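(* Let $s\geqslant0$. There is a constant $c_s>0$ depending only on $s$ such that for every $g\in B^s$ with $\operatorname{supp}(g)\subset\mathbb R_{x_1}\times(0,2)$, the solution $v$ of the problem $$ \begin{aligned} & iv_t+v_{x_1x_1}+v_{x_2x_2}=0, && (x_1,x_2,t)\in\mathbb R\times\mathbb R^+\times(0,2),\\ & v(x_1,x_2,0)=0, && (x_1,x_2)\in\mathbb R\times\overline{\mathbb R^+},\\ & v(x_1,0,t)=g(x_1,t), && (x_1,t)\in\mathbb R\times[0,2], \end{aligned} $$ given by the formula $$ v(x_1,x_2,t)=\frac{1}{(2\pi)^2}\int_{k_1\in\mathbb R}\int_{k_2\in\partial D}e^{ik_1x_1+ik_2x_2-i(k_1^2+k_2^2)t}\,2k_2\,\widehat g(k_1,-k_1^2-k_2^2)\,dk_2dk_1 $$ admits the estimate $$ \sup_{t\in[0,2]}\|v(t)\|_{H^s(\mathbb R_{x_1}\times\mathbb R_{x_2}^+)}\leqslant c_s\|g\|_{B^s}. $$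
   Context: $\mathbb R^+=(0,\infty)$. $H^s(\mathbb R\times\mathbb R^+)$ is the space of $f\in L^2(\mathbb R\times\mathbb R^+)$ with $\|f\|_{H^s(\mathbb R\times\mathbb R^+)}=\inf\{\|F\|_{H^s(\mathbb R^2)}: F|_{\mathbb R\times\mathbb R^+}=f\}<\infty$. $\widehat g(k_1,\tau)=\int_{\mathbb R}\int_{\mathbb R}e^{-ik_1x_1-i\tau t}g(x_1,t)\,dt\,dx_1$ is the spatiotemporal Fourier transform. The Bourgain space $X^{s,b}$ consists of the $g\in L^2(\mathbb R_{x_1}\times\mathbb R_t)$ with $$ \|g\|_{X^{s,b}}=\left(\int_{\mathbb R}\int_{\mathbb R}(1+k_1^2)^s(1+|\tau+k_1^2|)^{2b}|\widehat g(k_1,\tau)|^2\,d\tau\,dk_1\right)^{\frac12}<\infty, $$ and $B^s=X^{0,\frac{2s+1}{4}}\cap X^{s,\frac14}$ with $\|g\|_{B^s}=\|g\|_{X^{0,\frac{2s+1}{4}}}+\|g\|_{X^{s,\frac14}}$. $\partial D$ is the positively oriented boundary of the first quadrant $D$ of the complex $k_2$-plane (from $i\infty$ to $0$ along the imaginary axis, then from $0$ to $+\infty$ along the real axis); on $\partial D$ the number $-k_1^2-k_2^2$ is real. Integrals are interpreted in the usual $L^2$ sense for Fourier integrals. *)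

theory Defs
  imports "HOL-Complex_Analysis.Complex_Analysis"
begin

definition L2_on :: "(real \<times> real) set \<Rightarrow> (real \<times> real \<Rightarrow> complex) set" where
  "L2_on S = {f. set_borel_measurable lborel S f \<and>
                 set_integrable lborel S (\<lambda>z. (cmod (f z))\<^sup>2)}"

definition L2_limit ::
    "(real \<times> real) set \<Rightarrow> (nat \<Rightarrow> real \<times> real \<Rightarrow> complex) \<Rightarrow> (real \<times> real \<Rightarrow> complex) \<Rightarrow> bool" where
  "L2_limit S F f \<longleftrightarrow> f \<in> L2_on S \<and>
     (\<lambda>n. \<integral>\<^sup>+z\<in>S. ennreal ((cmod (F n z - f z))\<^sup>2) \<partial>lborel) \<longlonglongrightarrow> 0"

text \<open>
  The Fourier transform of a square integrable function is the \<open>L\<^sup>2\<close> limit of the integrals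
  over growing squares. It is determined only up to null sets; every later use is insensitive
  to the choice of the representative.
\<close>

definition fourier_trunc :: "nat \<Rightarrow> (real \<times> real \<Rightarrow> complex) \<Rightarrow> real \<times> real \<Rightarrow> complex" where
  "fourier_trunc n f = (\<lambda>(\<xi>, \<eta>).
     \<integral>(x, y)\<in>{-real n..real n} \<times> {-real n..real n}.
       exp (- \<i> * of_real \<xi> * of_real x - \<i> * of_real \<eta> * of_real y) * f (x, y) \<partial>lborel)"

definition fourier :: "(real \<times> real \<Rightarrow> complex) \<Rightarrow> real \<times> real \<Rightarrow> complex" where
  "fourier f = (SOME G. L2_limit UNIV (\<lambda>n. fourier_trunc n f) G)"

definition sobolev :: "real \<Rightarrow> (real \<times> real \<Rightarrow> complex) set" where
  "sobolev s = {F \<in> L2_on UNIV.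
     integrable lborel (\<lambda>(k1, k2). (1 + k1\<^sup>2 + k2\<^sup>2) powr s * (cmod (fourier F (k1, k2)))\<^sup>2)}"

definition sobolev_norm :: "real \<Rightarrow> (real \<times> real \<Rightarrow> complex) \<Rightarrow> real" where
  "sobolev_norm s F =
     sqrt (\<integral>(k1, k2). (1 + k1\<^sup>2 + k2\<^sup>2) powr s * (cmod (fourier F (k1, k2)))\<^sup>2 \<partial>lborel)"

definition half_plane :: "(real \<times> real) set" where
  "half_plane = UNIV \<times> {0<..}"

definition sobolev_extensions ::
    "real \<Rightarrow> (real \<times> real \<Rightarrow> complex) \<Rightarrow> (real \<times> real \<Rightarrow> complex) set" where
  "sobolev_extensions s f = {F \<in> sobolev s. AE z in lborel. z \<in> half_plane \<longrightarrow> F z = f z}"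

text \<open>The argument \<open>f\<close> is a total function of which only the values on the half-plane matter.\<close>

definition sobolev_half :: "real \<Rightarrow> (real \<times> real \<Rightarrow> complex) set" where
  "sobolev_half s = {f \<in> L2_on half_plane. sobolev_extensions s f \<noteq> {}}"

definition sobolev_half_norm :: "real \<Rightarrow> (real \<times> real \<Rightarrow> complex) \<Rightarrow> real" where
  "sobolev_half_norm s f = (INF F\<in>sobolev_extensions s f. sobolev_norm s F)"

text \<open>The arguments of \<open>g\<close> are \<open>(x\<^sub>1, t)\<close>, those of its transform \<open>(k\<^sub>1, \<tau>)\<close>.\<close>

definition bourgain_density ::
    "real \<Rightarrow> real \<Rightarrow> (real \<times> real \<Rightarrow> complex) \<Rightarrow> real \<times> real \<Rightarrow> real" where
  "bourgain_density s b g = (\<lambda>(k1, \<tau>).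
     (1 + k1\<^sup>2) powr s * (1 + \<bar>\<tau> + k1\<^sup>2\<bar>) powr (2 * b) * (cmod (fourier g (k1, \<tau>)))\<^sup>2)"

definition bourgain :: "real \<Rightarrow> real \<Rightarrow> (real \<times> real \<Rightarrow> complex) set" where
  "bourgain s b = {g \<in> L2_on UNIV. integrable lborel (bourgain_density s b g)}"

definition bourgain_norm :: "real \<Rightarrow> real \<Rightarrow> (real \<times> real \<Rightarrow> complex) \<Rightarrow> real" where
  "bourgain_norm s b g = sqrt (\<integral>z. bourgain_density s b g z \<partial>lborel)"

definition B_space :: "real \<Rightarrow> (real \<times> real \<Rightarrow> complex) set" where
  "B_space s = bourgain 0 ((2 * s + 1) / 4) \<inter> bourgain s (1 / 4)"

definition B_norm :: "real \<Rightarrow> (real \<times> real \<Rightarrow> complex) \<Rightarrow> real" where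
  "B_norm s g = bourgain_norm 0 ((2 * s + 1) / 4) g + bourgain_norm s (1 / 4) g"

text \<open>Support of an almost-everywhere class: the complement of the largest open set on which
  the function vanishes almost everywhere.\<close>

definition ess_supp :: "(real \<times> real \<Rightarrow> complex) \<Rightarrow> (real \<times> real) set" where
  "ess_supp g = - \<Union>{U. open U \<and> (AE z in lborel. z \<in> U \<longrightarrow> g z = 0)}"

text \<open>
  The part in the disc of radius \<open>R\<close> of the positively oriented boundary of the first quadrant:
  from \<open>\<i>R\<close> to 0, then from 0 to \<open>R\<close>.
\<close>

definition quadrant_boundary :: "real \<Rightarrow> real \<Rightarrow> complex" where
  "quadrant_boundary R = linepath (\<i> * of_real R) 0 +++ linepath 0 (of_real R)"

text \<open>
  The solution of \<open>i v\<^sub>t + v\<^sub>x\<^sub>1\<^sub>x\<^sub>1 + v\<^sub>x\<^sub>2\<^sub>x\<^sub>2 = 0\<close> in the half-plane with zero initial data and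
  boundary data \<open>v(x\<^sub>1, 0, t) = g(x\<^sub>1, t)\<close> is given by a double integral over \<open>k\<^sub>1 \<in> \<real>\<close> and
  \<open>k\<^sub>2\<close> on the whole quadrant boundary. The integral converges in the \<open>L\<^sup>2\<close> sense: for each
  \<open>t\<close> it is the limit, in \<open>L\<^sup>2\<close> of the half-plane, of the integrals over \<open>\<bar>k\<^sub>1\<bar> \<le> n\<close>,
  \<open>\<bar>k\<^sub>2\<bar> \<le> n\<close>. On the contour \<open>- k\<^sub>1\<^sup>2 - k\<^sub>2\<^sup>2\<close> is real, so that taking \<open>Re\<close> only changes its type.
\<close>

definition solution_trunc ::
    "(real \<times> real \<Rightarrow> complex) \<Rightarrow> real \<Rightarrow> nat \<Rightarrow> real \<times> real \<Rightarrow> complex" where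
  "solution_trunc g t n = (\<lambda>(x1, x2). 1 / (2 * of_real pi)\<^sup>2 *
     integral {-real n..real n} (\<lambda>k1.
       contour_integral (quadrant_boundary (real n)) (\<lambda>k2.
         exp (\<i> * of_real k1 * of_real x1 + \<i> * k2 * of_real x2
              - \<i> * ((of_real k1)\<^sup>2 + k2\<^sup>2) * of_real t)
         * (2 * k2) * fourier g (k1, Re (- (of_real k1)\<^sup>2 - k2\<^sup>2)))))"

definition solution_formula ::
    "(real \<times> real \<Rightarrow> complex) \<Rightarrow> (real \<Rightarrow> real \<times> real \<Rightarrow> complex) \<Rightarrow> bool" where
  "solution_formula g v \<longleftrightarrow> (\<forall>t\<in>{0..2}. L2_limit half_plane (solution_trunc g t) (v t))"

end

theory Submission
  imports Defs "HOL-Probability.Probability"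
begin

text \<open>
  On the real half-axis of the contour the solution formula is an inverse Fourier transform in
  the plane, with the density \<open>2 k\<^sub>2 h(k\<^sub>1, - k\<^sub>1\<^sup>2 - k\<^sub>2\<^sup>2)\<close> on \<open>k\<^sub>2 > 0\<close> times a phase, where
  \<open>h\<close> stands for the transform of \<open>g\<close>. Its Sobolev norm is therefore a weighted \<open>L\<^sup>2\<close> norm of
  this density, and the substitution \<open>\<tau> = - k\<^sub>1\<^sup>2 - k\<^sub>2\<^sup>2\<close> turns it into a weighted norm of
  \<open>h\<close>. The weight \<open>(1 + k\<^sub>1\<^sup>2 + k\<^sub>2\<^sup>2)\<^sup>s\<close> is at most a constant times the sum of
  \<open>(1 + k\<^sub>1\<^sup>2)\<^sup>s\<close> and \<open>(1 + |\<tau> + k\<^sub>1\<^sup>2|)\<^sup>s\<close>, and the factor \<open>k\<^sub>2\<close> that is left over is bounded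
  by \<open>(1 + |\<tau> + k\<^sub>1\<^sup>2|)\<close> to the power \<open>1/2\<close>: these are the two Bourgain norms
  (\<open>wave_amp_weight_le\<close>).

  On the imaginary half-axis \<open>k\<^sub>2 = i \<kappa>\<close> the exponential \<open>exp (i k\<^sub>2 x\<^sub>2)\<close> becomes
  \<open>exp (- \<kappa> x\<^sub>2)\<close>, and the density obeys the same bound. Here an extension to \<open>x\<^sub>2 < 0\<close> has to
  be chosen. The function \<open>exp (- y)\<close> on \<open>y > 0\<close> has an extension to the line with the rational
  Fourier transform \<open>2\<^sup>m / ((1 + iu) (1 - iu)\<^sup>m)\<close> (\<open>ext_symbol_inversion\<close>), and rescaling by
  \<open>\<kappa>\<close> extends every \<open>exp (- \<kappa> x\<^sub>2)\<close>. On the Fourier side the extension is then an integral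
  operator in \<open>\<kappa>\<close> with a kernel that is homogeneous of degree \<open>-1\<close>. For \<open>m \<ge> s\<close> its decay
  absorbs the Sobolev weight, and the kernel that remains is dominated by Hilbert's kernel
  \<open>1 / max \<kappa> |\<xi>|\<close>, which is bounded on \<open>L\<^sup>2\<close> (\<open>hilbert_schur\<close>, \<open>ext_op_weight_le\<close>). All real
  \<open>s \<ge> 0\<close> are treated at once.

  The truncated integrals of the formula are, on the half-plane, inverse transforms of
  integrable functions that converge in \<open>L\<^sup>2\<close> (\<open>solution_trunc_eq_ft\<close>); their limit is the
  restriction of the inverse transform of the limit. To compute the Sobolev norm of that
  extension, its Fourier transform has to be recovered. The transform of square integrable
  functions is built from the inequality \<open>sq_norm_ft_le\<close> (Gaussian damping) and completeness, and
  the inversion formula \<open>fourier_inversion\<close> is reduced, by testing against boxes, to Levy's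
  inversion theorem for a point mass.
\<close>

section \<open>Preliminaries on measurability and iterated integrals\<close>

lemma cis_measurable [measurable (raw)]:
  "f \<in> borel_measurable M \<Longrightarrow> (\<lambda>x. cis (f x)) \<in> borel_measurable M"
  by (rule measurable_compose[OF _ borel_measurable_continuous_onI[OF continuous_on_cis[OF
      continuous_on_id]]])

lemma cnj_borel_measurable [measurable (raw)]:
  "f \<in> borel_measurable M \<Longrightarrow> (\<lambda>x. cnj (f x)) \<in> borel_measurable M"
  by (rule measurable_compose[OF _ borel_measurable_continuous_onI]) (auto intro: continuous_intros)

lemma fst_borel_measurable [measurable (raw)]:
  fixes f :: "'a \<Rightarrow> 'b::second_countable_topology \<times> 'c::second_countable_topology"
  shows "f \<in> borel_measurable M \<Longrightarrow> (\<lambda>x. fst (f x)) \<in> borel_measurable M"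
  by (rule measurable_compose[OF _ borel_measurable_continuous_onI]) (auto intro: continuous_intros)

lemma snd_borel_measurable [measurable (raw)]:
  fixes f :: "'a \<Rightarrow> 'b::second_countable_topology \<times> 'c::second_countable_topology"
  shows "f \<in> borel_measurable M \<Longrightarrow> (\<lambda>x. snd (f x)) \<in> borel_measurable M"
  by (rule measurable_compose[OF _ borel_measurable_continuous_onI]) (auto intro: continuous_intros)

lemma pair_borel_measurable [measurable (raw)]:
  fixes f :: "'a \<Rightarrow> 'b::second_countable_topology" and g :: "'a \<Rightarrow> 'c::second_countable_topology"
  assumes "f \<in> borel_measurable M" "g \<in> borel_measurable M"
  shows "(\<lambda>x. (f x, g x)) \<in> borel_measurable M"
  using measurable_Pair[OF assms] by (simp add: borel_prod)

lemma ennreal_norm_integral_le: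
  fixes f :: "'a \<Rightarrow> 'b::{banach, second_countable_topology}"
  shows "ennreal (norm (\<integral>x. f x \<partial>M)) \<le> (\<integral>\<^sup>+x. ennreal (norm (f x)) \<partial>M)"
  by (cases "integrable M f") (auto simp: integral_norm_bound_ennreal not_integrable_integral_eq)

lemmas integral_cong_lborel = Bochner_Integration.integral_cong[OF refl[of lborel]]

lemma integrable_cis_mult:
  assumes "integrable M h" and [measurable]: "f \<in> borel_measurable M"
  shows "integrable M (\<lambda>x. cis (f x) * h x)"
  by (rule Bochner_Integration.integrable_bound[OF assms(1)])
    (use borel_measurable_integrable[OF assms(1)] in \<open>auto simp: norm_mult\<close>)

lemma nn_integral_plane:
  assumes [measurable]: "f \<in> borel_measurable (borel :: (real \<times> real) measure)"
  shows "(\<integral>\<^sup>+z. f z \<partial>lborel) = (\<integral>\<^sup>+k. (\<integral>\<^sup>+\<kappa>. f (k, \<kappa>) \<partial>lborel) \<partial>lborel)"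
proof -
  have "f \<in> borel_measurable (lborel \<Otimes>\<^sub>M lborel)" unfolding lborel_prod by measurable
  from lborel.nn_integral_fst[OF this] show ?thesis by (simp add: lborel_prod)
qed

lemma
  fixes f :: "real \<times> real \<Rightarrow> complex"
  assumes "integrable lborel f"
  shows integral_plane: "(\<integral>z. f z \<partial>lborel) = (\<integral>k. (\<integral>\<kappa>. f (k, \<kappa>) \<partial>lborel) \<partial>lborel)"
    and AE_integrable_plane: "AE k in lborel. integrable lborel (\<lambda>\<kappa>. f (k, \<kappa>))"
    and integrable_plane: "integrable lborel (\<lambda>k. \<integral>\<kappa>. f (k, \<kappa>) \<partial>lborel)"
proof -
  have int: "integrable (lborel \<Otimes>\<^sub>M lborel) (\<lambda>(k, \<kappa>). f (k, \<kappa>))" using assms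
    by (simp add: lborel_prod)
  show "(\<integral>z. f z \<partial>lborel) = (\<integral>k. (\<integral>\<kappa>. f (k, \<kappa>) \<partial>lborel) \<partial>lborel)"
    using lborel_pair.integral_fst[OF int] by (simp add: lborel_prod)
  show "AE k in lborel. integrable lborel (\<lambda>\<kappa>. f (k, \<kappa>))"
    using lborel_pair.AE_integrable_fst[OF int] .
  show "integrable lborel (\<lambda>k. \<integral>\<kappa>. f (k, \<kappa>) \<partial>lborel)"
    using lborel_pair.integrable_fst[OF int] .
qed

lemma
  fixes f g :: "real \<Rightarrow> complex"
  assumes "integrable lborel f" "integrable lborel g"
  shows integrable_prod_fun: "integrable lborel (\<lambda>z. f (fst z) * g (snd z))"
    and integral_prod_fun: "(\<integral>z. f (fst z) * g (snd z) \<partial>lborel)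
        = (\<integral>x. f x \<partial>lborel) * (\<integral>x. g x \<partial>lborel)"
proof -
  have [measurable]: "f \<in> borel_measurable borel" "g \<in> borel_measurable borel"
    using assms by (auto dest: borel_measurable_integrable)
  have int: "integrable (lborel \<Otimes>\<^sub>M lborel) (\<lambda>(x, y). f x * g y)"
  proof (rule lborel_pair.Fubini_integrable)
    have "integrable lborel (\<lambda>x. cmod (f x) * (\<integral>\<xi>. cmod (g \<xi>) \<partial>lborel))"
      using assms by (intro integrable_mult_left integrable_norm)
    then show "integrable lborel (\<lambda>x. \<integral>\<xi>. norm (case (x, \<xi>) of (x, \<xi>) \<Rightarrow> f x * g \<xi>) \<partial>lborel)"
      by (simp add: norm_mult)
  qed (use assms in auto)
  then show "integrable lborel (\<lambda>z. f (fst z) * g (snd z))"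
    by (simp add: lborel_prod case_prod_beta')
  show "(\<integral>z. f (fst z) * g (snd z) \<partial>lborel) = (\<integral>x. f x \<partial>lborel) * (\<integral>x. g x \<partial>lborel)"
    using lborel_pair.integral_fst[OF int] by (simp add: lborel_prod case_prod_beta')
qed

lemma nn_integral_translate:
  fixes f :: "real \<times> real \<Rightarrow> ennreal"
  assumes [measurable]: "f \<in> borel_measurable borel"
  shows "(\<integral>\<^sup>+u. f (c + u) \<partial>lborel) = (\<integral>\<^sup>+u. f u \<partial>lborel)"
  by (subst (2) lborel_distr_plus[symmetric, of c], subst nn_integral_distr) auto

lemma nn_integral_even:
  fixes g :: "real \<Rightarrow> ennreal"
  assumes [measurable]: "g \<in> borel_measurable borel"
  shows "(\<integral>\<^sup>+x. g \<bar>x\<bar> \<partial>lborel) = 2 * (\<integral>\<^sup>+x. g x * indicator {0<..} x \<partial>lborel)"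
proof -
  have "(\<integral>\<^sup>+x. g \<bar>x\<bar> \<partial>lborel) = (\<integral>\<^sup>+x. g \<bar>x\<bar> * indicator {0<..} x + g \<bar>x\<bar> * indicator {..<0} x
      \<partial>lborel)"
    using AE_lborel_singleton[of "0::real"]
    by (intro nn_integral_cong_AE, eventually_elim) (auto split: split_indicator)
  also have "\<dots> = (\<integral>\<^sup>+x. g \<bar>x\<bar> * indicator {0<..} x \<partial>lborel) + (\<integral>\<^sup>+x. g \<bar>x\<bar> * indicator {..<0} x
      \<partial>lborel)"
    by (rule nn_integral_add) auto
  also have "(\<integral>\<^sup>+x. g \<bar>x\<bar> * indicator {..<0} x \<partial>lborel)
      = (\<integral>\<^sup>+x. g \<bar>x\<bar> * indicator {0<..} x \<partial>lborel)"
    by (subst nn_integral_real_affine[where c="-1" and t=0]) (auto intro!: nn_integral_cong split: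
        split_indicator)
  also have "(\<integral>\<^sup>+x. g \<bar>x\<bar> * indicator {0<..} x \<partial>lborel) = (\<integral>\<^sup>+x. g x * indicator {0<..} x \<partial>lborel)"
    by (intro nn_integral_cong) (auto split: split_indicator)
  finally show ?thesis by (simp add: mult_2)
qed

lemma AE_negligible:
  assumes "AE x in lborel. P x"
  obtains N where "negligible N" "\<And>x. x \<notin> N \<Longrightarrow> P x"
proof -
  from assms obtain N where N: "{x \<in> space lborel. \<not> P x} \<subseteq> N" "emeasure lborel N
      = 0" "N \<in> sets lborel"
    by (rule AE_E)
  then have "N \<in> null_sets lborel" by auto
  then have "negligible N" by (simp add: negligible_iff_null_sets null_sets_completionI)
  then show thesis using N by (intro that[of N]) auto
qed

section \<open>Convergence in the quadratic mean\<close>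

definition sq_norm :: "'a measure \<Rightarrow> ('a \<Rightarrow> complex) \<Rightarrow> ennreal" where
  "sq_norm M f = (\<integral>\<^sup>+x. ennreal ((cmod (f x))\<^sup>2) \<partial>M)"

lemma sq_norm_cong_AE: "AE x in M. f x = g x \<Longrightarrow> sq_norm M f = sq_norm M g"
  unfolding sq_norm_def by (rule nn_integral_cong_AE) auto

lemma sq_norm_minus_commute: "sq_norm M (\<lambda>x. f x - g x) = sq_norm M (\<lambda>x. g x - f x)"
  by (simp add: sq_norm_def norm_minus_commute)

lemma sq_norm_cmult: "sq_norm M (\<lambda>x. c * f x) = ennreal ((cmod c)\<^sup>2) * sq_norm M f"
  if [measurable]: "f \<in> borel_measurable M"
  unfolding sq_norm_def
  by (subst nn_integral_cmult[symmetric]) (simp_all add: norm_mult power_mult_distrib ennreal_mult)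

lemma cmod_add_square_le: "(cmod (a + b))\<^sup>2 \<le> 2 * (cmod a)\<^sup>2 + 2 * (cmod b)\<^sup>2"
proof -
  have "(cmod (a + b))\<^sup>2 \<le> (cmod a + cmod b)\<^sup>2"
    by (intro power_mono norm_triangle_ineq) auto
  also have "\<dots> \<le> 2 * (cmod a)\<^sup>2 + 2 * (cmod b)\<^sup>2"
    using sum_squares_ge_zero[of "cmod a - cmod b" 0] by (simp add: power2_eq_square algebra_simps)
  finally show ?thesis .
qed

lemma sq_norm_add_le:
  assumes [measurable]: "f \<in> borel_measurable M" "g \<in> borel_measurable M"
  shows "sq_norm M (\<lambda>x. f x + g x) \<le> 2 * sq_norm M f + 2 * sq_norm M g"
proof -
  have "sq_norm M (\<lambda>x. f x + g x) \<le> (\<integral>\<^sup>+x. ennreal (2 * (cmod (f x))\<^sup>2 + 2 * (cmod (g x))\<^sup>2) \<partial>M)"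
    unfolding sq_norm_def by (intro nn_integral_mono ennreal_leI cmod_add_square_le)
  also have "\<dots> = 2 * sq_norm M f + 2 * sq_norm M g"
    unfolding sq_norm_def by (simp add: ennreal_plus ennreal_mult nn_integral_add nn_integral_cmult)
  finally show ?thesis .
qed

lemma sq_norm_diff_le:
  assumes [measurable]: "f \<in> borel_measurable M" "g \<in> borel_measurable M" "h \<in> borel_measurable M"
  shows "sq_norm M (\<lambda>x. f x - h x) \<le> 2 * sq_norm M (\<lambda>x. f x - g x) + 2 * sq_norm M (\<lambda>x. g x - h x)"
  using sq_norm_add_le[of "\<lambda>x. f x - g x" M "\<lambda>x. g x - h x"] by simp

lemma sq_norm_eq_0:
  assumes [measurable]: "f \<in> borel_measurable M"
  assumes "sq_norm M f = 0"
  shows "AE x in M. f x = 0"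
  using assms(2) unfolding sq_norm_def by (subst (asm) nn_integral_0_iff_AE) auto

lemma tendsto_0_ennreal_bound:
  fixes f g :: "'b \<Rightarrow> ennreal"
  assumes "(g \<longlongrightarrow> 0) F" "\<And>n. f n \<le> g n"
  shows "(f \<longlongrightarrow> 0) F"
  by (rule tendsto_sandwich[OF _ _ tendsto_const assms(1)]) (use assms(2) in auto)

lemma tendsto_0_ennreal_cmult:
  fixes f :: "'b \<Rightarrow> ennreal"
  assumes "(f \<longlongrightarrow> 0) F" "c < \<infinity>"
  shows "((\<lambda>n. c * f n) \<longlongrightarrow> 0) F"
  using ennreal_tendsto_cmult[of c f 0 F] assms by simp

lemma tendsto_0_ennreal_add:
  fixes f g :: "'b \<Rightarrow> ennreal"
  assumes "(f \<longlongrightarrow> 0) F" "(g \<longlongrightarrow> 0) F"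
  shows "((\<lambda>n. f n + g n) \<longlongrightarrow> 0) F"
  using tendsto_add[OF assms] by simp

lemma tendsto_0_sq_norm_trans:
  assumes [measurable]: "\<And>n. f n \<in> borel_measurable M" "\<And>n. g n \<in> borel_measurable M"
      "\<And>n. h n \<in> borel_measurable M"
  assumes "((\<lambda>n. sq_norm M (\<lambda>x. f n x - g n x)) \<longlongrightarrow> 0) F" "((\<lambda>n. sq_norm M (\<lambda>x. g n x - h n x)) \<longlongrightarrow> 0)
      F"
  shows "((\<lambda>n. sq_norm M (\<lambda>x. f n x - h n x)) \<longlongrightarrow> 0) F"
  by (rule tendsto_0_ennreal_bound[OF tendsto_0_ennreal_add[OF tendsto_0_ennreal_cmult[OF
      assms(4), of 2] tendsto_0_ennreal_cmult[OF assms(5), of 2]]])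
    (auto intro!: sq_norm_diff_le)

abbreviation mean_limit :: "'a measure \<Rightarrow> (nat \<Rightarrow> 'a \<Rightarrow> complex) \<Rightarrow> ('a \<Rightarrow> complex) \<Rightarrow> bool" where
  "mean_limit M F f \<equiv> (\<lambda>n. sq_norm M (\<lambda>x. F n x - f x)) \<longlonglongrightarrow> 0"

lemma sq_norm_limit_unique:
  assumes [measurable]: "\<And>n::nat. F n \<in> borel_measurable M" "f \<in> borel_measurable M"
      "g \<in> borel_measurable M"
  assumes f: "mean_limit M F f" and g: "mean_limit M F g"
  shows "AE x in M. f x = g x"
proof -
  have "(\<lambda>n::nat. sq_norm M (\<lambda>x. f x - g x)) \<longlonglongrightarrow> 0"
    by (rule tendsto_0_sq_norm_trans[where g=F]) (use f g in \<open>auto simp: sq_norm_minus_commute[of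
        M f]\<close>)
  then have "sq_norm M (\<lambda>x. f x - g x) = 0"
    by (simp add: LIMSEQ_const_iff)
  from sq_norm_eq_0[OF _ this] show ?thesis by auto
qed

text \<open>
  Fatou's lemma identifies a limit in the mean with a pointwise limit, without passing to
  subsequences.
\<close>

lemma sq_norm_limit_pointwise:
  assumes [measurable]: "\<And>n::nat. F n \<in> borel_measurable M" "f \<in> borel_measurable M"
      "g \<in> borel_measurable M"
  assumes f: "mean_limit M F f" and g: "AE x in M. (\<lambda>n. F n x) \<longlonglongrightarrow> g x"
  shows "AE x in M. f x = g x"
proof -
  have "sq_norm M (\<lambda>x. g x - f x) = (\<integral>\<^sup>+x. liminf (\<lambda>n. ennreal ((cmod (F n x - f x))\<^sup>2)) \<partial>M)"
    unfolding sq_norm_def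
  proof (rule nn_integral_cong_AE, use g in eventually_elim)
    fix x assume "(\<lambda>n. F n x) \<longlonglongrightarrow> g x"
    then have "(\<lambda>n. ennreal ((cmod (F n x - f x))\<^sup>2)) \<longlonglongrightarrow> ennreal ((cmod (g x - f x))\<^sup>2)"
      by (intro tendsto_intros tendsto_ennrealI)
    then show "ennreal ((cmod (g x - f x))\<^sup>2) = liminf (\<lambda>n. ennreal ((cmod (F n x - f x))\<^sup>2))"
      by (rule lim_imp_Liminf[symmetric, OF trivial_limit_sequentially])
  qed
  also have "\<dots> \<le> liminf (\<lambda>n. sq_norm M (\<lambda>x. F n x - f x))"
    unfolding sq_norm_def by (rule nn_integral_liminf) measurable
  also have "\<dots> = 0"
    using f by (simp add: lim_imp_Liminf)
  finally have "sq_norm M (\<lambda>x. g x - f x) = 0" by simp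
  from sq_norm_eq_0[OF _ this] show ?thesis by (auto elim: eventually_mono)
qed

text \<open>
  The Riesz--Fischer theorem: a rapidly convergent subsequence converges pointwise, and by
  Fatou's lemma the full sequence converges to the same limit in the mean.
\<close>

lemma sq_norm_complete:
  assumes [measurable]: "\<And>n::nat. F n \<in> borel_measurable M"
  assumes cauchy: "\<And>e. e > 0 \<Longrightarrow> \<exists>N. \<forall>m\<ge>N. \<forall>n\<ge>N. sq_norm M (\<lambda>x. F m x - F n x) \<le> ennreal e"
  obtains f where "f \<in> borel_measurable M" "mean_limit M F f"
proof -
  (* The squared increments of the subsequence decay like 16^-k, so that even their sum with
     the weights 4^k is integrable; where it is finite, the increments are summable. *)
  have "\<exists>N. \<forall>m\<ge>N. \<forall>n\<ge>N. sq_norm M (\<lambda>x. F m x - F n x) \<le> ennreal ((1/16)^k)" for k :: nat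
    using cauchy[of "(1/16)^k"] by auto
  then obtain N0 where N0: "\<And>k m n. m \<ge> N0 k \<Longrightarrow> n \<ge> N0 k \<Longrightarrow> sq_norm M (\<lambda>x. F m x - F n x)
      \<le> ennreal ((1/16)^k)"
    by metis
  define N where "N k = (\<Sum>j\<le>k. N0 j + 1)" for k
  have NN0: "N k \<ge> N0 k" for k unfolding N_def by (induction k) auto
  have N_Suc: "N (Suc k) = N k + N0 (Suc k) + 1" for k by (simp add: N_def)
  have Nk: "N k \<ge> k" for k by (induction k) (auto simp: N_Suc)
  define H where "H x = (\<Sum>k. ennreal (4^k * (cmod (F (N (Suc k)) x - F (N k) x))\<^sup>2))" for x
  have [measurable]: "H \<in> borel_measurable M" unfolding H_def by measurable
  have "(\<integral>\<^sup>+x. H x \<partial>M) = (\<Sum>k. ennreal (4^k) * sq_norm M (\<lambda>x. F (N (Suc k)) x - F (N k) x))"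
    unfolding H_def sq_norm_def by (subst nn_integral_suminf) (auto simp: ennreal_mult
        nn_integral_cmult)
  also have "\<dots> \<le> (\<Sum>k. ennreal ((1/4)^k))"
  proof (intro suminf_le summableI)
    fix k
    have "sq_norm M (\<lambda>x. F (N (Suc k)) x - F (N k) x) \<le> ennreal ((1/16)^k)"
      using NN0[of k] by (intro N0) (auto simp: N_Suc)
    then have "ennreal (4^k) * sq_norm M (\<lambda>x. F (N (Suc k)) x - F (N k) x)
        \<le> ennreal (4^k) * ennreal ((1/16)^k)"
      by (intro mult_left_mono) auto
    also have "\<dots> = ennreal (4^k * (1/16)^k)" by (simp add: ennreal_mult)
    also have "(4::real)^k * (1/16)^k = (1/4)^k" by (simp add: power_mult_distrib[symmetric])
    finally show "ennreal (4^k) * sq_norm M (\<lambda>x. F (N (Suc k)) x - F (N k) x) \<le> ennreal ((1/4)^k)" .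
  qed
  also have "\<dots> = ennreal (\<Sum>k. (1/4)^k)"
    by (rule suminf_ennreal2) (auto intro: summable_geometric)
  finally have "(\<integral>\<^sup>+x. H x \<partial>M) \<noteq> \<infinity>" by (auto simp: top_unique)
  then have Hfin: "AE x in M. H x \<noteq> \<infinity>" by (intro nn_integral_PInf_AE) auto
  have conv: "AE x in M. convergent (\<lambda>k. F (N k) x)"
    using Hfin
  proof eventually_elim
    fix x assume H: "H x \<noteq> \<infinity>"
    define h where "h = enn2real (H x)"
    have bound: "cmod (F (N (Suc k)) x - F (N k) x) \<le> sqrt h * (1/2)^k" for k
    proof -
      have "(\<Sum>j\<in>{k}. ennreal (4^j * (cmod (F (N (Suc j)) x - F (N j) x))\<^sup>2)) \<le> H x"
        unfolding H_def by (intro sum_le_suminf summableI) simp_all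
      then have "ennreal (4^k * (cmod (F (N (Suc k)) x - F (N k) x))\<^sup>2) \<le> H x"
        by (simp only: sum.insert_if sum.empty finite.emptyI empty_iff if_False add_0_right)
      also have "H x = ennreal h" using H by (simp add: h_def less_top)
      finally have "4^k * (cmod (F (N (Suc k)) x - F (N k) x))\<^sup>2 \<le> h"
        by (subst (asm) ennreal_le_iff) (auto simp: h_def)
      then have "sqrt (4^k * (cmod (F (N (Suc k)) x - F (N k) x))\<^sup>2) \<le> sqrt h" by simp
      moreover have "sqrt (4^k) = (2::real)^k" using real_sqrt_power[of 4 k] by simp
      ultimately have "2^k * cmod (F (N (Suc k)) x - F (N k) x)
          \<le> sqrt h" by (simp add: real_sqrt_mult)
      then show ?thesis by (simp add: field_simps)
    qed
    have "summable (\<lambda>k. F (N (Suc k)) x - F (N k) x)"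
      by (rule summable_comparison_test'[where g="\<lambda>k. sqrt h * (1/2)^k" and N=0])
        (use bound in \<open>auto intro!: summable_mult summable_geometric\<close>)
    then have "convergent (\<lambda>n. \<Sum>k<n. (F (N (Suc k)) x - F (N k) x))"
      by (simp add: summable_iff_convergent)
    then have "convergent (\<lambda>n. F (N n) x - F (N 0) x)"
      by (simp only: sum_lessThan_telescope[of "\<lambda>k. F (N k) x"])
    then show "convergent (\<lambda>k. F (N k) x)"
      using convergent_add[OF _ convergent_const[of "F (N 0) x"]] by fastforce
  qed
  define f where "f x = lim (\<lambda>k. F (N k) x)" for x
  have [measurable]: "f \<in> borel_measurable M" unfolding f_def by measurable
  have "mean_limit M F f"
  proof (rule tendsto_zero_ennreal)
    fix e :: real assume "0 < e"
    then obtain K where K: "\<And>m n. m \<ge> K \<Longrightarrow> n \<ge> K \<Longrightarrow> sq_norm M (\<lambda>x. F m x - F n x) \<le> ennreal (e/2)"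
      using cauchy[of "e/2"] by auto
    have "sq_norm M (\<lambda>x. F n x - f x) < ennreal e" if "n \<ge> K" for n
    proof -
      have "sq_norm M (\<lambda>x. F n x - f x)
          = (\<integral>\<^sup>+x. liminf (\<lambda>k. ennreal ((cmod (F n x - F (N k) x))\<^sup>2)) \<partial>M)"
        unfolding sq_norm_def
      proof (rule nn_integral_cong_AE, use conv in eventually_elim)
        fix x assume "convergent (\<lambda>k. F (N k) x)"
        then have "(\<lambda>k. F (N k) x) \<longlonglongrightarrow> f x" by (simp add: f_def convergent_LIMSEQ_iff)
        then have "(\<lambda>k. ennreal ((cmod (F n x - F (N k) x))\<^sup>2)) \<longlonglongrightarrow> ennreal ((cmod (F n x - f x))\<^sup>2)"
          by (intro tendsto_intros tendsto_ennrealI)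
        then show "ennreal ((cmod (F n x - f x))\<^sup>2)
            = liminf (\<lambda>k. ennreal ((cmod (F n x - F (N k) x))\<^sup>2))"
          by (rule lim_imp_Liminf[symmetric, OF trivial_limit_sequentially])
      qed
      also have "\<dots> \<le> liminf (\<lambda>k. sq_norm M (\<lambda>x. F n x - F (N k) x))"
        unfolding sq_norm_def by (rule nn_integral_liminf) measurable
      also have "\<dots> \<le> liminf (\<lambda>k::nat. ennreal (e/2))"
      proof (rule Liminf_mono)
        show "\<forall>\<^sub>F k in sequentially. sq_norm M (\<lambda>x. F n x - F (N k) x) \<le> ennreal (e / 2)"
          using eventually_ge_at_top[of K]
          by eventually_elim (use that Nk in \<open>auto intro!: K intro: order_trans\<close>)
      qed
      also have "\<dots> = ennreal (e/2)" by (simp add: Liminf_const)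
      also have "\<dots> < ennreal e" using \<open>0 < e\<close> by (simp add: ennreal_less_iff)
      finally show ?thesis .
    qed
    then show "\<forall>\<^sub>F n in sequentially. sq_norm M (\<lambda>x. F n x - f x) < ennreal e"
      by (auto simp: eventually_sequentially)
  qed
  then show thesis by (intro that[of f]) simp_all
qed

lemma sq_norm_Cauchy_of_limit:
  assumes [measurable]: "\<And>n::nat. F n \<in> borel_measurable M" "f \<in> borel_measurable M"
  assumes f: "mean_limit M F f" and "e > 0"
  shows "\<exists>N. \<forall>m\<ge>N. \<forall>n\<ge>N. sq_norm M (\<lambda>x. F m x - F n x) \<le> ennreal e"
proof -
  have "\<forall>\<^sub>F n in sequentially. sq_norm M (\<lambda>x. F n x - f x) < ennreal (e/4)"
    using order_tendstoD(2)[OF f, of "ennreal (e/4)"] \<open>e > 0\<close> by simp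
  then obtain N where N: "\<And>n. n \<ge> N \<Longrightarrow> sq_norm M (\<lambda>x. F n x - f x) \<le> ennreal (e/4)"
    unfolding eventually_sequentially using less_imp_le by metis
  have "sq_norm M (\<lambda>x. F m x - F n x) \<le> ennreal e" if "m \<ge> N" "n \<ge> N" for m n
  proof -
    have "sq_norm M (\<lambda>x. F m x - F n x) \<le> 2 * sq_norm M (\<lambda>x. F m x - f x) + 2 * sq_norm M
        (\<lambda>x. f x - F n x)"
      by (rule sq_norm_diff_le) auto
    also have "\<dots> \<le> 2 * ennreal (e/4) + 2 * ennreal (e/4)"
      using N[OF that(1)] N[OF that(2)]
      by (intro add_mono mult_left_mono) (auto simp: sq_norm_minus_commute[of M f])
    also have "\<dots> = ennreal (2 * (e/4)) + ennreal (2 * (e/4))"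
      using \<open>e > 0\<close> by (simp only: ennreal_mult' ennreal_numeral)
    also have "\<dots> = ennreal (2 * (e/4) + 2 * (e/4))"
      using \<open>e > 0\<close> by (subst ennreal_plus) auto
    finally show ?thesis by simp
  qed
  then show ?thesis by blast
qed

lemma sq_norm_limit_finite:
  assumes [measurable]: "\<And>n::nat. F n \<in> borel_measurable M" "f \<in> borel_measurable M"
  assumes f: "mean_limit M F f" and "\<And>n. sq_norm M (F n) < \<infinity>"
  shows "sq_norm M f < \<infinity>"
proof -
  have "\<forall>\<^sub>F n in sequentially. sq_norm M (\<lambda>x. F n x - f x) < 1"
    using order_tendstoD(2)[OF f, of 1] by simp
  then obtain n where n: "sq_norm M (\<lambda>x. F n x - f x) < 1" by (auto simp: eventually_sequentially)
  have "sq_norm M f \<le> 2 * sq_norm M (\<lambda>x. f x - F n x) + 2 * sq_norm M (\<lambda>x. F n x)"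
    using sq_norm_diff_le[of f M "F n" "\<lambda>_. 0"] by simp
  also have "\<dots> < \<infinity>" using n assms(4)[of n] sq_norm_minus_commute[of M f "F n"]
    by (auto simp: ennreal_mult_less_top intro: less_trans)
  finally show ?thesis .
qed

lemma nn_integral_mult_le_sq_norm:
  assumes [measurable]: "f \<in> borel_measurable M" "g \<in> borel_measurable M"
  shows "(\<integral>\<^sup>+x. ennreal (cmod (f x * g x)) \<partial>M)\<^sup>2 \<le> sq_norm M f * sq_norm M g"
  using Cauchy_Schwarz_nn_integral[of "\<lambda>x. ennreal (cmod (f x))" M "\<lambda>x. ennreal (cmod (g x))"]
  by (simp add: sq_norm_def norm_mult ennreal_mult ennreal_power)

lemma integrable_mult_sq_norm:
  assumes [measurable]: "f \<in> borel_measurable M" "g \<in> borel_measurable M"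
  assumes "sq_norm M f < \<infinity>" "sq_norm M g < \<infinity>"
  shows "integrable M (\<lambda>x. f x * g x)"
proof (rule integrableI_bounded)
  have "(\<integral>\<^sup>+x. ennreal (cmod (f x * g x)) \<partial>M)\<^sup>2 < \<infinity>"
    using nn_integral_mult_le_sq_norm[OF assms(1,2)] assms(3,4)
    by (auto simp: ennreal_mult_less_top intro: le_less_trans)
  then show "(\<integral>\<^sup>+x. ennreal (cmod (f x * g x)) \<partial>M) < \<infinity>"
    by (auto simp: power2_eq_square ennreal_mult_less_top less_top)
qed auto

text \<open>
  Strong convergence implies weak convergence, by the Cauchy--Schwarz inequality.
\<close>

lemma sq_norm_limit_weak:
  assumes [measurable]: "\<And>n::nat. F n \<in> borel_measurable M" "f \<in> borel_measurable M"
      "h \<in> borel_measurable M"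
  assumes f: "mean_limit M F f"
    and fin: "\<And>n. sq_norm M (F n) < \<infinity>" "sq_norm M h < \<infinity>"
  shows "(\<lambda>n. \<integral>x. F n x * h x \<partial>M) \<longlonglongrightarrow> (\<integral>x. f x * h x \<partial>M)"
proof -
  have ff: "sq_norm M f < \<infinity>" using sq_norm_limit_finite[OF _ _ f] fin by auto
  let ?e = "\<lambda>n. \<integral>\<^sup>+x. ennreal (cmod ((F n x - f x) * h x)) \<partial>M"
  have "(\<lambda>n. sq_norm M h * sq_norm M (\<lambda>x. F n x - f x)) \<longlonglongrightarrow> 0"
    by (rule tendsto_0_ennreal_cmult[OF f]) (use fin in auto)
  then have lim_sq: "(\<lambda>n. (?e n)\<^sup>2) \<longlonglongrightarrow> 0"
    by (rule tendsto_0_ennreal_bound) (subst mult.commute, rule nn_integral_mult_le_sq_norm, auto)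
  have "?e \<longlonglongrightarrow> 0"
  proof (rule tendsto_zero_ennreal)
    fix r :: real assume "0 < r"
    have "\<forall>\<^sub>F n in sequentially. (?e n)\<^sup>2 < ennreal (r\<^sup>2)"
      using order_tendstoD(2)[OF lim_sq, of "ennreal (r\<^sup>2)"] \<open>0 < r\<close> by simp
    then show "\<forall>\<^sub>F n in sequentially. ?e n < ennreal r"
    proof eventually_elim
      case (elim n)
      show ?case
      proof (rule ccontr)
        assume "\<not> ?e n < ennreal r"
        then have "(ennreal r)\<^sup>2 \<le> (?e n)\<^sup>2" by (intro power_mono) auto
        with elim \<open>0 < r\<close> show False by (simp add: ennreal_power)
      qed
    qed
  qed
  then have "(\<lambda>n. ennreal (cmod ((\<integral>x. F n x * h x \<partial>M) - (\<integral>x. f x * h x \<partial>M)))) \<longlonglongrightarrow> 0"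
  proof (rule tendsto_0_ennreal_bound)
    fix n
    have "(\<integral>x. F n x * h x \<partial>M) - (\<integral>x. f x * h x \<partial>M) = (\<integral>x. (F n x - f x) * h x \<partial>M)"
      using fin ff by (subst Bochner_Integration.integral_diff[symmetric])
          (auto intro!: integrable_mult_sq_norm simp: algebra_simps)
    then show "ennreal (cmod ((\<integral>x. F n x * h x \<partial>M) - (\<integral>x. f x * h x \<partial>M))) \<le> ?e n"
      by (simp add: ennreal_norm_integral_le)
  qed
  then have "(\<lambda>n. cmod ((\<integral>x. F n x * h x \<partial>M) - (\<integral>x. f x * h x \<partial>M))) \<longlonglongrightarrow> 0"
    by (simp add: ennreal_tendsto_0_iff)
  then show ?thesis by (simp add: LIM_zero_cancel tendsto_norm_zero_iff)
qed

section \<open>Square integrable functions in the plane\<close>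

abbreviation sq_norm2 :: "(real \<times> real \<Rightarrow> complex) \<Rightarrow> ennreal" where
  "sq_norm2 \<equiv> sq_norm lborel"

definition centred_square :: "nat \<Rightarrow> (real \<times> real) set" where
  "centred_square n = {-real n..real n} \<times> {-real n..real n}"

definition cut_off :: "nat \<Rightarrow> (real \<times> real \<Rightarrow> complex) \<Rightarrow> real \<times> real \<Rightarrow> complex" where
  "cut_off n f = (\<lambda>z. indicator (centred_square n) z *\<^sub>R f z)"

lemma centred_square_sets [measurable]: "centred_square n \<in> sets borel"
  unfolding centred_square_def by (intro borel_closed closed_Times) auto

lemma emeasure_centred_square: "emeasure lborel (centred_square n) < \<infinity>"
  unfolding centred_square_def by (intro emeasure_compact_finite compact_Times) auto

lemma cut_measurable [measurable]: "f \<in> borel_measurable borel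
    \<Longrightarrow> cut_off n f \<in> borel_measurable borel"
  unfolding cut_off_def by measurable

lemma sq_norm_cut_le: "sq_norm2 (cut_off n f) \<le> sq_norm2 f"
  unfolding sq_norm_def cut_off_def by (intro nn_integral_mono) (auto split: split_indicator)

lemma cut_limit:
  assumes [measurable]: "f \<in> borel_measurable borel" and "sq_norm2 f < \<infinity>"
  shows "mean_limit lborel (\<lambda>n. cut_off n f) f"
proof -
  have "(\<lambda>n. sq_norm2 (\<lambda>z. cut_off n f z - f z)) \<longlonglongrightarrow> (\<integral>\<^sup>+z. 0 \<partial>(lborel :: (real \<times> real) measure))"
    unfolding sq_norm_def
  proof (rule nn_integral_dominated_convergence[where w="\<lambda>z. ennreal ((cmod (f z))\<^sup>2)"])
    show "AE z in lborel. (\<lambda>n. ennreal ((cmod (cut_off n f z - f z))\<^sup>2)) \<longlonglongrightarrow> 0"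
    proof (rule AE_I2)
      fix z :: "real \<times> real"
      obtain N :: nat where N: "max \<bar>fst z\<bar> \<bar>snd z\<bar> \<le> real N" using real_arch_simple by blast
      have "z \<in> centred_square n" if "n \<ge> N" for n
        using N that by (cases z) (auto simp: centred_square_def)
      then have "\<forall>\<^sub>F n in sequentially. ennreal ((cmod (cut_off n f z - f z))\<^sup>2) = 0"
        unfolding eventually_sequentially cut_off_def by (intro exI[of _ N]) auto
      then show "(\<lambda>n. ennreal ((cmod (cut_off n f z - f z))\<^sup>2)) \<longlonglongrightarrow> 0"
        by (rule tendsto_eventually)
    qed
    show "AE z in lborel. ennreal ((cmod (cut_off n f z - f z))\<^sup>2) \<le> ennreal ((cmod (f z))\<^sup>2)" for n
      by (auto simp: cut_off_def split: split_indicator)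
  qed (use assms(2) in \<open>auto simp: sq_norm_def\<close>)
  then show ?thesis by simp
qed

lemma sq_norm_indicator_centred_square: "sq_norm2 (\<lambda>z. indicator (centred_square n) z) < \<infinity>"
proof -
  have "sq_norm2 (\<lambda>z. indicator (centred_square n) z)
      = (\<integral>\<^sup>+z. indicator (centred_square n) z \<partial>lborel)"
    unfolding sq_norm_def by (intro nn_integral_cong) (auto split: split_indicator)
  then show ?thesis using emeasure_centred_square by simp
qed

lemma integrable_cut:
  assumes [measurable]: "f \<in> borel_measurable borel" and "sq_norm2 f < \<infinity>"
  shows "integrable lborel (cut_off n f)"
proof -
  have "integrable lborel (\<lambda>z. indicator (centred_square n) z * f z)"
    by (rule integrable_mult_sq_norm) (use assms sq_norm_indicator_centred_square in auto)
  moreover have "(\<lambda>z. indicator (centred_square n) z * f z) = cut_off n f"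
    by (auto simp: cut_off_def fun_eq_iff split: split_indicator)
  ultimately show ?thesis by simp
qed

text \<open>
  Boxes generate the Borel sets and are stable under intersection, so vanishing integrals over
  boxes force all integrals over Borel subsets of a large box to vanish.
\<close>

lemma AE_zero_of_boxes:
  fixes u :: "real \<times> real \<Rightarrow> complex"
  assumes [measurable]: "u \<in> borel_measurable borel" and fin: "sq_norm2 u < \<infinity>"
    and box0: "\<And>a b. (\<integral>z. u z * indicator (box a b) z \<partial>lborel) = 0"
  shows "AE z in lborel. u z = 0"
proof -
  (* u is localised to the boxes Q n, where it is integrable and Dynkin's lemma applies. *)
  define Q where "Q n = box (- real n, - real n) (real n, real n)" for n
  have Qsub: "Q n \<subseteq> centred_square n" for n by (auto simp: Q_def centred_square_def box_prod)
  have "AE z in lborel. indicator (Q n) z *\<^sub>R u z = 0" for n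
  proof (rule sigma_finite_measure.density_zero[OF lborel.sigma_finite_measure_axioms])
    have [measurable]: "Q n \<in> sets borel" by (simp add: Q_def)
    have eq: "(\<lambda>z. indicator (Q n) z *\<^sub>R u z) = (\<lambda>z. indicator (Q n) z *\<^sub>R cut_off n u z)"
      using Qsub[of n] by (auto simp: cut_off_def fun_eq_iff split: split_indicator)
    show int: "integrable lborel (\<lambda>z. indicator (Q n) z *\<^sub>R u z)"
      unfolding eq by (intro integrable_mult_indicator integrable_cut assms(1,2)) simp
    let ?u = "\<lambda>z. indicator (Q n) z *\<^sub>R u z"
    have sint: "set_integrable lborel A ?u" if "A \<in> sets borel" for A
      unfolding set_integrable_def by (rule integrable_mult_indicator[OF _ int]) (use that in auto)
    have all0: "(\<integral>z. ?u z \<partial>lborel) = 0"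
      using box0[of "(- real n, - real n)" "(real n, real n)"]
      by (simp add: Q_def scaleR_conv_of_real mult.commute of_real_indicator)
    fix A :: "(real \<times> real) set" assume "A \<in> sets lborel"
    then have A: "A \<in> sigma_sets UNIV (range (\<lambda>(a, b). box a b))"
      by (simp add: borel_eq_box)
    have stable: "Int_stable (range (\<lambda>(a, b). box a b :: (real \<times> real) set))"
      by (auto simp: Int_stable_def box_Int_box)
    have sub: "range (\<lambda>(a, b). box a b) \<subseteq> Pow (UNIV :: (real \<times> real) set)" by simp
    from stable sub A show "(LINT z:A|lborel. ?u z) = 0"
    proof (induction rule: sigma_sets_induct_disjoint)
      case (basic A)
      then obtain a b where A: "A = box a b" by auto
      obtain c d where cd: "A \<inter> Q n = box c d" by (auto simp: A Q_def box_Int_box)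
      have "(LINT z:A|lborel. ?u z) = (\<integral>z. u z * indicator (A \<inter> Q n) z \<partial>lborel)"
        unfolding set_lebesgue_integral_def
        by (intro Bochner_Integration.integral_cong) (auto split: split_indicator)
      then show ?case by (simp add: cd box0)
    next
      case empty then show ?case by (simp add: set_lebesgue_integral_def)
    next
      case (compl A)
      then have [measurable]: "A \<in> sets borel" by (simp add: borel_eq_box)
      have "(LINT z:UNIV - A|lborel. ?u z) = (\<integral>z. ?u z - indicator A z *\<^sub>R ?u z \<partial>lborel)"
        unfolding set_lebesgue_integral_def
        by (intro Bochner_Integration.integral_cong) (auto split: split_indicator)
      also have "\<dots> = (\<integral>z. ?u z \<partial>lborel) - (\<integral>z. indicator A z *\<^sub>R ?u z \<partial>lborel)"
        by (rule Bochner_Integration.integral_diff[OF int integrable_mult_indicator[OF _ int]]) auto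
      also have "\<dots> = 0" using compl.IH all0 by (simp add: set_lebesgue_integral_def)
      finally show ?case .
    next
      case (union A)
      then have "A i \<in> sigma_sets UNIV (range (\<lambda>(a, b). box a b))" for i by blast
      then have A: "A i \<in> sets borel" for i by (simp add: borel_eq_box)
      have "(LINT z:(\<Union>i. A i)|lborel. ?u z) = (\<Sum>i. (LINT z:A i|lborel. ?u z))"
        using union A by (intro lebesgue_integral_countable_add sint)
            (auto simp: disjoint_family_on_def)
      then show ?case by (simp add: union.IH)
    qed
  qed
  then have "AE z in lborel. \<forall>n. indicator (Q n) z *\<^sub>R u z = 0"
    by (subst AE_all_countable) auto
  then show ?thesis
  proof eventually_elim
    fix z assume *: "\<forall>n. indicator (Q n) z *\<^sub>R u z = 0"
    obtain N :: nat where N: "max \<bar>fst z\<bar> \<bar>snd z\<bar> < real N" using reals_Archimedean2 by blast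
    then have "z \<in> Q N" by (cases z) (auto simp: Q_def box_prod)
    then show "u z = 0" using *[rule_format, of N] by simp
  qed
qed

lemma L2_limit_UNIV_iff:
  "L2_limit UNIV F f \<longleftrightarrow> f \<in> borel_measurable borel \<and> sq_norm2 f < \<infinity> \<and> mean_limit lborel F f"
  unfolding L2_limit_def L2_on_def set_borel_measurable_def set_integrable_def sq_norm_def
  by (auto simp: integrable_iff_bounded)

lemma L2_on_UNIV_iff: "f \<in> L2_on UNIV \<longleftrightarrow> f \<in> borel_measurable borel \<and> sq_norm2 f < \<infinity>"
  unfolding L2_on_def set_borel_measurable_def set_integrable_def sq_norm_def
  by (auto simp: integrable_iff_bounded)

lemma half_plane_sets [measurable]: "half_plane \<in> sets borel"
  unfolding half_plane_def by (intro borel_open open_Times) auto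

abbreviation on_half :: "(real \<times> real \<Rightarrow> complex) \<Rightarrow> real \<times> real \<Rightarrow> complex" where
  "on_half f z \<equiv> indicator half_plane z *\<^sub>R f z"

lemma sq_norm_half_plane_le: "sq_norm2 (on_half f) \<le> sq_norm2 f"
  unfolding sq_norm_def by (intro nn_integral_mono) (auto split: split_indicator)

lemma L2_limit_half_plane_iff:
  "L2_limit half_plane F f \<longleftrightarrow> f \<in> L2_on half_plane \<and>
    mean_limit lborel (\<lambda>n. on_half (F n)) (on_half f)"
proof -
  have "(\<integral>\<^sup>+z\<in>half_plane. ennreal ((cmod (F n z - f z))\<^sup>2) \<partial>lborel)
      = sq_norm2 (\<lambda>z. on_half (F n) z - on_half f z)" for n
    unfolding sq_norm_def by (intro nn_integral_cong) (auto split: split_indicator)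
  then show ?thesis by (simp add: L2_limit_def)
qed

lemma L2_on_half_plane_iff:
  "f \<in> L2_on half_plane \<longleftrightarrow> (on_half f) \<in> borel_measurable borel \<and> sq_norm2 (on_half f) < \<infinity>"
proof -
  have eq: "(\<lambda>z. ennreal (norm (indicator half_plane z *\<^sub>R (cmod (f z))\<^sup>2)))
      = (\<lambda>z. ennreal ((cmod (on_half f z))\<^sup>2))"
    by (auto simp: fun_eq_iff split: split_indicator)
  have "(\<lambda>z. indicator half_plane z *\<^sub>R (cmod (f z))\<^sup>2) \<in> borel_measurable borel"
    if [measurable]: "(on_half f) \<in> borel_measurable borel"
  proof -
    have "(\<lambda>z. (cmod (on_half f z))\<^sup>2) \<in> borel_measurable borel" by measurable
    moreover have "(\<lambda>z. (cmod (on_half f z))\<^sup>2) = (\<lambda>z. indicator half_plane z *\<^sub>R (cmod (f z))\<^sup>2)"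
      by (auto simp: fun_eq_iff split: split_indicator)
    ultimately show ?thesis by simp
  qed
  then show ?thesis
    unfolding L2_on_def set_borel_measurable_def set_integrable_def sq_norm_def mem_Collect_eq
        integrable_iff_bounded eq
    by auto
qed

lemma L2_limit_half_plane_unique:
  assumes "L2_limit half_plane S v" "L2_limit half_plane S w"
    and meas: "\<And>n. on_half (S n) \<in> borel_measurable borel"
  shows "AE z in lborel. z \<in> half_plane \<longrightarrow> v z = w z"
proof -
  have "AE z in lborel. on_half v z = on_half w z"
    by (rule sq_norm_limit_unique[of "\<lambda>n z. on_half (S n) z"])
      (use assms in \<open>auto simp: L2_limit_half_plane_iff L2_on_half_plane_iff\<close>)
  then show ?thesis by eventually_elim (auto split: split_indicator_asm)
qed

section \<open>Fourier integrals and the Bessel inequality\<close>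

text \<open>
  The values \<open>c = -1\<close> and \<open>c = 1\<close> are the Fourier transform and its unnormalised inverse.
\<close>

definition ft :: "real \<Rightarrow> (real \<times> real \<Rightarrow> complex) \<Rightarrow> real \<times> real \<Rightarrow> complex" where
  "ft c h \<xi> = (\<integral>x. cis (c * (\<xi> \<bullet> x)) * h x \<partial>lborel)"

lemma ft_measurable [measurable]:
  assumes [measurable]: "h \<in> borel_measurable borel"
  shows "ft c h \<in> borel_measurable borel"
  unfolding ft_def[abs_def] by measurable

lemma ft_add: "integrable lborel f \<Longrightarrow> integrable lborel h \<Longrightarrow> ft c (\<lambda>x. f x + h x) \<xi>
    = ft c f \<xi> + ft c h \<xi>"
  unfolding ft_def by (simp add: distrib_left integrable_cis_mult)

lemma ft_diff: "integrable lborel f \<Longrightarrow> integrable lborel h \<Longrightarrow> ft c (\<lambda>x. f x - h x) \<xi>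
    = ft c f \<xi> - ft c h \<xi>"
  unfolding ft_def by (simp add: right_diff_distrib integrable_cis_mult)

text \<open>
  The multiplication formula, by Fubini.
\<close>

lemma ft_swap:
  assumes "integrable lborel f" "integrable lborel h"
  shows "(\<integral>\<xi>. ft c f \<xi> * h \<xi> \<partial>lborel) = (\<integral>x. f x * ft c h x \<partial>lborel)"
proof -
  have [measurable]: "f \<in> borel_measurable borel" "h \<in> borel_measurable borel"
    using assms by (auto dest: borel_measurable_integrable)
  have int: "integrable (lborel \<Otimes>\<^sub>M lborel) (\<lambda>(x, \<xi>). cis (c * (\<xi> \<bullet> x)) * f x * h \<xi>)"
  proof (rule lborel_pair.Fubini_integrable)
    have "integrable lborel (\<lambda>x. cmod (f x) * (\<integral>\<xi>. cmod (h \<xi>) \<partial>lborel))"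
      using assms by (intro integrable_mult_left integrable_norm)
    then show "integrable lborel (\<lambda>x. \<integral>\<xi>. norm (case (x, \<xi>) of (x, \<xi>) \<Rightarrow> cis (c * (\<xi> \<bullet> x)) * f x *
        h \<xi>) \<partial>lborel)"
      by (simp add: norm_mult)
    show "AE x in lborel. integrable lborel (\<lambda>\<xi>. case (x, \<xi>) of (x, \<xi>) \<Rightarrow> cis (c * (\<xi> \<bullet> x)) * f x *
        h \<xi>)"
      using integrable_cis_mult[OF integrable_mult_right[OF assms(2)]] by (auto simp: mult.assoc)
  qed simp
  have "(\<integral>\<xi>. ft c f \<xi> * h \<xi> \<partial>lborel) = (\<integral>\<xi>. (\<integral>x. cis (c * (\<xi> \<bullet> x)) * f x * h \<xi> \<partial>lborel) \<partial>lborel)"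
    unfolding ft_def by simp
  also have "\<dots> = (\<integral>x. (\<integral>\<xi>. cis (c * (\<xi> \<bullet> x)) * f x * h \<xi> \<partial>lborel) \<partial>lborel)"
    by (rule lborel_pair.Fubini_integral[OF int])
  also have "\<dots> = (\<integral>x. f x * ft c h x \<partial>lborel)"
    unfolding ft_def by (simp flip: integral_mult_right_zero add: mult_ac inner_commute)
  finally show ?thesis .
qed

definition gauss :: "real \<Rightarrow> real \<Rightarrow> real" where
  "gauss a \<xi> = exp (- (a * \<xi>)\<^sup>2 / 2)"

lemma gauss_measurable [measurable]: "gauss a \<in> borel_measurable borel"
  unfolding gauss_def[abs_def] by measurable

lemma gauss_eq_normal_density:
  assumes "a > 0" shows "gauss a \<xi> = sqrt (2 * pi) / a * normal_density 0 (1/a) \<xi>"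
  using assms by (simp add: gauss_def normal_density_def real_sqrt_divide real_sqrt_mult
      power_divide field_simps)

lemma integrable_gauss:
  assumes "a > 0" shows "integrable lborel (gauss a)"
proof -
  have "integrable lborel (\<lambda>\<xi>. sqrt (2 * pi) / a * normal_density 0 (1/a) \<xi>)"
    using assms by (intro integrable_mult_right integrable_normal_density) auto
  then show ?thesis by (simp only: gauss_eq_normal_density[OF assms, symmetric])
qed

text \<open>
  The characteristic function of the normal distribution, rescaled.
\<close>

lemma fourier_gauss:
  assumes "a > 0"
  shows "(\<integral>\<xi>. cis (u * \<xi>) * of_real (gauss a \<xi>) \<partial>lborel) = of_real (2 * pi * normal_density 0 a u)"
proof -
  have "(\<integral>\<xi>. cis (u * \<xi>) * of_real (gauss a \<xi>) \<partial>lborel)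
      = (1/a) *\<^sub>R (\<integral>x. cis (u * (x / a)) * of_real (gauss a (x / a)) \<partial>lborel)"
    using lborel_integral_real_affine[of "1/a" "\<lambda>\<xi>. cis (u * \<xi>) * of_real (gauss a \<xi>)" 0] assms
    by simp
  also have "(\<integral>x. cis (u * (x / a)) * of_real (gauss a (x / a)) \<partial>lborel)
     = (\<integral>x. sqrt (2 * pi) *\<^sub>R (std_normal_density x *\<^sub>R iexp (u / a * x)) \<partial>lborel)"
    using assms by (intro integral_cong_lborel)
      (simp add: gauss_def std_normal_density_def cis_conv_exp scaleR_conv_of_real mult_ac)
  also have "\<dots> = sqrt (2 * pi) *\<^sub>R (\<integral>x. std_normal_density x *\<^sub>R iexp (u / a * x) \<partial>lborel)"
    by (rule integral_scaleR_right)
  also have "\<dots> = sqrt (2 * pi) *\<^sub>R char std_normal_distribution (u / a)"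
    unfolding char_def by (subst integral_density) (auto simp: normal_density_nonneg)
  also have "(1/a) *\<^sub>R (sqrt (2 * pi) *\<^sub>R char std_normal_distribution (u / a))
      = of_real (2 * pi * normal_density 0 a u)"
  proof -
    have "2 * pi = sqrt (2 * pi) * sqrt (2 * pi)" by simp
    then have "2 * pi * normal_density 0 a u = (1 / a) * sqrt (2 * pi) * exp (- (u / a)\<^sup>2 / 2)"
      using assms by (simp add: normal_density_def real_sqrt_mult field_simps power_divide)
    then show ?thesis
      by (simp add: char_std_normal_distribution scaleR_conv_of_real)
  qed
  finally show ?thesis .
qed

definition plane_gauss :: "real \<Rightarrow> real \<times> real \<Rightarrow> real" where
  "plane_gauss a \<xi> = gauss a (fst \<xi>) * gauss a (snd \<xi>)"

definition heat_kernel :: "real \<Rightarrow> real \<times> real \<Rightarrow> real" where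
  "heat_kernel a u = (2 * pi)\<^sup>2 * (normal_density 0 a (fst u) * normal_density 0 a (snd u))"

lemma plane_gauss_measurable [measurable]: "plane_gauss a \<in> borel_measurable borel"
  unfolding plane_gauss_def[abs_def] by measurable

lemma heat_kernel_measurable [measurable]: "heat_kernel a \<in> borel_measurable borel"
  unfolding heat_kernel_def[abs_def] by measurable

lemma heat_kernel_nonneg: "0 \<le> heat_kernel a u" by (simp add: heat_kernel_def)

lemma plane_gauss_nonneg: "0 \<le> plane_gauss a u" by (simp add: plane_gauss_def gauss_def)

lemma integrable_plane_gauss:
  assumes "a > 0" shows "integrable lborel (\<lambda>\<xi>. complex_of_real (plane_gauss a \<xi>))"
  using integrable_prod_fun[OF integrable_of_real integrable_of_real, OF integrable_gauss
      integrable_gauss, OF assms assms]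
  by (simp add: plane_gauss_def)

lemma ft_plane_gauss:
  assumes "a > 0"
  shows "ft c (\<lambda>\<xi>. of_real (plane_gauss a \<xi>)) u = of_real (heat_kernel a (c *\<^sub>R u))"
proof -
  have int: "integrable lborel (\<lambda>\<xi>. cis (u * \<xi>) * complex_of_real (gauss a \<xi>))" for u
    by (intro integrable_cis_mult integrable_of_real integrable_gauss assms) auto
  have "ft c (\<lambda>\<xi>. of_real (plane_gauss a \<xi>)) u
      = (\<integral>\<xi>. (cis (c * fst u * fst \<xi>) * of_real (gauss a (fst \<xi>))) * (cis (c * snd u * snd \<xi>) *
      of_real (gauss a (snd \<xi>))) \<partial>lborel)"
    unfolding ft_def
    by (intro integral_cong_lborel) (simp add: plane_gauss_def inner_prod_def distrib_left mult_ac
        flip: cis_mult)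
  also have "\<dots> = of_real (heat_kernel a (c *\<^sub>R u))"
    unfolding integral_prod_fun[OF int int] fourier_gauss[OF assms] of_real_mult[symmetric]
        of_real_eq_iff
    by (simp add: heat_kernel_def power2_eq_square)
  finally show ?thesis .
qed

lemma nn_integral_heat_kernel:
  assumes "a > 0"
  shows "(\<integral>\<^sup>+u. ennreal (heat_kernel a u) \<partial>lborel) = ennreal ((2 * pi)\<^sup>2)"
proof -
  have N: "(\<integral>\<^sup>+x. ennreal (normal_density 0 a x) \<partial>lborel) = 1"
    using assms by (subst nn_integral_eq_integral) auto
  have "(\<integral>\<^sup>+u. ennreal (heat_kernel a u) \<partial>lborel)
      = (\<integral>\<^sup>+u. ennreal ((2*pi)\<^sup>2) * (ennreal (normal_density 0 a (fst u)) * ennreal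
      (normal_density 0 a (snd u))) \<partial>(lborel \<Otimes>\<^sub>M lborel))"
    by (simp add: lborel_prod heat_kernel_def ennreal_mult)
  also have "\<dots> = ennreal ((2 * pi)\<^sup>2) * (\<integral>\<^sup>+u. ennreal (normal_density 0 a (fst u)) * ennreal
      (normal_density 0 a (snd u)) \<partial>(lborel \<Otimes>\<^sub>M lborel))"
    by (rule nn_integral_cmult) measurable
  also have "(\<integral>\<^sup>+u. ennreal (normal_density 0 a (fst u)) * ennreal (normal_density 0 a (snd u))
      \<partial>(lborel \<Otimes>\<^sub>M lborel)) = 1"
    by (subst lborel.nn_integral_fst[symmetric]) (auto simp: nn_integral_cmult N)
  finally show ?thesis by simp
qed

text \<open>
  \<open>|h x| |h y| \<le> (|h x|\<^sup>2 + |h y|\<^sup>2) / 2\<close>, and the integral of the kernel over one variable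
  does not depend on the other.
\<close>

lemma nn_integral_schur_convolution:
  assumes [measurable]: "h \<in> borel_measurable borel" "K \<in> borel_measurable (borel :: (real \<times> real)
      measure)"
  assumes nonneg: "\<And>u. K u \<ge> 0" and even: "\<And>u. K (- u) = K u" and "(\<integral>\<^sup>+u. ennreal (K u) \<partial>lborel)
      = C"
  shows "(\<integral>\<^sup>+x. (\<integral>\<^sup>+y. ennreal (cmod (h x) * cmod (h y) * K (x - y)) \<partial>lborel) \<partial>lborel)
      \<le> C * sq_norm2 h"
proof -
  let ?u = "\<lambda>x y. ennreal (1/2) * (ennreal ((cmod (h x))\<^sup>2) * ennreal (K (x - y)))"
  let ?v = "\<lambda>x y. ennreal (1/2) * (ennreal ((cmod (h y))\<^sup>2) * ennreal (K (x - y)))"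
  let ?w = "\<lambda>x y. ennreal (cmod (h x) * cmod (h y) * K (x - y))"
  have C: "(\<integral>\<^sup>+y. ennreal (K (x - y)) \<partial>lborel) = C" for x
  proof -
    have "(\<integral>\<^sup>+y. ennreal (K (x - y)) \<partial>lborel) = (\<integral>\<^sup>+y. ennreal (K (- x + y)) \<partial>lborel)"
      using even[of "x - y" for y] by simp
    then show ?thesis using nn_integral_translate[of "\<lambda>u. ennreal (K u)" "-x"] assms(5) by simp
  qed
  have C': "(\<integral>\<^sup>+y. ennreal (K (y - x)) \<partial>lborel) = C" for x
    using C[of x] even[of "x - y" for y] by simp
  have le: "(?w x y) \<le>
      (?u x y) + (?v x y)" for x y
  proof -
    have half: "(0::real) \<le> 1/2" by simp
    have "cmod (h x) * cmod (h y) \<le> (cmod (h x))\<^sup>2 / 2 + (cmod (h y))\<^sup>2 / 2"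
      using sum_squares_ge_zero[of "cmod (h x) - cmod (h y)" 0]
      by (simp add: power2_eq_square algebra_simps)
    then have "cmod (h x) * cmod (h y) * K (x - y) \<le> ((cmod (h x))\<^sup>2 / 2 + (cmod (h y))\<^sup>2 / 2) * K
        (x - y)"
      by (intro mult_right_mono nonneg)
    also have "\<dots> = 1/2 * ((cmod (h x))\<^sup>2 * K (x - y)) + 1/2 * ((cmod (h y))\<^sup>2 * K (x - y))"
      by (simp add: algebra_simps)
    finally have "(?w x y) \<le> ennreal (1/2 * ((cmod (h x))\<^sup>2 * K (x - y)) + 1/2 *
        ((cmod (h y))\<^sup>2 * K (x - y)))"
      by (rule ennreal_leI)
    also have "\<dots> = (?u x y) + (?v x y)"
      using half by (simp only: ennreal_plus ennreal_mult mult_nonneg_nonneg zero_le_power2 nonneg)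
    finally show ?thesis .
  qed
  have "(\<integral>\<^sup>+x. (\<integral>\<^sup>+y. ?w x y \<partial>lborel) \<partial>lborel) \<le>
     (\<integral>\<^sup>+x. (\<integral>\<^sup>+y. (?u x y) + (?v x y) \<partial>lborel) \<partial>lborel)"
    by (intro nn_integral_mono le)
  also have "\<dots> = (\<integral>\<^sup>+x. (\<integral>\<^sup>+y. ?u x y \<partial>lborel) \<partial>lborel)
     + (\<integral>\<^sup>+x. (\<integral>\<^sup>+y. ?v x y \<partial>lborel) \<partial>lborel)"
    by (simp add: nn_integral_add)
  also have "(\<integral>\<^sup>+x. (\<integral>\<^sup>+y. ?v x y \<partial>lborel) \<partial>lborel)
     = (\<integral>\<^sup>+y. (\<integral>\<^sup>+x. ?v x y \<partial>lborel) \<partial>lborel)"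
    by (rule lborel_pair.Fubini') measurable
  also have "(\<integral>\<^sup>+x. (\<integral>\<^sup>+y. ?u x y \<partial>lborel) \<partial>lborel)
     = ennreal (1/2) * (C * sq_norm2 h)"
    by (simp add: nn_integral_cmult nn_integral_multc C sq_norm_def mult_ac del: ennreal_half)
  also have "(\<integral>\<^sup>+y. (\<integral>\<^sup>+x. ?v x y \<partial>lborel) \<partial>lborel)
     = ennreal (1/2) * (C * sq_norm2 h)"
    by (simp add: nn_integral_cmult nn_integral_multc C' sq_norm_def mult_ac del: ennreal_half)
  also have "ennreal (1/2) * (C * sq_norm2 h) + ennreal (1/2) * (C * sq_norm2 h) = C * sq_norm2 h"
    by (simp flip: distrib_right ennreal_plus del: ennreal_half)
  finally show ?thesis .
qed

text \<open>
  With the Gaussian factor all integrals converge absolutely. Interchanging them turns the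
  damped square norm of the transform into a quadratic form of \<open>h\<close> with the positive kernel
  \<open>heat_kernel\<close>, whose total mass is \<open>(2 pi)\<^sup>2\<close> for every \<open>a\<close>.
\<close>

lemma nn_integral_plane_gauss_ft_le:
  assumes int: "integrable lborel h" and "a > 0" and c: "c = 1 \<or> c = -1"
  shows "(\<integral>\<^sup>+\<xi>. ennreal (plane_gauss a \<xi> * (cmod (ft c h \<xi>))\<^sup>2) \<partial>lborel)
      \<le> ennreal ((2 * pi)\<^sup>2) * sq_norm2 h"
proof -
  have [measurable]: "h \<in> borel_measurable borel"
    using int by (auto dest: borel_measurable_integrable)
  let ?L = "lborel :: (real \<times> real) measure"
  define E where "E \<xi> p = of_real (plane_gauss a \<xi>) * (cis (c * (\<xi> \<bullet> (fst p - snd p))) *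
      (h (fst p) * cnj (h (snd p))))"
    for \<xi> and p :: "(real \<times> real) \<times> (real \<times> real)"
  have [measurable]: "case_prod E \<in> borel_measurable (?L \<Otimes>\<^sub>M (?L \<Otimes>\<^sub>M ?L))"
    unfolding E_def by measurable
  interpret LL: pair_sigma_finite ?L "?L \<Otimes>\<^sub>M ?L"
    unfolding lborel_prod by unfold_locales
  have hh: "integrable (?L \<Otimes>\<^sub>M ?L) (\<lambda>(x, y). h x * cnj (h y))"
  proof (rule lborel_pair.Fubini_integrable)
    have "integrable lborel (\<lambda>x. cmod (h x) * (\<integral>\<xi>. cmod (h \<xi>) \<partial>lborel))"
      using int by (intro integrable_mult_left integrable_norm)
    then show "integrable lborel (\<lambda>x. \<integral>\<xi>. norm (case (x, \<xi>) of (x, \<xi>) \<Rightarrow> h x * cnj (h \<xi>)) \<partial>lborel)"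
      by (simp add: norm_mult)
  qed (use int in auto)
  then have hh': "integrable (?L \<Otimes>\<^sub>M ?L) (\<lambda>p. h (fst p) * cnj (h (snd p)))"
    by (simp add: case_prod_beta')
  have intE: "integrable (?L \<Otimes>\<^sub>M (?L \<Otimes>\<^sub>M ?L)) (case_prod E)"
  proof (rule LL.Fubini_integrable)
    have "integrable ?L (\<lambda>\<xi>. plane_gauss a \<xi> * (\<integral>p. cmod (h (fst p) * cnj (h (snd p))) \<partial>(?L \<Otimes>\<^sub>M
        ?L)))"
      using integrable_norm[OF integrable_plane_gauss[OF \<open>a > 0\<close>]] plane_gauss_nonneg
      by (intro integrable_mult_left) simp
    then show "integrable ?L (\<lambda>\<xi>. \<integral>p. norm (case (\<xi>, p) of (\<xi>, p) \<Rightarrow> E \<xi> p) \<partial>(?L \<Otimes>\<^sub>M ?L))"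
      using plane_gauss_nonneg by (simp add: E_def norm_mult)
    show "AE \<xi> in ?L. integrable (?L \<Otimes>\<^sub>M ?L) (\<lambda>p. case (\<xi>, p) of (\<xi>, p) \<Rightarrow> E \<xi> p)"
      unfolding E_def by (auto intro!: integrable_mult_right integrable_cis_mult hh')
  qed measurable
  (* Integrated first over p, the kernel E gives the damped square of the transform;
     integrated first over the frequency, it gives a convolution with the heat kernel. *)
  have eq1: "(\<integral>p. E \<xi> p \<partial>(?L \<Otimes>\<^sub>M ?L)) = of_real (plane_gauss a \<xi> * (cmod (ft c h \<xi>))\<^sup>2)" for \<xi>
  proof -
    have split: "cis (c * (\<xi> \<bullet> (x - y))) = cis (c * (\<xi> \<bullet> x)) * cis (- (c * (\<xi> \<bullet> y)))" for x y
      by (simp add: cis_mult inner_diff_right right_diff_distrib)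
    have i: "integrable (?L \<Otimes>\<^sub>M ?L) (\<lambda>(x, y). E \<xi> (x, y))"
      unfolding E_def by (auto intro!: integrable_mult_right integrable_cis_mult hh' simp:
          case_prod_beta')
    have "(\<integral>p. E \<xi> p \<partial>(?L \<Otimes>\<^sub>M ?L)) = (\<integral>x. (\<integral>y. E \<xi> (x, y) \<partial>?L) \<partial>?L)"
      using lborel_pair.integral_fst[OF i] by simp
    also have "\<dots> = (\<integral>x. (\<integral>y. of_real (plane_gauss a \<xi>) * (cis (c * (\<xi> \<bullet> x)) * h x) * cnj
        (cis (c * (\<xi> \<bullet> y)) * h y) \<partial>?L) \<partial>?L)"
      by (intro integral_cong_lborel)
        (simp add: E_def split cis_cnj mult_ac)
    also have "\<dots> = (\<integral>x. of_real (plane_gauss a \<xi>) * (cis (c * (\<xi> \<bullet> x)) * h x) * cnj (ft c h \<xi>) \<partial>?L)"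
      by (simp add: ft_def del: complex_cnj_mult)
    also have "\<dots> = of_real (plane_gauss a \<xi>) * (ft c h \<xi> * cnj (ft c h \<xi>))"
      unfolding ft_def by simp
    also have "\<dots> = of_real (plane_gauss a \<xi> * (cmod (ft c h \<xi>))\<^sup>2)"
      by (simp add: complex_norm_square[symmetric] del: of_real_power)
    finally show ?thesis .
  qed
  have eq2: "(\<integral>\<xi>. E \<xi> p \<partial>?L) = (h (fst p) * cnj (h (snd p))) * of_real (heat_kernel a
      (fst p - snd p))" for p
  proof -
    have "(\<integral>\<xi>. E \<xi> p \<partial>?L) = (\<integral>\<xi>. (h (fst p) * cnj (h (snd p))) * (cis (c * ((fst p - snd p) \<bullet> \<xi>))
        * of_real (plane_gauss a \<xi>)) \<partial>?L)"
      by (intro integral_cong_lborel) (simp add: E_def inner_commute mult_ac)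
    also have "\<dots> = (h (fst p) * cnj (h (snd p))) * ft c (\<lambda>\<xi>. of_real (plane_gauss a \<xi>))
        (fst p - snd p)"
      unfolding ft_def by simp
    also have "heat_kernel a (c *\<^sub>R u) = heat_kernel a u" for u
      using c by (auto simp: heat_kernel_def normal_density_def)
    then have "ft c (\<lambda>\<xi>. of_real (plane_gauss a \<xi>)) (fst p - snd p)
        = of_real (heat_kernel a (fst p - snd p))"
      by (simp add: ft_plane_gauss[OF \<open>a > 0\<close>])
    finally show ?thesis .
  qed
  have int1: "integrable ?L (\<lambda>\<xi>. plane_gauss a \<xi> * (cmod (ft c h \<xi>))\<^sup>2)"
    using LL.integrable_fst[OF intE] unfolding eq1 complex_of_real_integrable_eq .
  have "(\<integral>\<xi>. complex_of_real (plane_gauss a \<xi> * (cmod (ft c h \<xi>))\<^sup>2) \<partial>?L)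
      = (\<integral>p. (h (fst p) * cnj (h (snd p))) * of_real (heat_kernel a (fst p - snd p)) \<partial>(?L \<Otimes>\<^sub>M ?L))"
    using LL.Fubini_integral[OF intE] unfolding eq1 eq2 by (rule sym)
  then have main: "complex_of_real (\<integral>\<xi>. plane_gauss a \<xi> * (cmod (ft c h \<xi>))\<^sup>2 \<partial>?L)
      = (\<integral>p. (h (fst p) * cnj (h (snd p))) * of_real (heat_kernel a (fst p - snd p)) \<partial>(?L \<Otimes>\<^sub>M ?L))"
    unfolding integral_complex_of_real .
  have "(\<integral>\<^sup>+\<xi>. ennreal (plane_gauss a \<xi> * (cmod (ft c h \<xi>))\<^sup>2) \<partial>lborel)
      = ennreal (\<integral>\<xi>. plane_gauss a \<xi> * (cmod (ft c h \<xi>))\<^sup>2 \<partial>?L)"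
    by (rule nn_integral_eq_integral[OF int1]) (use plane_gauss_nonneg in auto)
  also have "\<dots> \<le> ennreal (cmod (of_real (\<integral>\<xi>. plane_gauss a \<xi> * (cmod (ft c h \<xi>))\<^sup>2 \<partial>?L)))"
    by (intro ennreal_leI) simp
  also have "\<dots> \<le> (\<integral>\<^sup>+p. ennreal (cmod ((h (fst p) * cnj (h (snd p))) * of_real (heat_kernel a
      (fst p - snd p)))) \<partial>(?L \<Otimes>\<^sub>M ?L))"
    unfolding main
    by (rule ennreal_norm_integral_le)
  also have "\<dots> = (\<integral>\<^sup>+x. (\<integral>\<^sup>+y. ennreal (cmod (h x) * cmod (h y) * heat_kernel a (x - y)) \<partial>lborel)
      \<partial>lborel)"
    by (subst lborel.nn_integral_fst[symmetric]) (auto simp: norm_mult heat_kernel_nonneg)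
  also have "\<dots> \<le> ennreal ((2 * pi)\<^sup>2) * sq_norm2 h"
    by (rule nn_integral_schur_convolution)
      (auto simp: heat_kernel_nonneg nn_integral_heat_kernel[OF \<open>a > 0\<close>], auto simp:
          heat_kernel_def normal_density_def)
  finally show ?thesis .
qed

text \<open>
  One half of Plancherel's theorem: the damping is removed by Fatou's lemma. The inequality
  suffices to extend the transform to square integrable functions.
\<close>

theorem sq_norm_ft_le:
  assumes int: "integrable lborel h" and c: "c = 1 \<or> c = -1"
  shows "sq_norm2 (ft c h) \<le> ennreal ((2 * pi)\<^sup>2) * sq_norm2 h"
proof -
  have [measurable]: "h \<in> borel_measurable borel"
    using int by (auto dest: borel_measurable_integrable)
  define a where "a k = inverse (real (Suc k))" for k
  have "sq_norm2 (ft c h) = (\<integral>\<^sup>+\<xi>. liminf (\<lambda>k. ennreal (plane_gauss (a k) \<xi> *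
      (cmod (ft c h \<xi>))\<^sup>2)) \<partial>lborel)"
    unfolding sq_norm_def
  proof (rule nn_integral_cong)
    fix \<xi>
    have "(\<lambda>k. plane_gauss (a k) \<xi> * (cmod (ft c h \<xi>))\<^sup>2)
        \<longlonglongrightarrow> exp (- (0 * fst \<xi>)\<^sup>2 / 2) * exp (- (0 * snd \<xi>)\<^sup>2 / 2) * (cmod (ft c h \<xi>))\<^sup>2"
      unfolding plane_gauss_def gauss_def a_def
      by (intro tendsto_intros LIMSEQ_inverse_real_of_nat) auto
    then have "(\<lambda>k. ennreal (plane_gauss (a k) \<xi> * (cmod (ft c h \<xi>))\<^sup>2))
        \<longlonglongrightarrow> ennreal ((cmod (ft c h \<xi>))\<^sup>2)"
      by (intro tendsto_ennrealI) simp
    then show "ennreal ((cmod (ft c h \<xi>))\<^sup>2)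
        = liminf (\<lambda>k. ennreal (plane_gauss (a k) \<xi> * (cmod (ft c h \<xi>))\<^sup>2))"
      by (rule lim_imp_Liminf[symmetric, OF trivial_limit_sequentially])
  qed
  also have "\<dots> \<le> liminf (\<lambda>k. \<integral>\<^sup>+\<xi>. ennreal (plane_gauss (a k) \<xi> * (cmod (ft c h \<xi>))\<^sup>2) \<partial>lborel)"
    by (rule nn_integral_liminf) measurable
  also have "\<dots> \<le> liminf (\<lambda>k::nat. ennreal ((2 * pi)\<^sup>2) * sq_norm2 h)"
    by (intro Liminf_mono always_eventually allI nn_integral_plane_gauss_ft_le int c)
        (simp add: a_def)
  also have "\<dots> = ennreal ((2 * pi)\<^sup>2) * sq_norm2 h" by (simp add: Liminf_const)
  finally show ?thesis .
qed

section \<open>The Fourier transform of square integrable functions and its inversion\<close>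

text \<open>
  By the inequality above the transforms form a Cauchy sequence.
\<close>

lemma ft_seq_converges:
  fixes \<Phi> :: "nat \<Rightarrow> real \<times> real \<Rightarrow> complex"
  assumes int: "\<And>n. integrable lborel (\<Phi> n)" and fin: "\<And>n. sq_norm2 (\<Phi> n) < \<infinity>"
    and [measurable]: "f \<in> borel_measurable borel" and lim: "mean_limit lborel \<Phi> f"
    and c: "c = 1 \<or> c = -1"
  obtains G where "G \<in> borel_measurable borel" "sq_norm2 G < \<infinity>"
      "mean_limit lborel (\<lambda>n. ft c (\<Phi> n)) G"
proof -
  have meas[measurable]: "\<Phi> n \<in> borel_measurable borel" for n
    using int[of n] by (auto dest: borel_measurable_integrable)
  obtain G where G: "G \<in> borel_measurable lborel" "mean_limit lborel (\<lambda>n. ft c (\<Phi> n)) G"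
  proof (rule sq_norm_complete[of "\<lambda>n. ft c (\<Phi> n)" lborel])
    fix e :: real assume "e > 0"
    then obtain N where N: "\<And>m n. m \<ge> N \<Longrightarrow> n \<ge> N \<Longrightarrow> sq_norm2 (\<lambda>x. \<Phi> m x - \<Phi> n x)
        \<le> ennreal (e / (2 * pi)\<^sup>2)"
      using sq_norm_Cauchy_of_limit[OF _ _ lim, of "e / (2 * pi)\<^sup>2"] by auto
    have "sq_norm2 (\<lambda>x. ft c (\<Phi> m) x - ft c (\<Phi> n) x) \<le> ennreal e" if "m \<ge> N" "n \<ge> N" for m n
    proof -
      have "sq_norm2 (\<lambda>x. ft c (\<Phi> m) x - ft c (\<Phi> n) x) = sq_norm2 (ft c (\<lambda>x. \<Phi> m x - \<Phi> n x))"
        by (simp add: ft_diff[OF int int, abs_def])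
      also have "\<dots> \<le> ennreal ((2 * pi)\<^sup>2) * sq_norm2 (\<lambda>x. \<Phi> m x - \<Phi> n x)"
        by (intro sq_norm_ft_le c Bochner_Integration.integrable_diff int)
      also have "\<dots> \<le> ennreal ((2 * pi)\<^sup>2) * ennreal (e / (2 * pi)\<^sup>2)"
        by (intro mult_left_mono N that) auto
      also have "\<dots> = ennreal ((2 * pi)\<^sup>2 * (e / (2 * pi)\<^sup>2))"
        using \<open>e > 0\<close> by (intro ennreal_mult[symmetric]) auto
      also have "(2 * pi)\<^sup>2 * (e / (2 * pi)\<^sup>2) = e" by simp
      finally show ?thesis .
    qed
    then show "\<exists>N. \<forall>m\<ge>N. \<forall>n\<ge>N. sq_norm2 (\<lambda>x. ft c (\<Phi> m) x - ft c (\<Phi> n) x) \<le> ennreal e" by blast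
  qed auto
  moreover have "sq_norm2 G < \<infinity>"
  proof (rule sq_norm_limit_finite[OF _ _ G(2)])
    fix n
    have "sq_norm2 (ft c (\<Phi> n)) \<le> ennreal ((2 * pi)\<^sup>2) * sq_norm2 (\<Phi> n)"
      by (intro sq_norm_ft_le int c)
    also have "\<dots> < \<infinity>" using fin by (simp add: ennreal_mult_less_top)
    finally show "sq_norm2 (ft c (\<Phi> n)) < \<infinity>" .
  qed (use G in auto)
  ultimately show thesis using that by auto
qed

lemma ft_cut_converges:
  assumes "f \<in> borel_measurable borel" "sq_norm2 f < \<infinity>" "c = 1 \<or> c = -1"
  obtains G where "G \<in> borel_measurable borel" "sq_norm2 G < \<infinity>"
      "mean_limit lborel (\<lambda>n. ft c (cut_off n f)) G"
  by (rule ft_seq_converges[OF integrable_cut[OF assms(1,2)] le_less_trans[OF sq_norm_cut_le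
      assms(2)] assms(1) cut_limit[OF assms(1,2)] assms(3)])

lemma fourier_trunc_eq: "fourier_trunc n f = ft (-1) (cut_off n f)"
proof (rule ext, clarify)
  fix \<xi> \<eta>
  show "fourier_trunc n f (\<xi>, \<eta>) = ft (-1) (cut_off n f) (\<xi>, \<eta>)"
    unfolding fourier_trunc_def ft_def cut_off_def set_lebesgue_integral_def case_prod_conv
        centred_square_def
    by (intro integral_cong_lborel)
      (auto simp: cis_conv_exp algebra_simps split: split_indicator)
qed

lemma
  assumes "f \<in> borel_measurable borel" "sq_norm2 f < \<infinity>"
  shows fourier_measurable: "fourier f \<in> borel_measurable borel"
    and sq_norm_fourier_finite: "sq_norm2 (fourier f) < \<infinity>"
    and fourier_limit: "mean_limit lborel (\<lambda>n. ft (-1) (cut_off n f)) (fourier f)"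
proof -
  have "\<exists>G. L2_limit UNIV (\<lambda>n. fourier_trunc n f) G"
    unfolding L2_limit_UNIV_iff fourier_trunc_eq
    by (rule ft_cut_converges[OF assms, of "-1"]) auto
  then have "L2_limit UNIV (\<lambda>n. fourier_trunc n f) (fourier f)"
    unfolding fourier_def by (rule someI_ex)
  then show "fourier f \<in> borel_measurable borel" "sq_norm2 (fourier f) < \<infinity>"
    "mean_limit lborel (\<lambda>n. ft (-1) (cut_off n f)) (fourier f)"
    unfolding L2_limit_UNIV_iff fourier_trunc_eq by auto
qed

text \<open>
  The transform of the indicator function of an interval. For \<open>a < b\<close> it is square integrable
  but not integrable.
\<close>

definition interval_ft :: "real \<Rightarrow> real \<Rightarrow> real \<Rightarrow> complex" where
  "interval_ft a b \<xi> = (\<integral>y. cis (- (\<xi> * y)) * indicator {a<..<b} y \<partial>lborel)"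

lemma integrable_indicator_interval: "integrable lborel (\<lambda>y::real. indicator {a<..<b} y :: complex)"
  using integrable_real_indicator[of "{a<..<b}" lborel, THEN integrable_of_real[where 'a=complex]]
  by (cases "a \<le> b") (auto simp: of_real_indicator emeasure_lborel_Ioo)

lemma interval_ft_measurable [measurable]: "interval_ft a b \<in> borel_measurable borel"
  unfolding interval_ft_def[abs_def] by measurable

lemma interval_ft_eq:
  assumes "a \<le> b" "\<xi> \<noteq> 0"
  shows "interval_ft a b \<xi> = (iexp (- (\<xi> * a)) - iexp (- (\<xi> * b))) / (\<i> * \<xi>)"
proof -
  have "interval_ft a b \<xi> = (\<integral>y. indicator {a..b} y *\<^sub>R iexp (- (\<xi> * y)) \<partial>lborel)"
    unfolding interval_ft_def
  proof (rule integral_cong_AE)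
    have "AE y in lborel. y \<noteq> a \<and> y \<noteq> b"
      using AE_lborel_singleton[of a] AE_lborel_singleton[of b] by eventually_elim auto
    then show "AE y in lborel. cis (- (\<xi> * y)) * indicator {a<..<b} y
        = indicator {a..b} y *\<^sub>R iexp (- (\<xi> * y))"
      by eventually_elim (auto simp: cis_conv_exp split: split_indicator)
  qed measurable
  also have "\<dots> = (- iexp (- (\<xi> * b)) / (\<i> * \<xi>)) - (- iexp (- (\<xi> * a)) / (\<i> * \<xi>))"
  proof (rule integral_FTC_Icc[where F="\<lambda>y. - iexp (- (\<xi> * y)) / (\<i> * \<xi>)", OF assms(1)])
    fix y
    have "((\<lambda>z. - exp (\<i> * (- (\<xi> * z))) / (\<i> * \<xi>)) has_field_derivative exp
        (\<i> * (- (\<xi> * of_real y)))) (at (of_real y))"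
      using assms(2) by (auto intro!: derivative_eq_intros simp: mult_ac)
    from has_vector_derivative_real_field[OF this]
    show "((\<lambda>y. - iexp (- (\<xi> * y)) / (\<i> * \<xi>)) has_vector_derivative iexp (- (\<xi> * y)))
        (at y within {a..b})"
      by simp
  qed (auto intro!: continuous_intros)
  finally show ?thesis by (simp add: diff_divide_distrib)
qed

lemma cmod_interval_ft_le: "a \<le> b \<Longrightarrow> cmod (interval_ft a b \<xi>) \<le> b - a"
proof -
  assume "a \<le> b"
  have "cmod (interval_ft a b \<xi>) \<le> (\<integral>y. cmod (cis (- (\<xi> * y)) * indicator {a<..<b} y) \<partial>lborel)"
    unfolding interval_ft_def by (rule integral_norm_bound)
  also have "\<dots> = (\<integral>y. indicator {a<..<b} y \<partial>lborel)"
    by (intro Bochner_Integration.integral_cong) (auto simp: norm_mult split: split_indicator)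
  also have "\<dots> = b - a" using \<open>a \<le> b\<close> by simp
  finally show ?thesis .
qed

lemma integrable_indicator_interval_ft:
  assumes "a \<le> b"
  shows "integrable lborel (\<lambda>\<xi>. indicator {-r..r} \<xi> *\<^sub>R interval_ft a b \<xi>)"
  by (rule integrableI_bounded_set[where A="{-r..r}" and B="b - a"])
    (use cmod_interval_ft_le[OF assms] in \<open>auto split: split_indicator simp:
        emeasure_lborel_Icc_eq\<close>)

text \<open>
  The symmetric partial integrals of the inverse transform are those that Levy's inversion
  theorem computes for the point mass at \<open>x\<close>, whose characteristic function is a pure
  exponential.
\<close>

lemma interval_ft_inversion:
  assumes ab: "a \<le> b" and x: "x \<noteq> a" "x \<noteq> b"
  shows "(\<lambda>n. \<integral>\<xi>. cis (x * \<xi>) * (indicator {- real n..real n} \<xi> *\<^sub>R interval_ft a b \<xi>) \<partial>lborel)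
      \<longlonglongrightarrow> 2 * pi * indicator {a<..<b} x"
proof -
  interpret P: prob_space "return borel x" by (rule prob_space_return) simp
  interpret R: real_distribution "return borel x" by unfold_locales auto
  have char: "char (return borel x) t = iexp (t * x)" for t
    unfolding char_def by (subst integral_return) auto
  have mI: "measure (return borel x) {a<..b} = indicator {a<..<b} x"
    using x by (subst measure_return) (auto split: split_indicator)
  have m0: "measure (return borel x) {a} = 0" "measure (return borel x) {b} = 0"
    using x by (auto simp: measure_return)
  note lev = R.Levy_Inversion[OF ab m0]
  have eq: "(CLBINT t=-real n..real n. (iexp (-(t * a)) - iexp (-(t * b))) / (\<i> * t) * char
      (return borel x) t)
     = (\<integral>\<xi>. cis (x * \<xi>) * (indicator {- real n..real n} \<xi> *\<^sub>R interval_ft a b \<xi>) \<partial>lborel)" for n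
  proof -
    have "(CLBINT t=-real n..real n. (iexp (-(t * a)) - iexp (-(t * b))) / (\<i> * t) * char
        (return borel x) t)
      = (\<integral>t. indicator {-real n<..<real n} t *\<^sub>R ((iexp (-(t * a)) - iexp (-(t * b))) /
          (\<i> * t) * iexp (t * x)) \<partial>lborel)"
      unfolding interval_lebesgue_integral_def set_lebesgue_integral_def char by simp
    also have "\<dots> = (\<integral>\<xi>. cis (x * \<xi>) * (indicator {- real n..real n} \<xi> *\<^sub>R interval_ft a b \<xi>)
        \<partial>lborel)"
    proof (rule integral_cong_AE)
      have "AE y in lborel. y \<noteq> real n \<and> y \<noteq> - real n \<and> y \<noteq> 0"
        using AE_lborel_singleton[of "real n"] AE_lborel_singleton[of
            "- real n"] AE_lborel_singleton[of 0] by eventually_elim auto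
      then show "AE t in lborel. indicator {-real n<..<real n} t *\<^sub>R ((iexp (-(t * a)) - iexp
          (-(t * b))) / (\<i> * t) * iexp (t * x))
          = cis (x * t) * (indicator {- real n..real n} t *\<^sub>R interval_ft a b t)"
        by eventually_elim (auto simp: interval_ft_eq[OF ab] cis_conv_exp mult_ac split:
            split_indicator)
    qed measurable
    finally show ?thesis .
  qed
  have "(\<lambda>n. 1 / (2 * pi) * (CLBINT t=-real n..real n. (iexp (-(t * a)) - iexp (-(t * b))) /
      (\<i> * t) * char (return borel x) t))
     \<longlonglongrightarrow> of_real (indicator {a<..<b} x)"
    using lev unfolding mI by simp
  then have "(\<lambda>n. (2 * pi) * (1 / (2 * pi) * (\<integral>\<xi>. cis (x * \<xi>) * (indicator {- real n..real n} \<xi>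
      *\<^sub>R interval_ft a b \<xi>) \<partial>lborel)))
     \<longlonglongrightarrow> of_real (2 * pi) * of_real (indicator {a<..<b} x)"
    unfolding eq by (intro tendsto_mult tendsto_const) simp
  then show ?thesis by (simp add: of_real_indicator)
qed

lemma box_real2: "box a b = {fst a<..<fst b} \<times> {snd a<..<snd b}" for a b :: "real \<times> real"
  by (simp add: box_prod)

lemma integrable_indicator_box: "integrable lborel (\<lambda>z :: real \<times> real. indicator (box a b) z ::
    complex)"
  using integrable_real_indicator[of "box a b" lborel, THEN integrable_of_real[where 'a=complex]]
      emeasure_lborel_box_finite[of a b]
  by (auto simp: of_real_indicator)

lemma sq_norm_indicator_box: "sq_norm2 (indicator (box a b)) < \<infinity>"
proof -
  have "sq_norm2 (indicator (box a b)) = (\<integral>\<^sup>+z. indicator (box a b) z \<partial>lborel)"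
    unfolding sq_norm_def by (intro nn_integral_cong) (auto split: split_indicator)
  then show ?thesis using emeasure_lborel_box_finite[of a b] by simp
qed

lemma ft_indicator_box:
  "ft (-1) (indicator (box a b)) \<xi> = interval_ft (fst a) (fst b) (fst \<xi>) * interval_ft (snd a)
      (snd b) (snd \<xi>)"
proof -
  have int: "integrable lborel (\<lambda>y. cis (- (r * y)) * indicator {u<..<v} y)" for r u v
    by (intro integrable_cis_mult integrable_indicator_interval) auto
  have "ft (-1) (indicator (box a b)) \<xi>
      = (\<integral>z. (cis (- (fst \<xi> * fst z)) * indicator {fst a<..<fst b} (fst z)) *
      (cis (- (snd \<xi> * snd z)) * indicator {snd a<..<snd b} (snd z)) \<partial>lborel)"
    unfolding ft_def
    by (intro integral_cong_lborel)
      (auto simp: inner_prod_def box_real2 cis_mult split: split_indicator)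
  also have "\<dots> = interval_ft (fst a) (fst b) (fst \<xi>) * interval_ft (snd a) (snd b) (snd \<xi>)"
    unfolding integral_prod_fun[OF int int] interval_ft_def ..
  finally show ?thesis .
qed

text \<open>
  Transforms over squares of a product function factor, so that the one-dimensional result
  gives the pointwise limit outside of finitely many lines.
\<close>

lemma box_inversion:
  assumes ab: "fst a \<le> fst b" "snd a \<le> snd b"
  shows "(\<lambda>n. sq_norm2 (\<lambda>z. ft 1 (cut_off n (ft (-1) (indicator (box a b)))) z - of_real
      ((2 * pi)\<^sup>2) * indicator (box a b) z)) \<longlonglongrightarrow> 0"
proof -
  let ?h = "indicator (box a b) :: real \<times> real \<Rightarrow> complex"
  let ?H = "ft (-1) ?h"
  let ?l = "\<lambda>z. complex_of_real (2 * pi * indicator {fst a<..<fst b} (fst z)) * complex_of_real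
      (2 * pi * indicator {snd a<..<snd b} (snd z))"
  have [measurable]: "?h \<in> borel_measurable borel" by simp
  have H: "sq_norm2 ?H < \<infinity>"
  proof -
    have "sq_norm2 ?H \<le> ennreal ((2 * pi)\<^sup>2) * sq_norm2 ?h"
      by (intro sq_norm_ft_le integrable_indicator_box) auto
    also have "\<dots> < \<infinity>" using sq_norm_indicator_box by (simp add: ennreal_mult_less_top)
    finally show ?thesis .
  qed
  obtain G where G[measurable]: "G \<in> borel_measurable borel" and lim:
      "mean_limit lborel (\<lambda>n. ft 1 (cut_off n ?H)) G"
    by (rule ft_cut_converges[OF _ H, of 1]) auto
  (* the limit in mean is identified by the pointwise limit *)
  have "AE z in lborel. G z = of_real ((2 * pi)\<^sup>2) * ?h z"
  proof (rule sq_norm_limit_pointwise[OF _ _ _ lim])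
    have "AE z in (lborel :: (real \<times> real) measure). fst z \<noteq> u \<and> snd z \<noteq> v" for u v :: real
    proof -
      let ?M = "(lborel :: real measure) \<Otimes>\<^sub>M (lborel :: real measure)"
      have "AE z in ?M. fst z \<noteq> u \<and> snd z \<noteq> v"
      proof (rule lborel_pair.AE_pair_measure)
        show "{z \<in> space ?M. fst z \<noteq> u \<and> snd z \<noteq> v} \<in> sets ?M" by measurable
      qed (use AE_lborel_singleton[of u] AE_lborel_singleton[of v] in auto)
      then show ?thesis unfolding lborel_prod .
    qed
    from this[of "fst a" "snd a"] this[of "fst b" "snd b"]
    have "AE z in lborel. fst z \<noteq> fst a \<and> fst z \<noteq> fst b \<and> snd z \<noteq> snd a \<and> snd z \<noteq> snd b"
      by eventually_elim auto
    then show "AE z in lborel. (\<lambda>n. ft 1 (cut_off n ?H) z) \<longlonglongrightarrow> of_real ((2 * pi)\<^sup>2) * ?h z"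
    proof eventually_elim
      fix z assume z: "fst z \<noteq> fst a \<and> fst z \<noteq> fst b \<and> snd z \<noteq> snd a \<and> snd z \<noteq> snd b"
      let ?I = "\<lambda>n x a b. \<integral>\<xi>. cis (x * \<xi>) * (indicator {- real n..real n} \<xi> *\<^sub>R interval_ft a b \<xi>)
          \<partial>lborel"
      have "ft 1 (cut_off n ?H) z = ?I n (fst z) (fst a) (fst b) * ?I n (snd z) (snd a) (snd b)"
          for n
      proof -
        have int: "integrable lborel (\<lambda>\<xi>. cis (x * \<xi>) * (indicator {- real n..real n} \<xi> *\<^sub>R
            interval_ft u v \<xi>))" if "u \<le> v" for x u v
          by (intro integrable_cis_mult integrable_indicator_interval_ft that) auto
        have "ft 1 (cut_off n ?H) z = (\<integral>\<xi>. (cis (fst z * fst \<xi>) * (indicator {- real n..real n}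
            (fst \<xi>) *\<^sub>R interval_ft (fst a) (fst b) (fst \<xi>)))
             * (cis (snd z * snd \<xi>) * (indicator {- real n..real n} (snd \<xi>) *\<^sub>R interval_ft
                 (snd a) (snd b) (snd \<xi>))) \<partial>lborel)"
          unfolding ft_def[of 1] cut_off_def ft_indicator_box
          by (intro integral_cong_lborel)
            (auto simp: inner_prod_def centred_square_def mult_ac split: split_indicator simp
                flip: cis_mult)
        then show ?thesis unfolding integral_prod_fun[OF int[OF ab(1)] int[OF ab(2)]] .
      qed
      moreover have "(\<lambda>n. ?I n (fst z) (fst a) (fst b) * ?I n (snd z) (snd a) (snd b)) \<longlonglongrightarrow>
          (?l z)"
        using z by (intro tendsto_mult interval_ft_inversion ab) auto
      moreover have "(?l z) = of_real ((2 * pi)\<^sup>2) * ?h z"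
        by (cases z) (auto simp: box_real2 power2_eq_square split: split_indicator)
      ultimately show "(\<lambda>n. ft 1 (cut_off n ?H) z) \<longlonglongrightarrow> of_real ((2 * pi)\<^sup>2) * ?h z"
        by (simp only:)
    qed
  qed auto
  then have "sq_norm2 (\<lambda>z. ft 1 (cut_off n ?H) z - of_real ((2 * pi)\<^sup>2) * ?h z)
      = sq_norm2 (\<lambda>z. ft 1 (cut_off n ?H) z - G z)" for n
    by (intro sq_norm_cong_AE) auto
  then show ?thesis using lim by simp
qed

text \<open>
  The function \<open>F\<close> is the inverse transform of \<open>f\<close> in the \<open>L\<^sup>2\<close> sense and \<open>G\<close> is the transform
  of \<open>F\<close>. Tested against the indicator function \<open>h\<close> of a box, both transforms can be moved to
  \<open>h\<close> by the multiplication formula, and for \<open>h\<close> the inversion is known.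
\<close>

theorem fourier_inversion:
  fixes \<Phi> :: "nat \<Rightarrow> real \<times> real \<Rightarrow> complex"
  assumes int: "\<And>n. integrable lborel (\<Phi> n)" and fin: "\<And>n. sq_norm2 (\<Phi> n) < \<infinity>"
    and f[measurable]: "f \<in> borel_measurable borel" and lim: "mean_limit lborel \<Phi> f"
    and F[measurable]: "F \<in> borel_measurable borel" and limF: "mean_limit lborel (\<lambda>n. ft 1 (\<Phi> n)) F"
    and G[measurable]: "G \<in> borel_measurable borel" and limG:
        "mean_limit lborel (\<lambda>n. ft (-1) (cut_off n F)) G"
  shows "AE z in lborel. G z = of_real ((2 * pi)\<^sup>2) * f z"
proof -
  have [measurable]: "\<Phi> n \<in> borel_measurable borel" for n
    using int[of n] by (auto dest: borel_measurable_integrable)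
  have ft_fin: "sq_norm2 (ft c h) < \<infinity>" if "integrable lborel h" "sq_norm2 h < \<infinity>" "c = 1 \<or> c
      = -1" for c h
  proof -
    have "sq_norm2 (ft c h) \<le> ennreal ((2 * pi)\<^sup>2) * sq_norm2 h" by (intro sq_norm_ft_le that)
    also have "\<dots> < \<infinity>" using that by (simp add: ennreal_mult_less_top)
    finally show ?thesis .
  qed
  have fin_f: "sq_norm2 f < \<infinity>" by (rule sq_norm_limit_finite[OF _ _ lim]) (use fin in auto)
  have fin_F: "sq_norm2 F < \<infinity>" by (rule sq_norm_limit_finite[OF _ _ limF]) (use ft_fin[OF int fin]
      in auto)
  have fin_cut: "sq_norm2 (cut_off n h) < \<infinity>" if "sq_norm2 h < \<infinity>" for n h
    using sq_norm_cut_le that by (rule le_less_trans)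
  have fin_G: "sq_norm2 G < \<infinity>" by (rule sq_norm_limit_finite[OF _ _ limG])
      (use ft_fin[OF integrable_cut fin_cut] fin_F in auto)
  let ?C = "complex_of_real ((2 * pi)\<^sup>2)"
  have "AE z in lborel. G z - ?C * f z = 0"
  proof (rule AE_zero_of_boxes)
    have "sq_norm2 (\<lambda>z. G z - ?C * f z) \<le> 2 * sq_norm2 G + 2 * sq_norm2 (\<lambda>z. - ?C * f z)"
      using sq_norm_add_le[of G lborel "\<lambda>z. - ?C * f z"] by simp
    also have "\<dots> < \<infinity>" using fin_G fin_f sq_norm_cmult[of f lborel "-?C"]
      by (auto simp: ennreal_mult_less_top)
    finally show "sq_norm2 (\<lambda>z. G z - ?C * f z) < \<infinity>" .
    fix a b :: "real \<times> real"
    let ?h = "indicator (box a b) :: real \<times> real \<Rightarrow> complex"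
    let ?H = "ft (-1) ?h"
    have [measurable]: "?h \<in> borel_measurable borel" by simp
    have fin_h: "sq_norm2 ?h < \<infinity>" by (rule sq_norm_indicator_box)
    have int_h: "integrable lborel ?h" by (rule integrable_indicator_box)
    have fin_H: "sq_norm2 ?H < \<infinity>" by (intro ft_fin int_h fin_h) auto
    show "(\<integral>z. (G z - ?C * f z) * ?h z \<partial>lborel) = 0"
    proof (cases "fst a \<le> fst b \<and> snd a \<le> snd b")
      case False
      then have "box a b = {}" by (auto simp: box_real2)
      then show ?thesis by simp
    next
      case ab: True
      (* ?H is square integrable but in general not integrable, so the duality of ft is
         used with cut-off functions only. *)
      have "(\<lambda>n. \<integral>z. ft (-1) (cut_off n F) z * ?h z \<partial>lborel) \<longlonglongrightarrow> (\<integral>z. G z * ?h z \<partial>lborel)"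
        by (rule sq_norm_limit_weak[OF _ _ _ limG]) (use ft_fin[OF integrable_cut fin_cut] fin_F
            fin_h in auto)
      moreover have "(\<lambda>n. \<integral>z. cut_off n F z * ?H z \<partial>lborel) \<longlonglongrightarrow> (\<integral>z. F z * ?H z \<partial>lborel)"
        by (rule sq_norm_limit_weak[OF _ _ _ cut_limit]) (use fin_cut fin_F fin_H in auto)
      moreover have "(\<integral>z. ft (-1) (cut_off n F) z * ?h z \<partial>lborel)
          = (\<integral>z. cut_off n F z * ?H z \<partial>lborel)" for n
        by (rule ft_swap[OF integrable_cut int_h]) (use fin_F in auto)
      ultimately have GF: "(\<integral>z. G z * ?h z \<partial>lborel) = (\<integral>z. F z * ?H z \<partial>lborel)"
        by (simp add: LIMSEQ_unique)
      have step: "(\<integral>z. ft 1 (\<Phi> j) z * ?H z \<partial>lborel) = (\<integral>z. \<Phi> j z * (?C * ?h z) \<partial>lborel)" for j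
      proof -
        have "(\<lambda>n. \<integral>z. cut_off n ?H z * ft 1 (\<Phi> j) z \<partial>lborel) \<longlonglongrightarrow> (\<integral>z. ?H z * ft 1 (\<Phi> j) z \<partial>lborel)"
          by (rule sq_norm_limit_weak[OF _ _ _ cut_limit]) (use fin_cut fin_H ft_fin[OF int fin]
              in auto)
        moreover have "(\<lambda>n. \<integral>z. ft 1 (cut_off n ?H) z * \<Phi> j z \<partial>lborel)
            \<longlonglongrightarrow> (\<integral>z. (?C * ?h z) * \<Phi> j z \<partial>lborel)"
          by (rule sq_norm_limit_weak[OF _ _ _ box_inversion])
            (use ab fin ft_fin[OF integrable_cut fin_cut] fin_H in auto)
        moreover have "(\<integral>z. ft 1 (cut_off n ?H) z * \<Phi> j z \<partial>lborel)
            = (\<integral>z. cut_off n ?H z * ft 1 (\<Phi> j) z \<partial>lborel)" for n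
          by (rule ft_swap[OF integrable_cut int]) (use fin_H in auto)
        ultimately show ?thesis by (simp add: LIMSEQ_unique mult.commute)
      qed
      have "(\<lambda>j. \<integral>z. ft 1 (\<Phi> j) z * ?H z \<partial>lborel) \<longlonglongrightarrow> (\<integral>z. F z * ?H z \<partial>lborel)"
        by (rule sq_norm_limit_weak[OF _ _ _ limF]) (use fin_H ft_fin[OF int fin] in auto)
      moreover have "(\<lambda>j. \<integral>z. \<Phi> j z * (?C * ?h z) \<partial>lborel) \<longlonglongrightarrow> (\<integral>z. f z * (?C * ?h z) \<partial>lborel)"
        by (rule sq_norm_limit_weak[OF _ _ _ lim]) (use fin fin_h sq_norm_cmult[of ?h lborel ?C]
            in \<open>auto simp: ennreal_mult_less_top\<close>)
      ultimately have "(\<integral>z. F z * ?H z \<partial>lborel) = (\<integral>z. f z * (?C * ?h z) \<partial>lborel)"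
        unfolding step by (rule LIMSEQ_unique)
      also have "\<dots> = ?C * (\<integral>z. f z * ?h z \<partial>lborel)"
        by (simp flip: integral_mult_right_zero add: mult_ac)
      finally have "(\<integral>z. G z * ?h z \<partial>lborel) - ?C * (\<integral>z. f z * ?h z \<partial>lborel) = 0"
        using GF by simp
      moreover have "(\<integral>z. (G z - ?C * f z) * ?h z \<partial>lborel)
          = (\<integral>z. G z * ?h z \<partial>lborel) - (\<integral>z. ?C * (f z * ?h z) \<partial>lborel)"
      proof -
        have "(\<integral>z. (G z - ?C * f z) * ?h z \<partial>lborel) = (\<integral>z. G z * ?h z - ?C * (f z * ?h z) \<partial>lborel)"
          by (simp only: left_diff_distrib mult.assoc)
        also have "\<dots> = (\<integral>z. G z * ?h z \<partial>lborel) - (\<integral>z. ?C * (f z * ?h z) \<partial>lborel)"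
          using fin_G fin_f fin_h
          by (intro Bochner_Integration.integral_diff integrable_mult_right
              integrable_mult_sq_norm) auto
        finally show ?thesis .
      qed
      ultimately show ?thesis by simp
    qed
  qed auto
  then show ?thesis by eventually_elim simp
qed

section \<open>A smooth extension of the decaying exponential\<close>

lemma integrable_exp_half_line:
  assumes "c > 0" shows "integrable lborel (\<lambda>r::real. indicator {0<..} r * exp (- (c * r)))"
  using integrable_I0i_exp_mscale[OF assms] by (simp add: set_integrable_def mult.commute)

text \<open>
  The fundamental theorem of calculus on \<open>{0..n}\<close> and dominated convergence.
\<close>

lemma laplace_half_line:
  assumes "Re z > 0"
  shows "(\<integral>r. indicator {0<..} r *\<^sub>R exp (- (z * of_real r)) \<partial>lborel) = 1 / z"
proof -
  let ?g = "\<lambda>n r. indicat_real {0..real n} r *\<^sub>R exp (- (z * of_real r))"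
  let ?h = "\<lambda>r. indicat_real {0<..} r *\<^sub>R exp (- (z * of_real r))"
  have z: "z \<noteq> 0" using assms by auto
  have "(\<lambda>n::nat. \<integral>r. ?g n r \<partial>lborel) \<longlonglongrightarrow>
      (\<integral>r. ?h r \<partial>lborel)"
  proof (rule integral_dominated_convergence[where w="\<lambda>r. indicator {0<..} r * exp (- (Re z * r))"])
    show "integrable lborel (\<lambda>r. indicator {0<..} r * exp (- (Re z * r)))"
      by (rule integrable_exp_half_line[OF assms])
    show "AE r in lborel. (\<lambda>n. ?g n r) \<longlonglongrightarrow> (?h r)"
      using AE_lborel_singleton[of "0::real"]
    proof eventually_elim
      fix r :: real assume "r \<noteq> 0"
      obtain N :: nat where N: "r \<le> real N" using real_arch_simple by blast
      have "\<forall>\<^sub>F n in sequentially. (?g n r) = (?h r)"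
        unfolding eventually_sequentially
        by (rule exI[of _ N]) (use N \<open>r \<noteq> 0\<close> in \<open>auto split: split_indicator\<close>)
      then show "(\<lambda>n. ?g n r) \<longlonglongrightarrow> (?h r)"
        by (rule tendsto_eventually)
    qed
    show "AE r in lborel. cmod (?g n r) \<le> indicat_real {0<..} r * exp (- (Re z * r))" for n :: nat
      using AE_lborel_singleton[of "0::real"]
      by eventually_elim (auto split: split_indicator simp: norm_exp_eq_Re)
  qed auto
  moreover have "(\<integral>r. ?g n r \<partial>lborel)
      = - exp (- (z * of_real (real n))) / z - (- exp (- (z * of_real 0)) / z)" for n :: nat
  proof (rule integral_FTC_Icc[where F="\<lambda>r. - exp (- (z * of_real r)) / z"])
    fix y
    have "((\<lambda>r. - exp (- (z * r)) / z) has_field_derivative exp (- (z * of_real y)))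
        (at (of_real y))"
      using z by (auto intro!: derivative_eq_intros)
    from has_vector_derivative_real_field[OF this]
    show "((\<lambda>r. - exp (- (z * of_real r)) / z) has_vector_derivative exp (- (z * of_real y)))
        (at y within {0..real n})" .
  qed (auto intro!: continuous_intros)
  moreover have "(\<lambda>n. - exp (- (z * of_real (real n))) / z - (- exp (- (z * of_real 0)) / z))
      \<longlonglongrightarrow> - 0 / z - (- exp (- (z * of_real 0)) / z)"
  proof (intro tendsto_intros z)
    show "(\<lambda>n. exp (- (z * of_real (real n)))) \<longlonglongrightarrow> 0"
    proof (rule tendsto_norm_zero_cancel)
      have "filterlim (\<lambda>n. - (Re z * real n)) at_bot sequentially"
        using assms by real_asymp
      then have "(\<lambda>n. exp (- (Re z * real n))) \<longlonglongrightarrow> 0"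
        by (rule filterlim_compose[OF exp_at_bot])
      then show "(\<lambda>n. cmod (exp (- (z * of_real (real n))))) \<longlonglongrightarrow> 0"
        by (simp add: norm_exp_eq_Re)
    qed
  qed
  ultimately show ?thesis by (simp add: LIMSEQ_unique)
qed

lemma fourier_exp_half_line:
  "(\<integral>r. cis (u * r) * of_real (indicator {0<..} r * exp (- r)) \<partial>lborel) = 1 / (1 - \<i> * of_real u)"
proof -
  have "(\<integral>r. cis (u * r) * of_real (indicator {0<..} r * exp (- r)) \<partial>lborel)
      = (\<integral>r. indicator {0<..} r *\<^sub>R exp (- ((1 - \<i> * of_real u) * of_real r)) \<partial>lborel)"
    by (intro integral_cong_lborel)
      (auto split: split_indicator simp: cis_conv_exp exp_of_real[symmetric] algebra_simps simp
          flip: exp_add)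
  then show ?thesis by (simp add: laplace_half_line)
qed

lemma one_plus_iu_neq_0: "1 + \<i> * of_real u \<noteq> 0" "1 - \<i> * of_real u \<noteq> 0"
  by (auto simp: complex_eq_iff)

lemma cmod_one_plus_iu: "cmod (1 + \<i> * of_real u) = sqrt (1 + u\<^sup>2)" "cmod (1 - \<i> * of_real u)
    = sqrt (1 + u\<^sup>2)"
  by (simp_all add: cmod_def)

lemma fourier_exp_abs:
  shows integrable_exp_abs: "integrable lborel (\<lambda>x. complex_of_real (exp (- \<bar>x\<bar>)))"
    and "(\<integral>x. cis (u * x) * of_real (exp (- \<bar>x\<bar>)) \<partial>lborel) = of_real (2 / (1 + u\<^sup>2))"
proof -
  let ?h = "\<lambda>r::real. complex_of_real (indicator {0<..} r * exp (- r))"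
  have h: "integrable lborel ?h" using integrable_exp_half_line[of 1]
    by (intro integrable_of_real) simp
  have h': "integrable lborel (\<lambda>x. ?h (- x))"
    using lborel_integrable_real_affine[OF h, of "-1" 0] by simp
  have ae: "AE x in lborel. complex_of_real (exp (- \<bar>x\<bar>)) = ?h x + ?h (- x)"
    using AE_lborel_singleton[of "0::real"] by eventually_elim (auto split: split_indicator)
  show "integrable lborel (\<lambda>x. complex_of_real (exp (- \<bar>x\<bar>)))"
    using Bochner_Integration.integrable_add[OF h h']
    by (rule integrable_cong_AE_imp) (use ae in auto)
  have "(\<integral>x. cis (u * x) * of_real (exp (- \<bar>x\<bar>)) \<partial>lborel)
      = (\<integral>x. cis (u * x) * ?h x + cis (u * x) * ?h (- x) \<partial>lborel)"
    by (rule integral_cong_AE) (use ae in \<open>auto simp: distrib_left elim: eventually_mono\<close>)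
  also have "\<dots> = (\<integral>x. cis (u * x) * ?h x \<partial>lborel) + (\<integral>x. cis (u * x) * ?h (- x) \<partial>lborel)"
    by (intro Bochner_Integration.integral_add integrable_cis_mult h h') auto
  also have "(\<integral>x. cis (u * x) * ?h (- x) \<partial>lborel) = (\<integral>x. cis (- u * x) * ?h x \<partial>lborel)"
    by (subst lborel_integral_real_affine[where c="-1" and t=0]) auto
  also have "(\<integral>x. cis (u * x) * ?h x \<partial>lborel) + (\<integral>x. cis (- u * x) * ?h x \<partial>lborel)
      = of_real (2 / (1 + u\<^sup>2))"
  proof -
    have "(1 - \<i> * of_real u) * (1 + \<i> * of_real u) = complex_of_real (1 + u\<^sup>2)"
      by (simp add: algebra_simps power2_eq_square)
    moreover have "1 / (1 - \<i> * of_real u) + 1 / (1 - \<i> * of_real (- u))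
        = 2 / ((1 - \<i> * of_real u) * (1 + \<i> * of_real u))"
      using one_plus_iu_neq_0[of u] by (simp add: add_frac_eq)
    ultimately show ?thesis unfolding fourier_exp_half_line by simp
  qed
  finally show "(\<integral>x. cis (u * x) * of_real (exp (- \<bar>x\<bar>)) \<partial>lborel) = of_real (2 / (1 + u\<^sup>2))" .
qed

lemma integrable_inverse_one_plus_square: "integrable lborel (\<lambda>u::real. 1 / (1 + u\<^sup>2))"
  using integrable_inverse_1_plus_square by (simp add: set_integrable_def inverse_eq_divide)

text \<open>
  Fourier inversion of \<open>exp (- |x|)\<close>. A Gaussian factor makes the interchange of integrals
  legitimate; as it tends to 1, dominated convergence applies on both sides.
\<close>

lemma fourier_cauchy:
  "(\<integral>u. cis (u * y) * of_real (2 / (1 + u\<^sup>2)) \<partial>lborel) = of_real (2 * pi * exp (- \<bar>y\<bar>))"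
proof -
  define a where "a n = inverse (real (Suc n))" for n
  have a: "a n > 0" for n by (simp add: a_def)
  have a0: "a \<longlonglongrightarrow> 0" unfolding a_def by (rule LIMSEQ_inverse_real_of_nat)
  let ?A = "\<lambda>u. complex_of_real (2 / (1 + u\<^sup>2))"
  have intA: "integrable lborel ?A"
    using integrable_mult_right[OF integrable_inverse_one_plus_square, of 2]
    by (intro integrable_of_real) simp
  let ?r = "\<lambda>n z. complex_of_real (2 * pi * (std_normal_density z * exp (- \<bar>a n * z + y\<bar>)))"
  let ?t = "\<lambda>z. complex_of_real (2 * pi * (std_normal_density z * exp (- \<bar>y\<bar>)))"
  let ?s = "\<lambda>n z. complex_of_real (2 * pi * normal_density 0 (a n) ((- y + - a n * z) + y)) *
      of_real (exp (- \<bar>- y + - a n * z\<bar>))"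
  let ?E = "\<lambda>n u x. cis (u * (x + y)) * of_real (gauss (a n) u) * of_real (exp (- \<bar>x\<bar>))"
  let ?G = "\<lambda>n u. of_real (gauss (a n) u) * (cis (u * y) * ?A u)"
  have "(\<lambda>n. \<integral>u. ?G n u \<partial>lborel) \<longlonglongrightarrow> (\<integral>u. cis (u * y) * ?A u \<partial>lborel)"
  proof (rule integral_dominated_convergence[where w="\<lambda>u. cmod (?A u)"])
    show "AE u in lborel. (\<lambda>n. ?G n u) \<longlonglongrightarrow> cis (u * y) * ?A u"
    proof (rule AE_I2)
      fix u
      have "(\<lambda>n. ?G n u) \<longlonglongrightarrow> of_real (exp (- (0 * u)\<^sup>2 / 2)) * (cis (u * y) * ?A u)"
        unfolding gauss_def by (intro tendsto_intros a0) auto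
      then show "(\<lambda>n. ?G n u) \<longlonglongrightarrow> cis (u * y) * ?A u" by simp
    qed
    show "AE u in lborel. cmod (?G n u) \<le> cmod (?A u)" for n
    proof (rule AE_I2)
      have le: "cmod (of_real (gauss r u) * (cis v * B)) \<le> cmod B" for r u v B
        by (auto simp: norm_mult gauss_def intro!: mult_left_le_one_le)
      show "cmod (?G n u) \<le> cmod (?A u)" for u
        by (rule le)
    qed
  qed (use intA in auto)
  moreover have "(\<integral>u. ?G n u \<partial>lborel) =
      (\<integral>z. ?r n z \<partial>lborel)" for n
  proof -
    have int: "integrable (lborel \<Otimes>\<^sub>M lborel) (\<lambda>(u, x). ?E n u x)"
    proof (rule lborel_pair.Fubini_integrable)
      have "integrable lborel (\<lambda>u. gauss (a n) u * (\<integral>x. exp (- \<bar>x\<bar>) \<partial>lborel))"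
        by (intro integrable_mult_left integrable_gauss a)
      then show "integrable lborel (\<lambda>u. \<integral>x. norm (case (u, x) of (u, x) \<Rightarrow> (?E n u x)) \<partial>lborel)"
        by (simp add: norm_mult gauss_def)
      show "AE u in lborel. integrable lborel (\<lambda>x. case (u, x) of (u, x) \<Rightarrow> (?E n u x))"
        unfolding case_prod_conv mult.assoc
        by (intro AE_I2 integrable_cis_mult integrable_mult_right integrable_exp_abs) auto
    qed (unfold gauss_def, measurable)
    have "(\<integral>u. ?G n u \<partial>lborel)
       = (\<integral>u. (\<integral>x. ?E n u x \<partial>lborel) \<partial>lborel)"
      unfolding fourier_exp_abs(2)[symmetric]
      by (simp flip: integral_mult_right_zero cis_mult add: distrib_left mult_ac)
    also have "\<dots> = (\<integral>x. (\<integral>u. ?E n u x \<partial>lborel) \<partial>lborel)"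
      using lborel_pair.Fubini_integral[OF int] by simp
    also have "\<dots> = (\<integral>x. of_real (2 * pi * normal_density 0 (a n) (x + y)) * of_real (exp (- \<bar>x\<bar>))
        \<partial>lborel)"
    proof -
      have fg: "(\<integral>u. cis (u * (x + y)) * of_real (gauss (a n) u) \<partial>lborel)
          = of_real (2 * pi * normal_density 0 (a n) (x + y))" for x
        using fourier_gauss[OF a, of "x + y" n] by (simp only: mult.commute[of _ "x + y"])
      show ?thesis unfolding integral_mult_left_zero fg ..
    qed
    (* the substitution x = - y - a n z turns the concentrating Gaussian into a fixed one *)
    also have "\<dots> = \<bar>a n\<bar> *\<^sub>R (\<integral>z. ?s n z \<partial>lborel)"
      using a[of n] by (subst lborel_integral_real_affine[where c="- a n" and t="-y"]) auto
    also have "\<dots> = (\<integral>z. \<bar>a n\<bar> *\<^sub>R (?s n z) \<partial>lborel)"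
      by (rule integral_scaleR_right[symmetric])
    also have "\<dots> = (\<integral>z. ?r n z \<partial>lborel)"
    proof (intro integral_cong_lborel)
      fix z
      have 1: "\<bar>- y + - a n * z\<bar> = \<bar>a n * z + y\<bar>" by (simp add: abs_minus_commute)
      have 2: "a n * normal_density 0 (a n) ((- y + - a n * z) + y) = std_normal_density z"
        using a[of n] by (simp add: normal_density_def real_sqrt_mult power_mult_distrib
            field_simps)
      show "\<bar>a n\<bar> *\<^sub>R (?s n z)
          = (?r n z)"
        unfolding 1 2[symmetric] using a[of n] by (simp add: scaleR_conv_of_real)
    qed
    finally show ?thesis .
  qed
  moreover have "(\<lambda>n. \<integral>z. ?r n z \<partial>lborel) \<longlonglongrightarrow>
      (\<integral>z. ?t z \<partial>lborel)"
  proof (rule integral_dominated_convergence[where w="\<lambda>z. 2 * pi * std_normal_density z"])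
    show "AE z in lborel. (\<lambda>n. ?r n z) \<longlonglongrightarrow> (?t z)"
    proof (rule AE_I2)
      fix z
      have "(\<lambda>n. ?r n z) \<longlonglongrightarrow> complex_of_real (2 * pi * (std_normal_density z * exp (- \<bar>0 * z + y\<bar>)))"
        by (intro tendsto_intros a0)
      then show "(\<lambda>n. ?r n z) \<longlonglongrightarrow> (?t z)" by simp
    qed
    show "AE z in lborel. cmod (?r n z) \<le> 2 * pi * std_normal_density z" for n
      unfolding norm_of_real by (auto simp: abs_mult intro!: mult_left_le)
  qed auto
  moreover have "(\<integral>z. ?t z \<partial>lborel) = of_real (2 * pi * exp (- \<bar>y\<bar>))"
    unfolding integral_complex_of_real by simp
  ultimately show ?thesis by (simp only: LIMSEQ_unique)
qed

text \<open>
  The Fourier transform, divided by \<open>2 pi\<close>, of a function that equals \<open>exp (- y)\<close> for \<open>y > 0\<close>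
  and a polynomial times \<open>exp y\<close> for \<open>y < 0\<close>. At 0 the two pieces fit together to order
  \<open>m - 1\<close>, which is why the symbol decays like the power \<open>-(m + 1)\<close>.
\<close>

definition ext_symbol :: "nat \<Rightarrow> real \<Rightarrow> complex" where
  "ext_symbol m u = of_real (2 ^ m / (2 * pi)) / ((1 + \<i> * of_real u) * (1 - \<i> * of_real u) ^ m)"

lemma ext_symbol_measurable [measurable]: "ext_symbol m \<in> borel_measurable borel"
  unfolding ext_symbol_def[abs_def] by measurable

lemma cmod_ext_symbol: "cmod (ext_symbol m u) = 2 ^ m / (2 * pi) / sqrt (1 + u\<^sup>2) ^ Suc m"
  by (simp add: ext_symbol_def norm_mult norm_divide norm_power cmod_one_plus_iu)

lemma ext_symbol_Suc: "ext_symbol (Suc m) u = ext_symbol m u * (2 / (1 - \<i> * of_real u))"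
  by (simp add: ext_symbol_def)

lemma integrable_ext_symbol:
  assumes "m \<ge> 1"
  shows "integrable lborel (ext_symbol m)"
proof (rule Bochner_Integration.integrable_bound)
  show "integrable lborel (\<lambda>u::real. 2 ^ m / (2 * pi) * (1 / (1 + u\<^sup>2)))"
    by (rule integrable_mult_right[OF integrable_inverse_one_plus_square])
  show "AE u in lborel. norm (ext_symbol m u) \<le> norm (2 ^ m / (2 * pi) * (1 / (1 + u\<^sup>2)))"
  proof (rule AE_I2)
    fix u :: real
    have "sqrt (1 + u\<^sup>2) ^ 2 \<le> sqrt (1 + u\<^sup>2) ^ Suc m"
      using assms by (intro power_increasing) auto
    then have "1 + u\<^sup>2 \<le> sqrt (1 + u\<^sup>2) ^ Suc m" by simp
    then have "1 / sqrt (1 + u\<^sup>2) ^ Suc m \<le> 1 / (1 + u\<^sup>2)"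
      by (intro divide_left_mono) (auto intro!: mult_pos_pos zero_less_power add_pos_nonneg)
    then have "2 ^ m / (2 * pi) * (1 / sqrt (1 + u\<^sup>2) ^ Suc m) \<le> 2 ^ m / (2 * pi) * (1 / (1 + u\<^sup>2))"
      by (intro mult_left_mono) auto
    then show "norm (ext_symbol m u) \<le> norm (2 ^ m / (2 * pi) * (1 / (1 + u\<^sup>2)))"
      unfolding cmod_ext_symbol by (simp add: abs_mult)
  qed
qed measurable

lemma ext_symbol_L1: "m \<ge> 1 \<Longrightarrow> (\<integral>\<^sup>+u. ennreal (cmod (ext_symbol m u)) \<partial>lborel) < \<infinity>"
  using integrable_ext_symbol[of m] by (simp add: integrable_iff_bounded)

text \<open>
  The factor \<open>1 / (1 - iu)\<close> is the average of \<open>cis (u * r)\<close> with the density \<open>exp (- r)\<close> on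
  \<open>r > 0\<close>. Hence a further factor \<open>2 / (1 - iu)\<close> replaces a function of \<open>y\<close> by twice an average
  of its values to the right of \<open>y\<close>, and \<open>exp (- y)\<close> on \<open>y > 0\<close> is invariant under this. The
  case \<open>m = 1\<close> is the Fourier inversion of \<open>exp (- |y|)\<close>.
\<close>

lemma ext_symbol_inversion:
  assumes "m \<ge> 1" "y > 0"
  shows "(\<integral>u. cis (u * y) * ext_symbol m u \<partial>lborel) = of_real (exp (- y))"
  using assms
proof (induction m arbitrary: y rule: nat_induct_at_least)
  case base
  have "ext_symbol 1 u = of_real (1 / (2 * pi)) * of_real (2 / (1 + u\<^sup>2))" for u
  proof -
    have "(1 + \<i> * of_real u) * (1 - \<i> * of_real u) = complex_of_real (1 + u\<^sup>2)"
      by (simp add: algebra_simps power2_eq_square)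
    then show ?thesis by (simp add: ext_symbol_def)
  qed
  then have "(\<integral>u. cis (u * y) * ext_symbol 1 u \<partial>lborel)
      = (\<integral>u. of_real (1 / (2 * pi)) * (cis (u * y) * of_real (2 / (1 + u\<^sup>2))) \<partial>lborel)"
    by (simp add: mult_ac)
  also have "\<dots> = of_real (1 / (2 * pi)) * of_real (2 * pi * exp (- \<bar>y\<bar>))"
    unfolding integral_mult_right_zero fourier_cauchy ..
  finally show ?case using base by simp
next
  case (Suc m)
  let ?h = "\<lambda>r::real. complex_of_real (indicator {0<..} r * exp (- r))"
  have h: "integrable lborel ?h" using integrable_exp_half_line[of 1]
    by (intro integrable_of_real) simp
  have int: "integrable (lborel \<Otimes>\<^sub>M lborel) (\<lambda>(u, r). cis (u * (y + r)) * (2 * ext_symbol m u) *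
      ?h r)"
  proof (rule lborel_pair.Fubini_integrable)
    have "integrable lborel (\<lambda>u. cmod (2 * ext_symbol m u) * (\<integral>r. cmod (?h r) \<partial>lborel))"
      by (intro integrable_mult_left integrable_norm integrable_mult_right integrable_ext_symbol
          Suc)
    then show "integrable lborel (\<lambda>u. \<integral>r. norm (case (u, r) of (u, r) \<Rightarrow> cis (u * (y + r)) *
        (2 * ext_symbol m u) * ?h r) \<partial>lborel)"
      by (simp add: norm_mult mult.assoc)
    show "AE u in lborel. integrable lborel (\<lambda>r. case (u, r) of (u, r) \<Rightarrow> cis (u * (y + r)) *
        (2 * ext_symbol m u) * ?h r)"
      unfolding case_prod_conv mult.assoc
      by (intro AE_I2 integrable_cis_mult integrable_mult_right h) auto
  qed measurable
  have "(\<integral>u. cis (u * y) * ext_symbol (Suc m) u \<partial>lborel)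
      = (\<integral>u. (\<integral>r. cis (u * (y + r)) * (2 * ext_symbol m u) * ?h r \<partial>lborel) \<partial>lborel)"
  proof (intro integral_cong_lborel)
    fix u
    have "cis (u * y) * ext_symbol (Suc m) u
        = (cis (u * y) * (2 * ext_symbol m u)) * (\<integral>r. cis (u * r) * ?h r \<partial>lborel)"
      unfolding fourier_exp_half_line ext_symbol_Suc by simp
    also have "\<dots> = (\<integral>r. (cis (u * y) * (2 * ext_symbol m u)) * (cis (u * r) * ?h r) \<partial>lborel)"
      by (rule integral_mult_right_zero[symmetric])
    also have "\<dots> = (\<integral>r. cis (u * (y + r)) * (2 * ext_symbol m u) * ?h r \<partial>lborel)"
      by (intro integral_cong_lborel) (simp add: distrib_left mult_ac flip: cis_mult)
    finally show "cis (u * y) * ext_symbol (Suc m) u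
        = (\<integral>r. cis (u * (y + r)) * (2 * ext_symbol m u) * ?h r \<partial>lborel)" .
  qed
  also have "\<dots> = (\<integral>r. (\<integral>u. cis (u * (y + r)) * (2 * ext_symbol m u) * ?h r \<partial>lborel) \<partial>lborel)"
    using lborel_pair.Fubini_integral[OF int] by simp
  also have "\<dots> = (\<integral>r. of_real (2 * exp (- y)) * (indicator {0<..} r *\<^sub>R exp (- (2 * of_real r)))
      \<partial>lborel)"
  proof (intro integral_cong_lborel)
    fix r
    show "(\<integral>u. cis (u * (y + r)) * (2 * ext_symbol m u) * ?h r \<partial>lborel)
        = of_real (2 * exp (- y)) * (indicator {0<..} r *\<^sub>R exp (- (2 * of_real r)))"
    proof (cases "r > 0")
      case True
      have "(\<integral>u. cis (u * (y + r)) * (2 * ext_symbol m u) * ?h r \<partial>lborel)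
          = (2 * ?h r) * (\<integral>u. cis (u * (y + r)) * ext_symbol m u \<partial>lborel)"
        unfolding integral_mult_right_zero[symmetric]
        by (intro integral_cong_lborel) (simp add: mult_ac)
      also have "\<dots> = (2 * ?h r) * of_real (exp (- (y + r)))"
        using Suc.IH[of "y + r"] Suc.prems True by simp
      also have "\<dots> = of_real (2 * exp (- y)) * of_real (exp (- (2 * r)))"
      proof -
        have e: "exp (- r) * exp (- (y + r)) = exp (- y) * exp (- (2 * r))"
          unfolding exp_add[symmetric] by simp
        have "(2 * ?h r) * of_real (exp (- (y + r))) = of_real (2 * (exp (- r) * exp (- (y + r))))"
          using True by simp
        then show ?thesis unfolding e by simp
      qed
      also have "complex_of_real (exp (- (2 * r))) = exp (- (2 * of_real r))"
        by (simp flip: exp_of_real)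
      finally show ?thesis using True by simp
    qed simp
  qed
  also have "\<dots> = of_real (2 * exp (- y)) * (1 / 2)"
  proof -
    have "(\<integral>r. indicator {0<..} r *\<^sub>R exp (- (2 * complex_of_real r)) \<partial>lborel) = 1 / 2"
      by (rule laplace_half_line) simp
    then show ?thesis unfolding integral_mult_right_zero by (rule arg_cong)
  qed
  finally show ?case by simp
qed

section \<open>Hilbert's inequality\<close>

lemma nn_integral_powr_max:
  fixes a :: real
  assumes "a > 0"
  shows "(\<integral>\<^sup>+x. ennreal (x powr (-1/2) / max x a) * indicator {0<..} x \<partial>lborel)
      = ennreal (4 * a powr (-1/2))"
proof -
  let ?f = "\<lambda>x::real. x powr (-1/2) / max x a"
  have "((\<lambda>x. x powr (-1/2) / a) has_integral (a powr (-1/2 + 1) / (-1/2 + 1)) / a) {0..a}"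
    using has_integral_powr_from_0[of "-1/2" a] assms by (intro has_integral_divide) auto
  then have 1: "(?f has_integral (a powr (-1/2 + 1) / (-1/2 + 1)) / a) {0..a}"
    by (rule has_integral_eq[rotated]) (auto simp: max_def)
  have "((\<lambda>x. x powr (-3/2)) has_integral - (a powr (-3/2 + 1)) / (-3/2 + 1)) {a..}"
    using assms by (intro has_integral_powr_to_inf) auto
  then have 2: "(?f has_integral - (a powr (-3/2 + 1)) / (-3/2 + 1)) {a..}"
  proof (rule has_integral_eq[rotated])
    fix x assume "x \<in> {a..}"
    then have x: "x \<ge> a" "x > 0" using assms by auto
    have "x powr (-3/2) = x powr (-1/2 - 1)" by simp
    also have "\<dots> = x powr (-1/2) / x" using x by (simp only: powr_diff) simp
    finally show "x powr (-3/2) = ?f x" using x by (simp add: max_def)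
  qed
  have "{0..a} \<inter> {a..} = {a}" using assms by auto
  with 1 2 have "(?f has_integral ((a powr (-1/2 + 1) / (-1/2 + 1)) / a + - (a powr (-3/2 + 1)) /
      (-3/2 + 1))) ({0..a} \<union> {a..})"
    by (intro has_integral_Un) auto
  moreover have "{0..a} \<union> {a..} = {0..}" using assms by auto
  moreover have "(a powr (-1/2 + 1) / (-1/2 + 1)) / a + - (a powr (-3/2 + 1)) / (-3/2 + 1)
      = 4 * a powr (-1/2)"
  proof -
    have "a powr (-1/2 + 1) = a powr (-1/2) * a"
      using assms by (subst powr_add) (simp only: powr_one)
    moreover have "(-3/2 + 1 :: real) = -1/2" "(-1/2 + 1 :: real) = 1/2" by simp_all
    ultimately show ?thesis using assms by (simp only:) simp
  qed
  ultimately have "(?f has_integral 4 * a powr (-1/2)) {0..}" by simp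
  then have "((\<lambda>x. if x \<in> {0..} then ?f x else 0) has_integral 4 * a powr (-1/2)) UNIV"
    by (subst has_integral_restrict_UNIV)
  then have "(\<integral>\<^sup>+x. ennreal (if x \<in> {0..} then ?f x else 0) \<partial>lborel) = ennreal (4 * a powr (-1/2))"
    using assms by (intro nn_integral_has_integral_lborel) (auto simp: max_def)
  moreover have "(\<integral>\<^sup>+x. ennreal (?f x) * indicator {0<..} x \<partial>lborel)
      = (\<integral>\<^sup>+x. ennreal (if x \<in> {0..} then ?f x else 0) \<partial>lborel)"
    using AE_lborel_singleton[of "0::real"]
    by (intro nn_integral_cong_AE, eventually_elim) (auto split: split_indicator)
  ultimately show ?thesis by simp
qed

text \<open>
  Schur's test: on a half-axis, the kernel \<open>1 / max\<close> maps the power \<open>-1/2\<close> to four times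
  itself, in either variable.
\<close>

lemma hilbert_schur:
  fixes f :: "real \<Rightarrow> ennreal"
  assumes [measurable]: "f \<in> borel_measurable borel"
  shows "(\<integral>\<^sup>+\<xi>. (\<integral>\<^sup>+\<kappa>. ennreal (1 / max \<kappa> \<bar>\<xi>\<bar>) * f \<kappa> * indicator {0<..} \<kappa> \<partial>lborel)\<^sup>2 \<partial>lborel)
    \<le> 32 * (\<integral>\<^sup>+\<kappa>. (f \<kappa>)\<^sup>2 * indicator {0<..} \<kappa> \<partial>lborel)"
proof -
  let ?A = "\<lambda>\<xi>. (\<integral>\<^sup>+\<kappa>. ennreal (1 / max \<kappa> \<bar>\<xi>\<bar>) * f \<kappa> * indicator {0<..} \<kappa> \<partial>lborel)"
  define v where "v \<xi> \<kappa> = ennreal (\<kappa> powr (1/2) / max \<kappa> \<bar>\<xi>\<bar>) * (f \<kappa>)\<^sup>2 * indicator {0<..} \<kappa>"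
      for \<xi> \<kappa> :: real
  have [measurable]: "(\<lambda>(\<xi>, \<kappa>). v \<xi> \<kappa>) \<in> borel_measurable (borel \<Otimes>\<^sub>M borel)"
    "\<And>\<xi>. v \<xi> \<in> borel_measurable borel"
    unfolding v_def by measurable
  have cs: "(?A \<xi>)\<^sup>2 \<le> ennreal (4 * \<bar>\<xi>\<bar> powr (-1/2)) * (\<integral>\<^sup>+\<kappa>. v \<xi> \<kappa> \<partial>lborel)"
    if "\<xi> \<noteq> 0" for \<xi>
  proof -
    let ?m = "\<lambda>\<kappa>. sqrt (1 / max \<kappa> \<bar>\<xi>\<bar>)"
    let ?p = "\<lambda>\<kappa>. ennreal (?m \<kappa> * \<kappa> powr (-1/4)) * indicator {0<..} \<kappa>"
    let ?q = "\<lambda>\<kappa>. ennreal (?m \<kappa> * \<kappa> powr (1/4)) * f \<kappa> * indicator {0<..} \<kappa>"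
    have root_sq: "(?m \<kappa>)\<^sup>2 = 1 / max \<kappa> \<bar>\<xi>\<bar>" for \<kappa>
      using that by (intro real_sqrt_pow2) (auto simp: max_def)
    have eq: "(?A \<xi>) = (\<integral>\<^sup>+\<kappa>. ?p \<kappa> * ?q \<kappa> \<partial>lborel)"
    proof (intro nn_integral_cong)
      fix \<kappa> :: real
      show "ennreal (1 / max \<kappa> \<bar>\<xi>\<bar>) * f \<kappa> * indicator {0<..} \<kappa> = ?p \<kappa> * ?q \<kappa>"
      proof (cases "\<kappa> > 0")
        case True
        have "\<kappa> powr (-1/4) * \<kappa> powr (1/4) = 1" using True by (simp flip: powr_add)
        moreover have "(u * v) * (u * w) = u\<^sup>2 * (v * w)" for u v w :: real
          by (simp add: power2_eq_square mult_ac)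
        ultimately have "1 / max \<kappa> \<bar>\<xi>\<bar> = (?m \<kappa> * \<kappa> powr (-1/4)) * (?m \<kappa> * \<kappa> powr (1/4))"
          by (simp only: root_sq mult_1_right)
        then have "ennreal (1 / max \<kappa> \<bar>\<xi>\<bar>)
            = ennreal (?m \<kappa> * \<kappa> powr (-1/4)) * ennreal (?m \<kappa> * \<kappa> powr (1/4))"
          using True by (subst ennreal_mult[symmetric]) auto
        then show ?thesis using True by (simp add: mult.assoc)
      qed simp
    qed
    have "(?A \<xi>)\<^sup>2 \<le> (\<integral>\<^sup>+\<kappa>. (?p \<kappa>)\<^sup>2 \<partial>lborel) * (\<integral>\<^sup>+\<kappa>. (?q \<kappa>)\<^sup>2 \<partial>lborel)"
      unfolding eq by (rule Cauchy_Schwarz_nn_integral) measurable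
    also have "(\<integral>\<^sup>+\<kappa>. (?p \<kappa>)\<^sup>2 \<partial>lborel)
        = (\<integral>\<^sup>+\<kappa>. ennreal (\<kappa> powr (-1/2) / max \<kappa> \<bar>\<xi>\<bar>) * indicator {0<..} \<kappa> \<partial>lborel)"
    proof (intro nn_integral_cong)
      fix \<kappa> :: real
      have "(?m \<kappa> * \<kappa> powr (-1/4))\<^sup>2 = \<kappa> powr (-1/2) / max \<kappa> \<bar>\<xi>\<bar>"
        unfolding power_mult_distrib root_sq by (simp add: power2_eq_square flip: powr_add)
      then have "(ennreal (?m \<kappa> * \<kappa> powr (-1/4)))\<^sup>2 = ennreal (\<kappa> powr (-1/2) / max \<kappa> \<bar>\<xi>\<bar>)" if
          "\<kappa> > 0"
        using that by (subst ennreal_power) auto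
      then show "(?p \<kappa>)\<^sup>2 = ennreal (\<kappa> powr (-1/2) / max \<kappa> \<bar>\<xi>\<bar>) * indicator {0<..} \<kappa>"
        by (auto split: split_indicator)
    qed
    also have "\<dots> = ennreal (4 * \<bar>\<xi>\<bar> powr (-1/2))"
      by (rule nn_integral_powr_max) (use that in auto)
    also have "(\<integral>\<^sup>+\<kappa>. (?q \<kappa>)\<^sup>2 \<partial>lborel) = (\<integral>\<^sup>+\<kappa>. v \<xi> \<kappa> \<partial>lborel)"
    proof (intro nn_integral_cong)
      fix \<kappa> :: real
      have "(?m \<kappa> * \<kappa> powr (1/4))\<^sup>2 = \<kappa> powr (1/2) / max \<kappa> \<bar>\<xi>\<bar>"
        unfolding power_mult_distrib root_sq by (simp add: power2_eq_square flip: powr_add)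
      then have "(ennreal (?m \<kappa> * \<kappa> powr (1/4)))\<^sup>2 = ennreal (\<kappa> powr (1/2) / max \<kappa> \<bar>\<xi>\<bar>)" if "\<kappa> > 0"
        using that by (subst ennreal_power) auto
      then show "(?q \<kappa>)\<^sup>2 = v \<xi> \<kappa>"
        by (auto simp: v_def power_mult_distrib split: split_indicator)
    qed
    finally show ?thesis .
  qed
  have "(\<integral>\<^sup>+\<xi>. (?A \<xi>)\<^sup>2 \<partial>lborel)
     \<le> (\<integral>\<^sup>+\<xi>. (\<integral>\<^sup>+\<kappa>. ennreal (4 * \<bar>\<xi>\<bar> powr (-1/2)) * v \<xi> \<kappa> \<partial>lborel) \<partial>lborel)"
    by (intro nn_integral_mono_AE, use AE_lborel_singleton[of "0::real"] in eventually_elim)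
      (use cs in \<open>simp add: nn_integral_cmult\<close>)
  also have "\<dots> = (\<integral>\<^sup>+\<kappa>. (\<integral>\<^sup>+\<xi>. ennreal (4 * \<bar>\<xi>\<bar> powr (-1/2)) * v \<xi> \<kappa> \<partial>lborel) \<partial>lborel)"
    by (rule lborel_pair.Fubini') measurable
  also have "\<dots> = (\<integral>\<^sup>+\<kappa>. 32 * ((f \<kappa>)\<^sup>2 * indicator {0<..} \<kappa>) \<partial>lborel)"
  proof (intro nn_integral_cong)
    fix \<kappa> :: real
    show "(\<integral>\<^sup>+\<xi>. ennreal (4 * \<bar>\<xi>\<bar> powr (-1/2)) * v \<xi> \<kappa> \<partial>lborel)
        = 32 * ((f \<kappa>)\<^sup>2 * indicator {0<..} \<kappa>)"
    proof (cases "\<kappa> > 0")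
      case True
      have "(\<integral>\<^sup>+\<xi>. ennreal (4 * \<bar>\<xi>\<bar> powr (-1/2)) * v \<xi> \<kappa> \<partial>lborel)
        = (\<integral>\<^sup>+\<xi>. (ennreal (4 * \<kappa> powr (1/2)) * (f \<kappa>)\<^sup>2) * ennreal (\<bar>\<xi>\<bar> powr (-1/2) / max \<bar>\<xi>\<bar> \<kappa>)
            \<partial>lborel)"
      proof (intro nn_integral_cong)
        fix \<xi> :: real
        have "ennreal (4 * \<bar>\<xi>\<bar> powr (-1/2)) * ennreal (\<kappa> powr (1/2) / max \<kappa> \<bar>\<xi>\<bar>)
            = ennreal (4 * \<kappa> powr (1/2)) * ennreal (\<bar>\<xi>\<bar> powr (-1/2) / max \<bar>\<xi>\<bar> \<kappa>)"
          using True by (simp add: ennreal_mult[symmetric] max.commute)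
        then show "ennreal (4 * \<bar>\<xi>\<bar> powr (-1/2)) * v \<xi> \<kappa>
            = (ennreal (4 * \<kappa> powr (1/2)) * (f \<kappa>)\<^sup>2) * ennreal (\<bar>\<xi>\<bar> powr (-1/2) / max \<bar>\<xi>\<bar> \<kappa>)"
          using True by (simp add: v_def mult_ac)
      qed
      also have "\<dots> = (ennreal (4 * \<kappa> powr (1/2)) * (f \<kappa>)\<^sup>2) * (\<integral>\<^sup>+\<xi>. ennreal (\<bar>\<xi>\<bar> powr
          (-1/2) / max \<bar>\<xi>\<bar> \<kappa>) \<partial>lborel)"
        by (rule nn_integral_cmult) measurable
      also have "(\<integral>\<^sup>+\<xi>. ennreal (\<bar>\<xi>\<bar> powr (-1/2) / max \<bar>\<xi>\<bar> \<kappa>) \<partial>lborel)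
          = 2 * ennreal (4 * \<kappa> powr (-1/2))"
        using nn_integral_even[of "\<lambda>\<xi>. ennreal (\<xi> powr (-1/2) / max \<xi> \<kappa>)"] nn_integral_powr_max[OF
            True] by simp
      also have "ennreal (4 * \<kappa> powr (1/2)) * (f \<kappa>)\<^sup>2 * (2 * ennreal (4 * \<kappa> powr (-1/2)))
          = 2 * (ennreal (4 * \<kappa> powr (1/2)) * ennreal (4 * \<kappa> powr (-1/2))) * (f \<kappa>)\<^sup>2"
        by (simp add: mult_ac)
      also have "ennreal (4 * \<kappa> powr (1/2)) * ennreal (4 * \<kappa> powr (-1/2))
          = ennreal ((4 * \<kappa> powr (1/2)) * (4 * \<kappa> powr (-1/2)))"
        by (rule ennreal_mult[symmetric]) auto
      also have "(4 * \<kappa> powr (1/2)) * (4 * \<kappa> powr (-1/2)) = 16 * (\<kappa> powr (1/2) * \<kappa> powr (-1/2))"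
        by simp
      also have "\<kappa> powr (1/2) * \<kappa> powr (-1/2) = 1" using True by (simp flip: powr_add)
      finally show ?thesis using True by simp
    qed (simp add: v_def)
  qed
  also have "\<dots> = 32 * (\<integral>\<^sup>+\<kappa>. (f \<kappa>)\<^sup>2 * indicator {0<..} \<kappa> \<partial>lborel)"
    by (rule nn_integral_cmult) measurable
  finally show ?thesis .
qed

section \<open>The extension operator\<close>

text \<open>
  For \<open>\<kappa> > 0\<close> a function of the frequency \<open>\<xi>\<close> whose inverse transform extends \<open>exp (- \<kappa> y)\<close>
  from \<open>y > 0\<close> to the whole line.
\<close>

definition ext_kernel :: "nat \<Rightarrow> real \<Rightarrow> real \<Rightarrow> complex" where
  "ext_kernel m \<xi> \<kappa> = indicator {0<..} \<kappa> *\<^sub>R (ext_symbol m (\<xi> / \<kappa>) / of_real \<kappa>)"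

lemma ext_kernel_measurable [measurable (raw)]:
  assumes [measurable]: "f \<in> borel_measurable M" "g \<in> borel_measurable M"
  shows "(\<lambda>x. ext_kernel m (f x) (g x)) \<in> borel_measurable M"
  unfolding ext_kernel_def by measurable

text \<open>
  The Fourier weight of the squared Sobolev norm of order \<open>s\<close>.
\<close>

definition weight :: "real \<Rightarrow> real \<times> real \<Rightarrow> real" where
  "weight s z = (1 + (fst z)\<^sup>2 + (snd z)\<^sup>2) powr s"

lemma weight_measurable [measurable]: "weight s \<in> borel_measurable borel"
  unfolding weight_def[abs_def] by measurable

lemma weight_nonneg: "0 \<le> weight s z" by (simp add: weight_def)

lemma weight_0: "weight 0 z = 1"
proof -
  have "1 + (fst z)\<^sup>2 + (snd z)\<^sup>2 > 0" by (intro add_pos_nonneg) auto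
  then show ?thesis by (simp add: weight_def)
qed

lemma weight_half_square: "(weight (s / 2) z)\<^sup>2 = weight s z"
  by (simp add: weight_def power2_eq_square flip: powr_add)

abbreviation weighted_sq_norm :: "real \<Rightarrow> (real \<times> real \<Rightarrow> complex) \<Rightarrow> ennreal" where
  "weighted_sq_norm s f \<equiv> (\<integral>\<^sup>+z. ennreal (weight s z * (cmod (f z))\<^sup>2) \<partial>lborel)"

lemma sq_norm_le_weight:
  assumes "s \<ge> 0"
  shows "sq_norm2 f \<le> weighted_sq_norm s f"
  unfolding sq_norm_def
proof (intro nn_integral_mono ennreal_leI)
  fix z
  have "1 \<le> weight s z" unfolding weight_def using assms by (intro ge_one_powr_ge_zero) auto
  then show "(cmod (f z))\<^sup>2 \<le> weight s z * (cmod (f z))\<^sup>2"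
    using mult_right_mono[of 1 "weight s z" "(cmod (f z))\<^sup>2"] by simp
qed

text \<open>
  Since \<open>1 + k\<^sup>2 + \<xi>\<^sup>2 \<le> (1 + k\<^sup>2 + \<kappa>\<^sup>2) (1 + (\<xi>/\<kappa>)\<^sup>2)\<close>, moving the weight from \<open>\<xi>\<close> to \<open>\<kappa>\<close>
  costs \<open>s\<close> of the \<open>m + 1\<close> powers of \<open>\<xi>/\<kappa>\<close> by which the symbol decays, and at least one power
  is left, which gives Hilbert's kernel.
\<close>

lemma ext_kernel_weight_le:
  assumes "0 \<le> s" "s \<le> real m" "\<kappa> > 0"
  shows "weight (s / 2) (k, \<xi>) * cmod (ext_kernel m \<xi> \<kappa>)
      \<le> 2 ^ m * (1 / max \<kappa> \<bar>\<xi>\<bar>) * weight (s / 2) (k, \<kappa>)"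
proof -
  define q where "q = \<xi> / \<kappa>"
  define S where "S = sqrt (1 + q\<^sup>2)"
  have S: "S \<ge> 1" "S > 0" "S\<^sup>2 = 1 + q\<^sup>2" by (auto simp: S_def add_pos_nonneg)
  have xi: "\<xi> = q * \<kappa>" using assms by (simp add: q_def)
  have "1 + k\<^sup>2 + \<xi>\<^sup>2 \<le> (1 + k\<^sup>2 + \<kappa>\<^sup>2) * (1 + q\<^sup>2)"
    by (simp add: xi algebra_simps power_mult_distrib)
  then have "weight (s/2) (k, \<xi>) \<le> ((1 + k\<^sup>2 + \<kappa>\<^sup>2) * (1 + q\<^sup>2)) powr (s/2)"
    unfolding weight_def using assms by (intro powr_mono2) auto
  also have "\<dots> = weight (s/2) (k, \<kappa>) * (S\<^sup>2) powr (s/2)"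
    unfolding weight_def S(3) by (simp add: powr_mult)
  also have "\<dots> \<le> weight (s/2) (k, \<kappa>) * S ^ m"
  proof (rule mult_left_mono[OF _ weight_nonneg])
    have "(S\<^sup>2) powr (s/2) = S powr s"
      using S(2) by (simp add: powr_powr flip: powr_numeral)
    also have "\<dots> \<le> S powr real m" using S assms by (intro powr_mono) auto
    also have "\<dots> = S ^ m" using S by (simp add: powr_realpow)
    finally show "(S\<^sup>2) powr (s/2) \<le> S ^ m" .
  qed
  finally have w: "weight (s/2) (k, \<xi>) \<le> weight (s/2) (k, \<kappa>) * S ^ m" .
  have "max \<kappa> \<bar>\<xi>\<bar> \<le> S * \<kappa>"
  proof -
    have "\<bar>q\<bar> \<le> S" unfolding S_def by (intro real_le_rsqrt) simp
    then have "\<bar>q\<bar> * \<kappa> \<le> S * \<kappa>" using assms by (intro mult_right_mono) auto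
    moreover have "1 * \<kappa> \<le> S * \<kappa>" using S assms by (intro mult_right_mono) auto
    ultimately show ?thesis using assms by (simp add: xi abs_mult)
  qed
  then have inv: "1 / (S * \<kappa>) \<le> 1 / max \<kappa> \<bar>\<xi>\<bar>"
    using assms S by (intro divide_left_mono) (auto simp: max_def)
  have k: "cmod (ext_kernel m \<xi> \<kappa>) = 2 ^ m / (2 * pi) / S ^ Suc m / \<kappa>"
    using assms by (simp add: ext_kernel_def norm_divide cmod_ext_symbol S_def q_def)
  have "weight (s / 2) (k, \<xi>) * cmod (ext_kernel m \<xi> \<kappa>)
      \<le> (weight (s/2) (k, \<kappa>) * S ^ m) * (2 ^ m / (2 * pi) / S ^ Suc m / \<kappa>)"
    unfolding k using w assms S by (intro mult_right_mono) auto
  also have "\<dots> = 2 ^ m / (2 * pi) * (1 / (S * \<kappa>)) * weight (s/2) (k, \<kappa>)"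
    using S assms by (simp add: field_simps)
  also have "\<dots> \<le> 2 ^ m * (1 / max \<kappa> \<bar>\<xi>\<bar>) * weight (s/2) (k, \<kappa>)"
  proof (rule mult_right_mono[OF mult_mono[OF _ inv] weight_nonneg])
    have "2 ^ m / (2 * pi) \<le> 2 ^ m / 1"
      using pi_gt3 by (intro divide_left_mono) auto
    then show "2 ^ m / (2 * pi) \<le> 2 ^ m" by simp
  qed (use S assms in auto)
  finally show ?thesis .
qed

text \<open>
  The majorant of \<open>ext_op\<close>; the integral of \<open>ext_op\<close> exists where it is finite.
\<close>

definition ext_abs :: "nat \<Rightarrow> (real \<times> real \<Rightarrow> complex) \<Rightarrow> real \<times> real \<Rightarrow> ennreal" where
  "ext_abs m h z = (\<integral>\<^sup>+\<kappa>. ennreal (cmod (ext_kernel m (snd z) \<kappa> * h (fst z, \<kappa>))) \<partial>lborel)"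

text \<open>
  The operator that takes the density \<open>h\<close> of a superposition of \<open>cis (k x) exp (- \<kappa> y)\<close> on
  \<open>y > 0\<close> to a density in frequency space whose inverse transform extends this superposition to
  the plane.
\<close>

definition ext_op :: "nat \<Rightarrow> (real \<times> real \<Rightarrow> complex) \<Rightarrow> real \<times> real \<Rightarrow> complex" where
  "ext_op m h z = (\<integral>\<kappa>. ext_kernel m (snd z) \<kappa> * h (fst z, \<kappa>) \<partial>lborel)"

lemma ext_abs_measurable [measurable]:
  assumes [measurable]: "h \<in> borel_measurable borel"
  shows "ext_abs m h \<in> borel_measurable borel"
  unfolding ext_abs_def[abs_def] by measurable

lemma ext_op_measurable [measurable]:
  assumes [measurable]: "h \<in> borel_measurable borel"
  shows "ext_op m h \<in> borel_measurable borel"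
  unfolding ext_op_def[abs_def] by measurable

lemma cmod_ext_op_le: "ennreal (cmod (ext_op m h z)) \<le> ext_abs m h z"
  unfolding ext_op_def ext_abs_def by (rule ennreal_norm_integral_le)

text \<open>
  For each \<open>k\<close> this is Hilbert's inequality, after the weight has been moved through the
  kernel.
\<close>

lemma ext_abs_weight_le:
  assumes [measurable]: "h \<in> borel_measurable borel" and s: "0 \<le> s" "s \<le> real m"
  shows "(\<integral>\<^sup>+z. ennreal (weight s z) * (ext_abs m h z)\<^sup>2 \<partial>lborel)
      \<le> ennreal (32 * 4 ^ m) * weighted_sq_norm s h"
proof -
  let ?S = "\<lambda>k \<xi>. ennreal (weight s (k, \<xi>)) * (ext_abs m h (k, \<xi>))\<^sup>2"
  let ?T = "\<lambda>k \<kappa>. ennreal (32 * 4 ^ m) * ennreal (weight s (k, \<kappa>) * (cmod (h (k, \<kappa>)))\<^sup>2)"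
  have "(\<integral>\<^sup>+z. ennreal (weight s z) * (ext_abs m h z)\<^sup>2 \<partial>lborel)
      = (\<integral>\<^sup>+k. (\<integral>\<^sup>+\<xi>. ?S k \<xi> \<partial>lborel) \<partial>lborel)"
    by (rule nn_integral_plane) measurable
  also have "\<dots> \<le> (\<integral>\<^sup>+k. (\<integral>\<^sup>+\<kappa>. ?T k \<kappa> \<partial>lborel) \<partial>lborel)"
  proof (rule nn_integral_mono)
    fix k :: real
    define f where "f \<kappa> = ennreal (2 ^ m * weight (s / 2) (k, \<kappa>) * cmod (h (k, \<kappa>)))" for \<kappa>
    have [measurable]: "f \<in> borel_measurable borel" unfolding f_def by measurable
    let ?A = "\<lambda>\<xi>. (\<integral>\<^sup>+\<kappa>. ennreal (1 / max \<kappa> \<bar>\<xi>\<bar>) * f \<kappa> * indicator {0<..} \<kappa> \<partial>lborel)"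
    have "(\<integral>\<^sup>+\<xi>. ?S k \<xi> \<partial>lborel)
      \<le> (\<integral>\<^sup>+\<xi>. (?A \<xi>)\<^sup>2 \<partial>lborel)"
    proof (rule nn_integral_mono)
      fix \<xi>
      have "(?S k \<xi>) = (ennreal (weight (s/2) (k, \<xi>)) * ext_abs m h (k, \<xi>))\<^sup>2"
        by (simp add: power_mult_distrib ennreal_power weight_nonneg weight_half_square)
      also have "ennreal (weight (s/2) (k, \<xi>)) * ext_abs m h (k, \<xi>)
          = (\<integral>\<^sup>+\<kappa>. ennreal (weight (s/2) (k, \<xi>)) * ennreal (cmod (ext_kernel m \<xi> \<kappa> * h (k, \<kappa>)))
          \<partial>lborel)"
        unfolding ext_abs_def fst_conv snd_conv by (rule nn_integral_cmult[symmetric]) measurable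
      also have "\<dots>\<^sup>2 \<le> (?A \<xi>)\<^sup>2"
      proof (intro power_mono nn_integral_mono)
        fix \<kappa>
        show "ennreal (weight (s/2) (k, \<xi>)) * ennreal (cmod (ext_kernel m \<xi> \<kappa> * h (k, \<kappa>)))
            \<le> ennreal (1 / max \<kappa> \<bar>\<xi>\<bar>) * f \<kappa> * indicator {0<..} \<kappa>"
        proof (cases "\<kappa> > 0")
          case True
          have "ennreal (weight (s/2) (k, \<xi>)) * ennreal (cmod (ext_kernel m \<xi> \<kappa> * h (k, \<kappa>)))
              = ennreal (weight (s/2) (k, \<xi>) * cmod (ext_kernel m \<xi> \<kappa>) * cmod (h (k, \<kappa>)))"
            by (simp add: norm_mult ennreal_mult[symmetric] weight_nonneg mult.assoc)
          also have "\<dots> \<le> ennreal ((2 ^ m * (1 / max \<kappa> \<bar>\<xi>\<bar>) * weight (s / 2) (k, \<kappa>)) * cmod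
              (h (k, \<kappa>)))"
            by (intro ennreal_leI mult_right_mono ext_kernel_weight_le s True) auto
          also have "\<dots> = ennreal ((1 / max \<kappa> \<bar>\<xi>\<bar>) * (2 ^ m * weight (s / 2) (k, \<kappa>) * cmod
              (h (k, \<kappa>))))"
            by (simp only: mult_ac)
          also have "\<dots> = ennreal (1 / max \<kappa> \<bar>\<xi>\<bar>) * f \<kappa>"
            unfolding f_def using True by (intro ennreal_mult) (auto simp: weight_nonneg)
          finally show ?thesis using True by simp
        qed (simp add: ext_kernel_def)
      qed simp
      finally show "(?S k \<xi>) \<le> (?A \<xi>)\<^sup>2" .
    qed
    also have "\<dots> \<le> 32 * (\<integral>\<^sup>+\<kappa>. (f \<kappa>)\<^sup>2 * indicator {0<..} \<kappa> \<partial>lborel)"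
      by (rule hilbert_schur) measurable
    also have "\<dots> \<le> 32 * (\<integral>\<^sup>+\<kappa>. (f \<kappa>)\<^sup>2 \<partial>lborel)"
      by (intro mult_left_mono nn_integral_mono) (auto split: split_indicator)
    also have "\<dots> = (\<integral>\<^sup>+\<kappa>. 32 * (f \<kappa>)\<^sup>2 \<partial>lborel)"
      by (rule nn_integral_cmult[symmetric]) measurable
    also have "\<dots> = (\<integral>\<^sup>+\<kappa>. ?T k \<kappa> \<partial>lborel)"
    proof (intro nn_integral_cong)
      fix \<kappa>
      have "(2 ^ m)\<^sup>2 = (4::real) ^ m" by (simp add: power_mult[symmetric] mult.commute[of _ 2]
          power_mult)
      then have "(2 ^ m * weight (s / 2) (k, \<kappa>) * cmod (h (k, \<kappa>)))\<^sup>2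
          = 4 ^ m * (weight s (k, \<kappa>) * (cmod (h (k, \<kappa>)))\<^sup>2)"
        by (simp add: power_mult_distrib weight_half_square)
      then have "(f \<kappa>)\<^sup>2 = ennreal (4 ^ m) * ennreal (weight s (k, \<kappa>) * (cmod (h (k, \<kappa>)))\<^sup>2)"
        unfolding f_def by (simp add: ennreal_power weight_nonneg ennreal_mult[symmetric])
      moreover have "ennreal (32 * 4 ^ m) = 32 * ennreal (4 ^ m)"
        by (subst ennreal_mult') auto
      ultimately show "32 * (f \<kappa>)\<^sup>2 = (?T k \<kappa>)"
        by (simp add: mult.assoc)
    qed
    finally show "(\<integral>\<^sup>+\<xi>. ?S k \<xi> \<partial>lborel) \<le> (\<integral>\<^sup>+\<kappa>. ?T k \<kappa> \<partial>lborel)" .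
  qed
  also have "\<dots> = (\<integral>\<^sup>+z. ennreal (32 * 4 ^ m) * ennreal (weight s z * (cmod (h z))\<^sup>2) \<partial>lborel)"
    by (rule nn_integral_plane[symmetric]) measurable
  also have "\<dots> = ennreal (32 * 4 ^ m) * weighted_sq_norm s h"
    by (rule nn_integral_cmult) measurable
  finally show ?thesis .
qed

lemma ext_op_weight_le:
  assumes [measurable]: "h \<in> borel_measurable borel" and s: "0 \<le> s" "s \<le> real m"
  shows "weighted_sq_norm s (ext_op m h) \<le> ennreal (32 * 4 ^ m) * weighted_sq_norm s h"
proof -
  have "ennreal (weight s z * (cmod (ext_op m h z))\<^sup>2) \<le> ennreal (weight s z) * (ext_abs m h z)\<^sup>2"
      for z
  proof -
    have "ennreal (weight s z * (cmod (ext_op m h z))\<^sup>2)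
        = ennreal (weight s z) * (ennreal (cmod (ext_op m h z)))\<^sup>2"
      by (simp add: ennreal_mult weight_nonneg ennreal_power)
    also have "\<dots> \<le> ennreal (weight s z) * (ext_abs m h z)\<^sup>2"
      by (intro mult_left_mono power_mono cmod_ext_op_le) auto
    finally show ?thesis .
  qed
  then show ?thesis by (intro order_trans[OF nn_integral_mono ext_abs_weight_le[OF assms]])
qed

lemma sq_norm_ext_op_le:
  assumes [measurable]: "h \<in> borel_measurable borel"
  shows "sq_norm2 (ext_op m h) \<le> ennreal (32 * 4 ^ m) * sq_norm2 h"
proof -
  show ?thesis
    using ext_op_weight_le[OF assms, of 0 m] by (simp add: sq_norm_def weight_0)
qed

lemma AE_integrable_ext_op:
  assumes [measurable]: "h \<in> borel_measurable borel" and "sq_norm2 h < \<infinity>"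
  shows "AE z in lborel. integrable lborel (\<lambda>\<kappa>. ext_kernel m (snd z) \<kappa> * h (fst z, \<kappa>))"
proof -
  have "(\<integral>\<^sup>+z. (ext_abs m h z)\<^sup>2 \<partial>lborel) \<le> ennreal (32 * 4 ^ m) * sq_norm2 h"
    using ext_abs_weight_le[OF assms(1), of 0 m] by (simp add: sq_norm_def weight_0)
  also have "\<dots> < \<infinity>" using assms(2) by (simp add: ennreal_mult_less_top)
  finally have "AE z in lborel. (ext_abs m h z)\<^sup>2 \<noteq> \<infinity>"
    by (intro nn_integral_PInf_AE) auto
  then show ?thesis
  proof eventually_elim
    fix z assume "(ext_abs m h z)\<^sup>2 \<noteq> \<infinity>"
    then have "ext_abs m h z < \<infinity>" by (auto simp: less_top[symmetric] power2_eq_square)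
    then show "integrable lborel (\<lambda>\<kappa>. ext_kernel m (snd z) \<kappa> * h (fst z, \<kappa>))"
      unfolding ext_abs_def by (intro integrableI_bounded) auto
  qed
qed

text \<open>
  The operator is linear only where its integrals exist, hence the restriction to almost every
  point.
\<close>

lemma AE_ext_op_diff:
  assumes [measurable]: "f \<in> borel_measurable borel" "g \<in> borel_measurable borel" and
      "sq_norm2 f < \<infinity>" "sq_norm2 g < \<infinity>"
  shows "AE z in lborel. ext_op m (\<lambda>z. f z - g z) z = ext_op m f z - ext_op m g z"
  using AE_integrable_ext_op[OF assms(1,3), of m] AE_integrable_ext_op[OF assms(2,4), of m]
  by eventually_elim (simp add: ext_op_def right_diff_distrib)

lemma ext_kernel_inversion:
  assumes "m \<ge> 1" "\<kappa> > 0" "y > 0"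
  shows "(\<integral>\<xi>. cis (\<xi> * y) * ext_kernel m \<xi> \<kappa> \<partial>lborel) = of_real (exp (- \<kappa> * y))"
proof -
  have "(\<integral>\<xi>. cis (\<xi> * y) * ext_kernel m \<xi> \<kappa> \<partial>lborel)
      = \<bar>\<kappa>\<bar> *\<^sub>R (\<integral>u. cis ((0 + \<kappa> * u) * y) * ext_kernel m (0 + \<kappa> * u) \<kappa> \<partial>lborel)"
    using assms by (intro lborel_integral_real_affine) auto
  also have "\<dots> = (\<integral>u. \<bar>\<kappa>\<bar> *\<^sub>R (cis ((0 + \<kappa> * u) * y) * ext_kernel m (0 + \<kappa> * u) \<kappa>) \<partial>lborel)"
    by (rule integral_scaleR_right[symmetric])
  also have "\<dots> = (\<integral>u. cis (u * (\<kappa> * y)) * ext_symbol m u \<partial>lborel)"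
    using assms by (intro integral_cong_lborel) (simp add: ext_kernel_def scaleR_conv_of_real
        mult_ac)
  also have "\<dots> = of_real (exp (- (\<kappa> * y)))"
    using assms by (intro ext_symbol_inversion) auto
  finally show ?thesis by simp
qed

lemma nn_integral_ext_kernel:
  assumes "m \<ge> 1"
  shows "(\<integral>\<^sup>+\<xi>. ennreal (cmod (ext_kernel m \<xi> \<kappa>)) \<partial>lborel)
      \<le> (\<integral>\<^sup>+u. ennreal (cmod (ext_symbol m u)) \<partial>lborel)"
proof (cases "\<kappa> > 0")
  case True
  have "(\<integral>\<^sup>+\<xi>. ennreal (cmod (ext_kernel m \<xi> \<kappa>)) \<partial>lborel)
      = ennreal \<bar>\<kappa>\<bar> * (\<integral>\<^sup>+u. ennreal (cmod (ext_kernel m (0 + \<kappa> * u) \<kappa>)) \<partial>lborel)"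
    using True by (intro nn_integral_real_affine) auto
  also have "\<dots> = (\<integral>\<^sup>+u. ennreal \<bar>\<kappa>\<bar> * ennreal (cmod (ext_kernel m (0 + \<kappa> * u) \<kappa>)) \<partial>lborel)"
    by (rule nn_integral_cmult[symmetric]) measurable
  also have "\<dots> = (\<integral>\<^sup>+u. ennreal (cmod (ext_symbol m u)) \<partial>lborel)"
    using True by (intro nn_integral_cong) (simp add: ext_kernel_def norm_divide
        ennreal_mult[symmetric])
  finally show ?thesis by simp
qed (simp add: ext_kernel_def)

lemma nn_integral_ext_abs:
  assumes [measurable]: "h \<in> borel_measurable borel" and m: "m \<ge> 1"
  shows "(\<integral>\<^sup>+\<xi>. ext_abs m h (k, \<xi>) \<partial>lborel) \<le> (\<integral>\<^sup>+u. ennreal (cmod (ext_symbol m u)) \<partial>lborel) *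
      (\<integral>\<^sup>+\<kappa>. ennreal (cmod (h (k, \<kappa>))) \<partial>lborel)"
proof -
  let ?C = "\<integral>\<^sup>+u. ennreal (cmod (ext_symbol m u)) \<partial>lborel"
  have "(\<integral>\<^sup>+\<xi>. ext_abs m h (k, \<xi>) \<partial>lborel)
      = (\<integral>\<^sup>+\<xi>. (\<integral>\<^sup>+\<kappa>. ennreal (cmod (ext_kernel m \<xi> \<kappa>)) * ennreal (cmod (h (k, \<kappa>))) \<partial>lborel)
      \<partial>lborel)"
    unfolding ext_abs_def by (simp add: norm_mult ennreal_mult)
  also have "\<dots> = (\<integral>\<^sup>+\<kappa>. (\<integral>\<^sup>+\<xi>. ennreal (cmod (ext_kernel m \<xi> \<kappa>)) * ennreal (cmod (h (k, \<kappa>)))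
      \<partial>lborel) \<partial>lborel)"
    by (rule lborel_pair.Fubini') measurable
  also have "\<dots> = (\<integral>\<^sup>+\<kappa>. (\<integral>\<^sup>+\<xi>. ennreal (cmod (ext_kernel m \<xi> \<kappa>)) \<partial>lborel) * ennreal
      (cmod (h (k, \<kappa>))) \<partial>lborel)"
    by (intro nn_integral_cong nn_integral_multc) measurable
  also have "\<dots> \<le> (\<integral>\<^sup>+\<kappa>. ?C * ennreal (cmod (h (k, \<kappa>))) \<partial>lborel)"
    by (intro nn_integral_mono mult_right_mono nn_integral_ext_kernel m) auto
  also have "\<dots> = ?C * (\<integral>\<^sup>+\<kappa>. ennreal (cmod (h (k, \<kappa>))) \<partial>lborel)"
    by (rule nn_integral_cmult) measurable
  finally show ?thesis .
qed

lemma integrable_ext_op: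
  assumes h: "integrable lborel h" and m: "m \<ge> 1"
  shows "integrable lborel (ext_op m h)"
proof (rule integrableI_bounded)
  have [measurable]: "h \<in> borel_measurable borel" using h
    by (auto dest: borel_measurable_integrable)
  show "ext_op m h \<in> borel_measurable lborel" by simp
  let ?C = "\<integral>\<^sup>+u. ennreal (cmod (ext_symbol m u)) \<partial>lborel"
  have "(\<integral>\<^sup>+z. ennreal (norm (ext_op m h z)) \<partial>lborel) \<le> (\<integral>\<^sup>+z. ext_abs m h z \<partial>lborel)"
    by (intro nn_integral_mono cmod_ext_op_le)
  also have "\<dots> = (\<integral>\<^sup>+k. (\<integral>\<^sup>+\<xi>. ext_abs m h (k, \<xi>) \<partial>lborel) \<partial>lborel)"
    by (rule nn_integral_plane) measurable
  also have "\<dots> \<le> (\<integral>\<^sup>+k. ?C * (\<integral>\<^sup>+\<kappa>. ennreal (cmod (h (k, \<kappa>))) \<partial>lborel) \<partial>lborel)"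
    by (intro nn_integral_mono nn_integral_ext_abs m) measurable
  also have "\<dots> = ?C * (\<integral>\<^sup>+k. (\<integral>\<^sup>+\<kappa>. ennreal (cmod (h (k, \<kappa>))) \<partial>lborel) \<partial>lborel)"
    by (rule nn_integral_cmult) measurable
  also have "\<dots> = ?C * (\<integral>\<^sup>+z. ennreal (cmod (h z)) \<partial>lborel)"
    by (subst nn_integral_plane[symmetric]) auto
  also have "\<dots> < \<infinity>"
    using h ext_symbol_L1[OF m] by (auto simp: integrable_iff_bounded ennreal_mult_less_top)
  finally show "(\<integral>\<^sup>+z. ennreal (norm (ext_op m h z)) \<partial>lborel) < \<infinity>" .
qed

text \<open>
  The inverse transform of \<open>ext_op m h\<close> is, on the half-plane, the superposition of decaying
  exponentials with density \<open>h\<close>. This is why the operator produces extensions.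
\<close>

lemma ft_ext_op:
  assumes h: "integrable lborel h" and m: "m \<ge> 1" and y: "y > 0"
  shows "ft 1 (ext_op m h) (x, y)
      = (\<integral>k. (\<integral>\<kappa>. indicator {0<..} \<kappa> *\<^sub>R (cis (k * x) * of_real (exp (- \<kappa> * y)) * h (k, \<kappa>))
      \<partial>lborel) \<partial>lborel)"
proof -
  let ?R = "\<lambda>k. (\<integral>\<kappa>. indicator {0<..} \<kappa> *\<^sub>R (cis (k * x) * of_real (exp (- \<kappa> * y)) * h (k, \<kappa>))
      \<partial>lborel)"
  let ?L = "\<lambda>k. (\<integral>\<xi>. cis (1 * ((x, y) \<bullet> (k, \<xi>))) * ext_op m h (k, \<xi>) \<partial>lborel)"
  have [measurable]: "h \<in> borel_measurable borel" using h
    by (auto dest: borel_measurable_integrable)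
  have "ft 1 (ext_op m h) (x, y) = (\<integral>z. cis (1 * ((x, y) \<bullet> z)) * ext_op m h z \<partial>lborel)"
    unfolding ft_def ..
  also have "\<dots> = (\<integral>k. ?L k \<partial>lborel)"
    by (intro integral_plane integrable_cis_mult integrable_ext_op h m) simp
  also have "\<dots> = (\<integral>k. ?R k \<partial>lborel)"
  proof (rule integral_cong_AE)
    show "AE k in lborel. (?L k) =
       (?R k)"
      using AE_integrable_plane[OF h]
    proof eventually_elim
      fix k assume hk: "integrable lborel (\<lambda>\<kappa>. h (k, \<kappa>))"
      let ?E = "\<lambda>\<xi> \<kappa>. cis (k * x) * (cis (\<xi> * y) * ext_kernel m \<xi> \<kappa>) * h (k, \<kappa>)"
      (* for fixed k the frequency and kappa are interchanged *)
      have int: "integrable (lborel \<Otimes>\<^sub>M lborel) (\<lambda>(\<xi>, \<kappa>). ?E \<xi> \<kappa>)"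
      proof (rule integrableI_bounded)
        have "(\<integral>\<^sup>+p. ennreal (norm (case p of (\<xi>, \<kappa>) \<Rightarrow> ?E \<xi> \<kappa>)) \<partial>(lborel \<Otimes>\<^sub>M lborel))
            = (\<integral>\<^sup>+\<xi>. ext_abs m h (k, \<xi>) \<partial>lborel)"
          unfolding ext_abs_def by (subst lborel.nn_integral_fst[symmetric]) (auto simp: norm_mult)
        also have "\<dots> \<le> (\<integral>\<^sup>+u. ennreal (cmod (ext_symbol m u)) \<partial>lborel) * (\<integral>\<^sup>+\<kappa>. ennreal
            (cmod (h (k, \<kappa>))) \<partial>lborel)"
          by (rule nn_integral_ext_abs[OF _ m]) measurable
        also have "\<dots> < \<infinity>"
          using hk ext_symbol_L1[OF m] by (auto simp: integrable_iff_bounded ennreal_mult_less_top)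
        finally show "(\<integral>\<^sup>+p. ennreal (norm (case p of (\<xi>, \<kappa>) \<Rightarrow> ?E \<xi> \<kappa>)) \<partial>(lborel \<Otimes>\<^sub>M lborel)) < \<infinity>" .
      qed measurable
      have "(?L k) = (\<integral>\<xi>. (\<integral>\<kappa>. ?E \<xi> \<kappa> \<partial>lborel) \<partial>lborel)"
        unfolding ext_op_def integral_mult_right_zero[symmetric]
        by (intro integral_cong_lborel) (simp add: inner_prod_def mult_ac flip: cis_mult)
      also have "\<dots> = (\<integral>\<kappa>. (\<integral>\<xi>. ?E \<xi> \<kappa> \<partial>lborel) \<partial>lborel)"
        by (rule lborel_pair.Fubini_integral[OF int, symmetric])
      also have "\<dots> = (?R k)"
      proof (intro integral_cong_lborel)
        fix \<kappa>
        show "(\<integral>\<xi>. ?E \<xi> \<kappa> \<partial>lborel) = indicator {0<..} \<kappa> *\<^sub>R (cis (k * x) * of_real (exp (- \<kappa> * y))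
            * h (k, \<kappa>))"
        proof (cases "\<kappa> > 0")
          case True
          show ?thesis
            unfolding integral_mult_left_zero integral_mult_right_zero ext_kernel_inversion[OF m
                True y]
            using True by simp
        qed (simp add: ext_kernel_def)
      qed
      finally show "(?L k) =
         (?R k)" .
    qed
  qed measurable
  finally show ?thesis .
qed

section \<open>Amplitudes on the half-axes and the Bourgain norms\<close>

lemma nn_integral_substitute_square:
  fixes F :: "real \<Rightarrow> real"
  assumes [measurable]: "F \<in> borel_measurable borel"
  shows "(\<integral>\<^sup>+\<kappa>. ennreal (F (\<kappa>\<^sup>2) * (2 * \<kappa>)) * indicator {0<..} \<kappa> \<partial>lborel)
      \<le> (\<integral>\<^sup>+x. ennreal (F x) \<partial>lborel)"
proof -
  let ?f = "\<lambda>(n::nat) \<kappa>. ennreal (F (\<kappa>\<^sup>2) * (2 * \<kappa>) * indicator {0..real n} \<kappa>)"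
  let ?g = "\<lambda>\<kappa>. ennreal (F (\<kappa>\<^sup>2) * (2 * \<kappa>)) * indicator {0<..} \<kappa>"
  let ?I = "(\<integral>\<^sup>+x. ennreal (F x) \<partial>lborel)"
  have le: "(\<integral>\<^sup>+\<kappa>. ?f n \<kappa> \<partial>lborel) \<le> ?I" for n
  proof -
    have "(\<integral>\<^sup>+x. ennreal (F x * indicator {0\<^sup>2..(real n)\<^sup>2} x) \<partial>lborel) = (\<integral>\<^sup>+\<kappa>. ?f n \<kappa> \<partial>lborel)"
      by (rule nn_integral_substitution)
        (auto intro!: derivative_eq_intros continuous_intros simp: set_borel_measurable_def)
    then have "(\<integral>\<^sup>+\<kappa>. ?f n \<kappa> \<partial>lborel)
        = (\<integral>\<^sup>+x. ennreal (F x * indicator {0\<^sup>2..(real n)\<^sup>2} x) \<partial>lborel)" ..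
    also have "\<dots> \<le> ?I"
      by (intro nn_integral_mono) (auto split: split_indicator)
    finally show ?thesis .
  qed
  have "(\<integral>\<^sup>+\<kappa>. ?g \<kappa> \<partial>lborel) \<le>
    (\<integral>\<^sup>+\<kappa>. liminf (\<lambda>n. ?f n \<kappa>) \<partial>lborel)"
  proof (rule nn_integral_mono)
    fix \<kappa> :: real
    obtain N :: nat where N: "\<kappa> \<le> real N" using real_arch_simple by blast
    have "\<forall>\<^sub>F n in sequentially. (?g \<kappa>) \<le> (?f n \<kappa>)"
      unfolding eventually_sequentially
      by (rule exI[of _ N]) (use N in \<open>auto split: split_indicator\<close>)
    then show "(?g \<kappa>) \<le> liminf (\<lambda>n. ?f n \<kappa>)"
      by (rule Liminf_bounded)
  qed
  also have "\<dots> \<le> liminf (\<lambda>n. \<integral>\<^sup>+\<kappa>. ?f n \<kappa> \<partial>lborel)"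
    by (rule nn_integral_liminf) measurable
  also have "\<dots> \<le> liminf (\<lambda>n::nat. \<integral>\<^sup>+x. ennreal (F x) \<partial>lborel)"
    by (intro Liminf_mono always_eventually allI le)
  also have "\<dots> = ?I" by (simp add: Liminf_const)
  finally show ?thesis .
qed

text \<open>
  The substitution \<open>\<tau> = - k\<^sup>2 - e \<kappa>\<^sup>2\<close> with \<open>d\<tau> = 2 \<kappa> d\<kappa>\<close>, for each \<open>k\<close>. It covers the part of
  the line on one side of \<open>- k\<^sup>2\<close>, whence the inequality.
\<close>

lemma nn_integral_parabola:
  fixes H :: "real \<times> real \<Rightarrow> real"
  assumes [measurable]: "H \<in> borel_measurable borel" and e: "e = 1 \<or> e = -1"
  shows "(\<integral>\<^sup>+z. ennreal (H (fst z, - (fst z)\<^sup>2 - e * (snd z)\<^sup>2) * (2 * snd z)) * indicator {0<..}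
      (snd z) \<partial>lborel) \<le> (\<integral>\<^sup>+z. ennreal (H z) \<partial>lborel)"
proof -
  have "(\<integral>\<^sup>+z. ennreal (H (fst z, - (fst z)\<^sup>2 - e * (snd z)\<^sup>2) * (2 * snd z)) * indicator {0<..}
      (snd z) \<partial>lborel)
     = (\<integral>\<^sup>+k. (\<integral>\<^sup>+\<kappa>. ennreal (H (k, - k\<^sup>2 - e * \<kappa>\<^sup>2) * (2 * \<kappa>)) * indicator {0<..} \<kappa> \<partial>lborel)
         \<partial>lborel)"
    by (subst nn_integral_plane) auto
  also have "\<dots> \<le> (\<integral>\<^sup>+k. (\<integral>\<^sup>+\<tau>. ennreal (H (k, \<tau>)) \<partial>lborel) \<partial>lborel)"
  proof (rule nn_integral_mono)
    fix k :: real
    have "(\<integral>\<^sup>+\<kappa>. ennreal (H (k, - k\<^sup>2 - e * \<kappa>\<^sup>2) * (2 * \<kappa>)) * indicator {0<..} \<kappa> \<partial>lborel)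
        \<le> (\<integral>\<^sup>+x. ennreal (H (k, - k\<^sup>2 + (- e) * x)) \<partial>lborel)"
      using nn_integral_substitute_square[of "\<lambda>x. H (k, - k\<^sup>2 - e * x)"] by simp
    also have "\<dots> = (\<integral>\<^sup>+\<tau>. ennreal (H (k, \<tau>)) \<partial>lborel)"
      using nn_integral_real_affine[of "\<lambda>\<tau>. ennreal (H (k, \<tau>))" "- e" "- k\<^sup>2"] e by auto
    finally show "(\<integral>\<^sup>+\<kappa>. ennreal (H (k, - k\<^sup>2 - e * \<kappa>\<^sup>2) * (2 * \<kappa>)) * indicator {0<..} \<kappa> \<partial>lborel)
        \<le> (\<integral>\<^sup>+\<tau>. ennreal (H (k, \<tau>)) \<partial>lborel)" .
  qed
  also have "\<dots> = (\<integral>\<^sup>+z. ennreal (H z) \<partial>lborel)"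
    by (rule nn_integral_plane[symmetric]) measurable
  finally show ?thesis .
qed

text \<open>
  The density of the solution formula at \<open>k\<^sub>2 = \<kappa>\<close> for \<open>e = 1\<close> and at \<open>k\<^sub>2 = i \<kappa>\<close> for \<open>e = -1\<close>,
  parametrised by \<open>\<kappa> > 0\<close>; the orientation of the contour and the factors \<open>i\<close> are absorbed.
\<close>

definition wave_amp :: "real \<Rightarrow> real \<Rightarrow> (real \<times> real \<Rightarrow> complex) \<Rightarrow> real \<times> real \<Rightarrow> complex" where
  "wave_amp e t G z = indicator {0<..} (snd z) *\<^sub>R
     (cis (- (((fst z)\<^sup>2 + e * (snd z)\<^sup>2) * t)) * of_real (2 * snd z) * G (fst z, - (fst z)\<^sup>2 - e
         * (snd z)\<^sup>2))"

lemma wave_amp_measurable [measurable]: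
  assumes [measurable]: "G \<in> borel_measurable borel"
  shows "wave_amp e t G \<in> borel_measurable borel"
  unfolding wave_amp_def[abs_def] by measurable

definition B_density :: "real \<Rightarrow> (real \<times> real \<Rightarrow> complex) \<Rightarrow> real \<times> real \<Rightarrow> real" where
  "B_density s g z = bourgain_density 0 ((2 * s + 1) / 4) g z + bourgain_density s (1 / 4) g z"

lemma bourgain_density_nonneg: "0 \<le> bourgain_density s b g z"
  by (cases z) (simp add: bourgain_density_def)

lemma B_density_nonneg: "0 \<le> B_density s g z"
  by (simp add: B_density_def bourgain_density_nonneg)

text \<open>
  With \<open>\<kappa>\<^sup>2 = |\<tau> + k\<^sup>2|\<close> the two terms on the right are the weights of the two Bourgain norms.
  The factor \<open>\<kappa>\<close> that the substitution leaves over is half a power of \<open>1 + \<kappa>\<^sup>2\<close>, which explains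
  the exponents \<open>1/4\<close> and \<open>(2s + 1)/4\<close>.
\<close>

lemma weight_split:
  fixes s k \<kappa> :: real
  assumes "s \<ge> 0" "\<kappa> > 0"
  shows "2 * \<kappa> * (1 + k\<^sup>2 + \<kappa>\<^sup>2) powr s
      \<le> 2 powr (s + 1) * ((1 + \<kappa>\<^sup>2) powr (s + 1/2) + (1 + k\<^sup>2) powr s * (1 + \<kappa>\<^sup>2) powr (1/2))"
proof -
  (* 1 + k^2 + kappa^2 is at most twice the larger of a and b *)
  define a where "a = 1 + k\<^sup>2"
  define b where "b = 1 + \<kappa>\<^sup>2"
  have ab: "a > 0" "b > 0" by (auto simp: a_def b_def add_pos_nonneg)
  have "(1 + k\<^sup>2 + \<kappa>\<^sup>2) powr s \<le> (2 * max a b) powr s"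
    using assms by (intro powr_mono2) (auto simp: a_def b_def max_def)
  also have "\<dots> = 2 powr s * max a b powr s" by (rule powr_mult)
  also have "\<dots> \<le> 2 powr s * (a powr s + b powr s)"
    by (intro mult_left_mono) (auto simp: max_def)
  finally have 1: "(1 + k\<^sup>2 + \<kappa>\<^sup>2) powr s \<le> 2 powr s * (a powr s + b powr s)" .
  have "\<kappa> \<le> sqrt b" unfolding b_def by (intro real_le_rsqrt) simp
  then have 2: "2 * \<kappa> \<le> 2 * b powr (1/2)" using ab by (simp add: powr_half_sqrt)
  have "2 * \<kappa> * (1 + k\<^sup>2 + \<kappa>\<^sup>2) powr s \<le> (2 * b powr (1/2)) * (2 powr s * (a powr s + b powr s))"
    using 1 2 assms by (intro mult_mono) auto
  also have "\<dots> = 2 powr (s + 1) * (b powr s * b powr (1/2) + a powr s * b powr (1/2))"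
    by (simp add: powr_add algebra_simps)
  also have "b powr s * b powr (1/2) = b powr (s + 1/2)" by (simp add: powr_add)
  finally show ?thesis by (simp add: a_def b_def)
qed

text \<open>
  The phase factor has modulus 1, so that the bound does not depend on the time \<open>t\<close>.
\<close>

lemma wave_amp_weight_le:
  assumes s: "s \<ge> 0" and e: "e = 1 \<or> e = -1"
    and [measurable]: "B_density s g \<in> borel_measurable borel"
  shows "weighted_sq_norm s (wave_amp e t (fourier g))
      \<le> ennreal (2 powr (s + 1)) * (\<integral>\<^sup>+z. ennreal (B_density s g z) \<partial>lborel)"
proof -
  define H where "H z = 2 powr (s + 1) * B_density s g z" for z
  have [measurable]: "H \<in> borel_measurable borel" unfolding H_def by measurable
  have "weighted_sq_norm s (wave_amp e t (fourier g)) \<le>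
     (\<integral>\<^sup>+z. ennreal (H (fst z, - (fst z)\<^sup>2 - e * (snd z)\<^sup>2) * (2 * snd z)) * indicator {0<..}
         (snd z) \<partial>lborel)"
  proof (rule nn_integral_mono)
    fix z :: "real \<times> real"
    obtain k \<kappa> where z: "z = (k, \<kappa>)" by (cases z)
    show "ennreal (weight s z * (cmod (wave_amp e t (fourier g) z))\<^sup>2)
        \<le> ennreal (H (fst z, - (fst z)\<^sup>2 - e * (snd z)\<^sup>2) * (2 * snd z)) * indicator {0<..} (snd z)"
    proof (cases "\<kappa> > 0")
      case True
      define G where "G = (cmod (fourier g (k, - k\<^sup>2 - e * \<kappa>\<^sup>2)))\<^sup>2"
      have "weight s z * (cmod (wave_amp e t (fourier g) z))\<^sup>2
          = (2 * \<kappa> * (1 + k\<^sup>2 + \<kappa>\<^sup>2) powr s) * G * (2 * \<kappa>)"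
        using True by (simp add: z weight_def wave_amp_def norm_mult power_mult_distrib G_def
            power2_eq_square)
      also have "\<dots> \<le> (2 powr (s + 1) * ((1 + \<kappa>\<^sup>2) powr (s + 1/2) + (1 + k\<^sup>2) powr s *
          (1 + \<kappa>\<^sup>2) powr (1/2))) * G * (2 * \<kappa>)"
        using weight_split[OF s True, of k] True by (intro mult_right_mono) (auto simp: G_def)
      also have "\<dots> = H (k, - k\<^sup>2 - e * \<kappa>\<^sup>2) * (2 * \<kappa>)"
      proof -
        have abs: "\<bar>- k\<^sup>2 - e * \<kappa>\<^sup>2 + k\<^sup>2\<bar> = \<kappa>\<^sup>2" using e by auto
        have ex: "2 * ((2 * s + 1) / 4) = s + 1/2" "2 * (1 / 4) = (1 / 2 :: real)"
          by (simp_all add: field_simps)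
        have pos: "1 + k\<^sup>2 \<noteq> 0" by (metis add_pos_nonneg less_irrefl zero_le_power2 zero_less_one)
        show ?thesis
          unfolding H_def B_density_def bourgain_density_def case_prod_conv abs ex G_def[symmetric]
          using pos by (simp add: algebra_simps)
      qed
      finally show ?thesis using True by (simp add: z ennreal_leI)
    qed (simp add: z wave_amp_def)
  qed
  also have "\<dots> \<le> (\<integral>\<^sup>+z. ennreal (H z) \<partial>lborel)"
    by (rule nn_integral_parabola[OF _ e]) measurable
  also have "\<dots> = (\<integral>\<^sup>+z. ennreal (2 powr (s + 1)) * ennreal (B_density s g z) \<partial>lborel)"
    unfolding H_def by (simp add: ennreal_mult B_density_nonneg)
  also have "\<dots> = ennreal (2 powr (s + 1)) * (\<integral>\<^sup>+z. ennreal (B_density s g z) \<partial>lborel)"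
    by (rule nn_integral_cmult) measurable
  finally show ?thesis .
qed

lemma B_density_integral:
  assumes "g \<in> B_space s"
  shows "B_density s g \<in> borel_measurable borel"
    and "(\<integral>\<^sup>+z. ennreal (B_density s g z) \<partial>lborel)
        = ennreal ((bourgain_norm 0 ((2 * s + 1) / 4) g)\<^sup>2 + (bourgain_norm s (1 / 4) g)\<^sup>2)"
proof -
  have i: "integrable lborel (bourgain_density 0 ((2 * s + 1) / 4) g)"
      "integrable lborel (bourgain_density s (1 / 4) g)"
    using assms by (auto simp: B_space_def bourgain_def)
  then have int: "integrable lborel (B_density s g)"
    unfolding B_density_def[abs_def] by (rule Bochner_Integration.integrable_add)
  then show "B_density s g \<in> borel_measurable borel" by (auto dest: borel_measurable_integrable)
  have "(\<integral>\<^sup>+z. ennreal (B_density s g z) \<partial>lborel) = ennreal (\<integral>z. B_density s g z \<partial>lborel)"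
    by (rule nn_integral_eq_integral[OF int]) (simp add: B_density_nonneg)
  also have "(\<integral>z. B_density s g z \<partial>lborel)
      = (\<integral>z. bourgain_density 0 ((2 * s + 1) / 4) g z \<partial>lborel) + (\<integral>z. bourgain_density s
      (1 / 4) g z \<partial>lborel)"
    unfolding B_density_def by (rule Bochner_Integration.integral_add[OF i])
  also have "\<dots> = (bourgain_norm 0 ((2 * s + 1) / 4) g)\<^sup>2 + (bourgain_norm s (1 / 4) g)\<^sup>2"
    unfolding bourgain_norm_def by (simp add: integral_nonneg_AE bourgain_density_nonneg)
  finally show "(\<integral>\<^sup>+z. ennreal (B_density s g z) \<partial>lborel)
      = ennreal ((bourgain_norm 0 ((2 * s + 1) / 4) g)\<^sup>2 + (bourgain_norm s (1 / 4) g)\<^sup>2)" .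
qed

section \<open>The contour integral as a Fourier integral\<close>

lemma has_contour_integral_real_segment:
  assumes "R \<ge> 0" "((\<lambda>x. f (of_real x)) has_integral I) {0..R}"
  shows "(f has_contour_integral I) (linepath 0 (of_real R))"
proof (cases "R = 0")
  case True
  then have "I = 0" using assms(2) by (simp add: has_integral_refl has_integral_unique)
  then show ?thesis using True by simp
next
  case False
  then show ?thesis using assms
    by (subst has_contour_integral_linepath_Reals_iff) auto
qed

lemma has_contour_integral_quadrant_boundary:
  assumes R: "R \<ge> 0"
    and I: "((\<lambda>x. f (of_real x)) has_integral I) {0..R}"
    and J: "((\<lambda>x. f (\<i> * of_real x)) has_integral J) {0..R}"
  shows "(f has_contour_integral (I - \<i> * J)) (quadrant_boundary R)"
proof -
  have "(f has_contour_integral (\<i> * J)) (linepath 0 (\<i> * of_real R))"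
  proof -
    have "((\<lambda>z. f (\<i> * z)) has_contour_integral J) (linepath 0 (of_real R))"
      by (rule has_contour_integral_real_segment) (use R J in auto)
    then have "((\<lambda>x. f (\<i> * linepath 0 (of_real R) x) * (of_real R - 0)) has_integral J) {0..1}"
      by (simp only: has_contour_integral_linepath)
    then have "((\<lambda>x. \<i> * (f (\<i> * linepath 0 (of_real R) x) * (of_real R - 0))) has_integral \<i> * J)
        {0..1}"
      by (rule has_integral_mult_right)
    moreover have "(\<lambda>x. \<i> * (f (\<i> * linepath 0 (of_real R) x) * (of_real R - 0)))
        = (\<lambda>x. f (linepath 0 (\<i> * of_real R) x) * (\<i> * of_real R - 0))"
      by (auto simp: linepath_def fun_eq_iff scaleR_conv_of_real mult_ac)
    ultimately show ?thesis by (simp only: has_contour_integral_linepath)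
  qed
  from has_contour_integral_reverse_linepath[OF this]
  have "(f has_contour_integral (- (\<i> * J) + I)) (quadrant_boundary R)"
    unfolding quadrant_boundary_def
    by (intro has_contour_integral_join has_contour_integral_real_segment R I) auto
  then show ?thesis by simp
qed

text \<open>
  A density in frequency space whose inverse transform extends the truncated solution to the
  plane.
\<close>

definition trunc_amp :: "nat \<Rightarrow> real \<Rightarrow> (real \<times> real \<Rightarrow> complex) \<Rightarrow> nat \<Rightarrow> real \<times> real \<Rightarrow> complex" where
  "trunc_amp m t G n z = 1 / (2 * of_real pi)\<^sup>2 * (cut_off n (wave_amp 1 t G) z + ext_op m
      (cut_off n (wave_amp (-1) t G)) z)"

lemma integrable_trunc_amp:
  assumes "G \<in> borel_measurable borel" "m \<ge> 1"
    and "sq_norm2 (wave_amp 1 t G) < \<infinity>" "sq_norm2 (wave_amp (-1) t G) < \<infinity>"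
  shows "integrable lborel (trunc_amp m t G n)"
  unfolding trunc_amp_def[abs_def]
  by (intro integrable_mult_right Bochner_Integration.integrable_add integrable_ext_op
      integrable_cut wave_amp_measurable assms)

text \<open>
  On the real half-axis the integrand is a Fourier integral already; on the imaginary half-axis
  it is a superposition of decaying exponentials, to which the extension operator applies. The
  integrals over \<open>k\<^sub>2\<close> exist for almost every \<open>k\<^sub>1\<close> only.
\<close>

lemma solution_trunc_eq_ft:
  assumes G[measurable]: "G \<in> borel_measurable borel" and G_eq: "G = fourier g" and m: "m \<ge> 1"
    and fin: "sq_norm2 (wave_amp 1 t G) < \<infinity>" "sq_norm2 (wave_amp (-1) t G) < \<infinity>"
    and y: "y > 0"
  shows "solution_trunc g t n (x, y) = ft 1 (trunc_amp m t G n) (x, y)"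
proof -
  let ?p = "cut_off n (wave_amp 1 t G)" and ?q = "cut_off n (wave_amp (-1) t G)"
  have [measurable]: "?p \<in> borel_measurable borel" "?q \<in> borel_measurable borel" by measurable
  have p: "integrable lborel ?p" and q: "integrable lborel ?q"
    using fin by (auto intro!: integrable_cut)
  (* A and B carry the real and the imaginary half-axis; the Henstock--Kurzweil integrals of
     the formula are compared with the Lebesgue integral of C outside a null set of k. *)
  define A where "A z = cis (1 * ((x, y) \<bullet> z)) * ?p z" for z
  define B where "B z = indicator {0<..} (snd z) *\<^sub>R (cis (fst z * x) * of_real
      (exp (- snd z * y)) * ?q z)" for z
  have [measurable]: "A \<in> borel_measurable borel" "B \<in> borel_measurable borel"
    unfolding A_def B_def by measurable
  have A: "integrable lborel A" unfolding A_def by (intro integrable_cis_mult p) simp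
  have B: "integrable lborel B"
  proof (rule Bochner_Integration.integrable_bound[OF q])
    show "AE z in lborel. norm (B z) \<le> norm (?q z)"
      using y by (intro AE_I2) (auto simp: B_def norm_mult intro!: mult_left_le_one_le split:
          split_indicator)
  qed simp
  define C where "C k = (\<integral>\<kappa>. A (k, \<kappa>) \<partial>lborel) + (\<integral>\<kappa>. B (k, \<kappa>) \<partial>lborel)" for k
  have C: "integrable lborel C"
    unfolding C_def by (intro Bochner_Integration.integrable_add integrable_plane A B)
  define f where "f k k2 = exp (\<i> * of_real k * of_real x + \<i> * k2 * of_real y - \<i> *
      ((of_real k)\<^sup>2 + k2\<^sup>2) * of_real t)
         * (2 * k2) * fourier g (k, Re (- (of_real k)\<^sup>2 - k2\<^sup>2))" for k :: real and k2 :: complex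
  have "ft 1 (trunc_amp m t G n) (x, y)
      = 1 / (2 * of_real pi)\<^sup>2 * (ft 1 ?p (x, y) + ft 1 (ext_op m ?q) (x, y))"
  proof -
    have "ft 1 (trunc_amp m t G n) (x, y)
        = 1 / (2 * of_real pi)\<^sup>2 * ft 1 (\<lambda>z. ?p z + ext_op m ?q z) (x, y)"
      unfolding trunc_amp_def ft_def integral_mult_right_zero[symmetric]
      by (intro integral_cong_lborel) (simp only: mult_ac)
    also have "ft 1 (\<lambda>z. ?p z + ext_op m ?q z) (x, y) = ft 1 ?p (x, y) + ft 1 (ext_op m ?q) (x, y)"
      by (rule ft_add[OF p integrable_ext_op[OF q m]])
    finally show ?thesis .
  qed
  also have "ft 1 ?p (x, y) = (\<integral>k. (\<integral>\<kappa>. A (k, \<kappa>) \<partial>lborel) \<partial>lborel)"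
    using integral_plane[OF A] by (simp only: ft_def A_def)
  also have "ft 1 (ext_op m ?q) (x, y) = (\<integral>k. (\<integral>\<kappa>. B (k, \<kappa>) \<partial>lborel) \<partial>lborel)"
    unfolding ft_ext_op[OF q m y] by (simp add: B_def)
  also have "(\<integral>k. (\<integral>\<kappa>. A (k, \<kappa>) \<partial>lborel) \<partial>lborel) + (\<integral>k. (\<integral>\<kappa>. B (k, \<kappa>) \<partial>lborel) \<partial>lborel)
      = (\<integral>k. C k \<partial>lborel)"
    unfolding C_def by (intro Bochner_Integration.integral_add[symmetric] integrable_plane A B)
  also have "(\<integral>k. C k \<partial>lborel) = (LINT k:{-real n..real n}|lborel. C k)"
    unfolding set_lebesgue_integral_def
  proof (intro integral_cong_lborel)
    fix k
    have "C k = 0" if "k \<notin> {-real n..real n}"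
    proof -
      have "(k, \<kappa>) \<notin> centred_square n" for \<kappa> using that by (auto simp: centred_square_def)
      then show ?thesis by (simp add: C_def A_def B_def cut_off_def)
    qed
    then show "C k = indicator {-real n..real n} k *\<^sub>R C k" by (auto split: split_indicator)
  qed
  also have "\<dots> = integral {-real n..real n} C"
    by (rule set_borel_integral_eq_integral)
      (use C in \<open>auto simp: set_integrable_def intro!: integrable_mult_indicator\<close>)
  also have "\<dots> = integral {-real n..real n} (\<lambda>k. contour_integral (quadrant_boundary (real n))
      (f k))"
  proof -
    have "AE k in lborel. integrable lborel (\<lambda>\<kappa>. A (k, \<kappa>)) \<and> integrable lborel (\<lambda>\<kappa>. B (k, \<kappa>))"
      using AE_integrable_plane[OF A] AE_integrable_plane[OF B] by eventually_elim auto
    then obtain N where N: "negligible N" and AB: "\<And>k. k \<notin> N \<Longrightarrow> integrable lborel (\<lambda>\<kappa>. A (k, \<kappa>))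
        \<and> integrable lborel (\<lambda>\<kappa>. B (k, \<kappa>))"
      by (rule AE_negligible) auto
    show ?thesis
    proof (rule integral_spike[OF N])
      fix k assume k: "k \<in> {-real n..real n} - N"
      have hk: "((\<lambda>\<kappa>. h (k, \<kappa>)) has_integral (\<integral>\<kappa>. h (k, \<kappa>) \<partial>lborel)) {0..real n}"
        if "integrable lborel (\<lambda>\<kappa>. h (k, \<kappa>))" "\<And>\<kappa>. \<kappa> \<notin> {0..real n} \<Longrightarrow> h (k, \<kappa>)
            = 0" for h :: "real \<times> real \<Rightarrow> complex"
      proof -
        have "(\<lambda>\<kappa>. if \<kappa> \<in> {0..real n} then h (k, \<kappa>) else 0) = (\<lambda>\<kappa>. h (k, \<kappa>))" using that(2) by auto
        then show ?thesis
          using has_integral_integral_lborel[OF that(1)] has_integral_restrict_UNIV[of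
              "{0..real n}" "\<lambda>\<kappa>. h (k, \<kappa>)"] by simp
      qed
      have "((\<lambda>\<kappa>. A (k, \<kappa>)) has_integral (\<integral>\<kappa>. A (k, \<kappa>) \<partial>lborel)) {0..real n}"
        by (rule hk) (use AB[of k] k in \<open>auto simp: A_def cut_off_def centred_square_def
            wave_amp_def split: split_indicator\<close>)
      then have I: "((\<lambda>\<kappa>. f k (of_real \<kappa>)) has_integral (\<integral>\<kappa>. A (k, \<kappa>) \<partial>lborel)) {0..real n}"
      proof (rule has_integral_eq[rotated])
        fix \<kappa> assume \<kappa>: "\<kappa> \<in> {0..real n}"
        have arg: "Re (- (complex_of_real k)\<^sup>2 - (complex_of_real \<kappa>)\<^sup>2) = - k\<^sup>2 - 1 * \<kappa>\<^sup>2"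
          by (simp flip: of_real_power)
        have ex: "exp (\<i> * of_real k * of_real x + \<i> * of_real \<kappa> * of_real y - \<i> *
            ((of_real k)\<^sup>2 + (of_real \<kappa>)\<^sup>2) * of_real t)
           = cis (1 * ((x, y) \<bullet> (k, \<kappa>))) * cis (- ((k\<^sup>2 + 1 * \<kappa>\<^sup>2) * t))"
          by (simp add: cis_conv_exp algebra_simps flip: exp_add)
        show "A (k, \<kappa>) = f k (of_real \<kappa>)"
          unfolding f_def arg ex using \<kappa> k
          by (cases "\<kappa> = 0") (auto simp: A_def G_eq cut_off_def centred_square_def wave_amp_def)
      qed
      have "((\<lambda>\<kappa>. B (k, \<kappa>)) has_integral (\<integral>\<kappa>. B (k, \<kappa>) \<partial>lborel)) {0..real n}"
        by (rule hk) (use AB[of k] k in \<open>auto simp: B_def cut_off_def centred_square_def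
            wave_amp_def split: split_indicator\<close>)
      then have "((\<lambda>\<kappa>. \<i> * B (k, \<kappa>)) has_integral \<i> * (\<integral>\<kappa>. B (k, \<kappa>) \<partial>lborel)) {0..real n}"
        by (rule has_integral_mult_right)
      then have J: "((\<lambda>\<kappa>. f k (\<i> * of_real \<kappa>)) has_integral \<i> * (\<integral>\<kappa>. B (k, \<kappa>) \<partial>lborel)) {0..real n}"
      proof (rule has_integral_eq[rotated])
        fix \<kappa> assume \<kappa>: "\<kappa> \<in> {0..real n}"
        have arg: "Re (- (complex_of_real k)\<^sup>2 - (\<i> * complex_of_real \<kappa>)\<^sup>2) = - k\<^sup>2 - (-1) * \<kappa>\<^sup>2"
          by (simp add: power_mult_distrib flip: of_real_power)
        have ex: "exp (\<i> * of_real k * of_real x + \<i> * (\<i> * of_real \<kappa>) * of_real y - \<i> *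
            ((of_real k)\<^sup>2 + (\<i> * of_real \<kappa>)\<^sup>2) * of_real t)
           = cis (k * x) * of_real (exp (- \<kappa> * y)) * cis (- ((k\<^sup>2 + (-1) * \<kappa>\<^sup>2) * t))"
          by (simp add: cis_conv_exp algebra_simps power_mult_distrib flip: exp_add exp_of_real)
        show "\<i> * B (k, \<kappa>) = f k (\<i> * of_real \<kappa>)"
          unfolding f_def arg ex using \<kappa> k
          by (cases "\<kappa> = 0") (auto simp: B_def G_eq cut_off_def centred_square_def wave_amp_def)
      qed
      (* the factor i of the tangent, the factor i of 2 i kappa and the orientation of the
         imaginary half-axis combine to +1 *)
      have "(f k has_contour_integral ((\<integral>\<kappa>. A (k, \<kappa>) \<partial>lborel) - \<i> * (\<i> * (\<integral>\<kappa>. B (k, \<kappa>) \<partial>lborel))))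
          (quadrant_boundary (real n))"
        by (rule has_contour_integral_quadrant_boundary[OF _ I J]) simp
      then show "contour_integral (quadrant_boundary (real n)) (f k) = C k"
        by (simp add: contour_integral_unique C_def)
    qed
  qed
  finally show ?thesis unfolding solution_trunc_def case_prod_conv f_def[abs_def] by (rule sym)
qed

section \<open>The estimate of the solution\<close>

text \<open>
  The extension of the solution is the inverse transform of the limit of the truncated
  amplitudes. By Fourier inversion its transform is, up to normalisation, that limit, and so
  its Sobolev norm is a weighted norm of the two amplitudes.
\<close>

lemma solution_extension:
  assumes s: "s \<ge> 0" and m: "m \<ge> 1" "s \<le> real m" and g: "g \<in> B_space s"
  obtains F where "F \<in> sobolev s" "F \<in> L2_on half_plane" "L2_limit half_plane (solution_trunc g t)
      F"
    "\<And>n. on_half (solution_trunc g t n) \<in> borel_measurable borel"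
    "sobolev_norm s F \<le> sqrt ((2 + 2 * (32 * 4 ^ m)) * 2 powr (s + 1)) * B_norm s g"
proof -
  define N where "N = (bourgain_norm 0 ((2 * s + 1) / 4) g)\<^sup>2 + (bourgain_norm s (1 / 4) g)\<^sup>2"
  have N0: "N \<ge> 0" by (simp add: N_def)
  have gm: "g \<in> borel_measurable borel" "sq_norm2 g < \<infinity>"
    using g by (auto simp: B_space_def bourgain_def L2_on_UNIV_iff)
  define G where "G = fourier g"
  have G[measurable]: "G \<in> borel_measurable borel" unfolding G_def
    by (rule fourier_measurable[OF gm])
  define p where "p e = wave_amp e t G" for e
  have [measurable]: "p e \<in> borel_measurable borel" for e unfolding p_def by measurable
  have pw: "weighted_sq_norm s (p e) \<le> ennreal (2 powr (s + 1) * N)" if "e = 1 \<or> e = -1" for e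
  proof -
    have "weighted_sq_norm s (p e) \<le> ennreal (2 powr (s + 1)) * (\<integral>\<^sup>+z. ennreal (B_density s g z)
        \<partial>lborel)"
      unfolding p_def G_def by (rule wave_amp_weight_le[OF s that B_density_integral(1)[OF g]])
    also have "\<dots> = ennreal (2 powr (s + 1) * N)"
      using N0 unfolding B_density_integral(2)[OF g] N_def[symmetric] by (simp add: ennreal_mult)
    finally show ?thesis .
  qed
  have fin: "sq_norm2 (p e) < \<infinity>" if "e = 1 \<or> e = -1" for e
    using sq_norm_le_weight[OF s] pw[OF that] by (rule le_less_trans[OF order_trans]) simp
  have fin1: "sq_norm2 (p 1) < \<infinity>" and fin2: "sq_norm2 (p (-1)) < \<infinity>" using fin[of 1] fin[of "-1"]
    by auto
  define c where "c = 1 / (2 * complex_of_real pi)\<^sup>2"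
  let ?u = "\<lambda>n z. cut_off n (p 1) z - p 1 z"
  let ?v = "\<lambda>n. \<lambda>z. cut_off n (p (-1)) z - p (-1) z"
  let ?e = "ext_op m (p (-1))"
  let ?M = "ennreal (2 powr (s + 1) * N)"
  define \<Phi> where "\<Phi> n = trunc_amp m t G n" for n
  have \<Phi>_eq: "\<Phi> n z = c * (cut_off n (p 1) z + ext_op m (cut_off n (p (-1))) z)" for n z
    by (simp add: \<Phi>_def trunc_amp_def p_def c_def)
  (* h is the Fourier transform of the extension *)
  define h where "h z = p 1 z + ?e z" for z
  define f where "f z = c * h z" for z
  have h_meas[measurable]: "h \<in> borel_measurable borel" unfolding h_def by measurable
  have f_meas[measurable]: "f \<in> borel_measurable borel" unfolding f_def by measurable
  have \<Phi>_meas[measurable]: "\<Phi> n \<in> borel_measurable borel" for n unfolding \<Phi>_eq[abs_def]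
    by measurable
  have int: "integrable lborel (\<Phi> n)" for n
    unfolding \<Phi>_def by (rule integrable_trunc_amp[OF G m(1)]) (use fin1 fin2 in \<open>auto simp: p_def\<close>)
  have cut_fin: "sq_norm2 (cut_off n (p e)) < \<infinity>" if "e = 1 \<or> e = -1" for n e
    using sq_norm_cut_le fin[OF that] by (rule le_less_trans)
  have ext_fin: "sq_norm2 (ext_op m u) < \<infinity>" if [measurable]: "u \<in> borel_measurable borel" and
      "sq_norm2 u < \<infinity>" for u
    using sq_norm_ext_op_le[OF that(1), of m] that(2)
    by (auto simp: ennreal_mult_less_top intro: le_less_trans)
  have finsum: "sq_norm2 (\<lambda>z. c * (u z + v z)) < \<infinity>"
    if [measurable]: "u \<in> borel_measurable borel" "v \<in> borel_measurable borel" and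
        "sq_norm2 u < \<infinity>" "sq_norm2 v < \<infinity>" for u v
  proof -
    have "sq_norm2 (\<lambda>z. u z + v z) < \<infinity>"
      by (rule le_less_trans[OF sq_norm_add_le]) (use that in \<open>auto simp: ennreal_mult_less_top\<close>)
    then show ?thesis by (subst sq_norm_cmult) (auto simp: ennreal_mult_less_top)
  qed
  have \<Phi>_fin: "sq_norm2 (\<Phi> n) < \<infinity>" for n
    unfolding \<Phi>_eq[abs_def] by (intro finsum ext_fin cut_fin) auto
  have \<Phi>_lim: "mean_limit lborel \<Phi> f"
  proof (rule tendsto_0_ennreal_bound)
    let ?d1 = "\<lambda>n. sq_norm2 (\<lambda>z. ?u n z)" and ?d2 = "\<lambda>n. sq_norm2 (?v n)"
    show "(\<lambda>n. ennreal ((cmod c)\<^sup>2) * (2 * ?d1 n + (2 * ennreal (32 * 4 ^ m)) * ?d2 n)) \<longlonglongrightarrow> 0"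
      by (intro tendsto_0_ennreal_cmult tendsto_0_ennreal_add cut_limit fin1 fin2)
          (auto simp: ennreal_mult_less_top)
    fix n
    have "sq_norm2 (\<lambda>z. \<Phi> n z - f z) = sq_norm2 (\<lambda>z. c * ((?u n z) + ext_op m (?v n) z))"
    proof (rule sq_norm_cong_AE)
      have "AE z in lborel. ext_op m (?v n) z = ext_op m (cut_off n (p (-1))) z - ?e z"
        by (rule AE_ext_op_diff) (use cut_fin[of "-1" n] fin2 in auto)
      then show "AE z in lborel. \<Phi> n z - f z = c * ((?u n z) + ext_op m (?v n) z)"
      proof eventually_elim
        case (elim z)
        have "c * (a + u) - c * (b + v) = c * ((a - b) + (u - v))" for a b u v
          by (simp add: algebra_simps)
        then show ?case unfolding elim \<Phi>_eq f_def h_def .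
      qed
    qed
    also have "\<dots> = ennreal ((cmod c)\<^sup>2) * sq_norm2 (\<lambda>z. (?u n z) + ext_op m (?v n) z)"
      by (rule sq_norm_cmult) measurable
    also have "\<dots> \<le> ennreal ((cmod c)\<^sup>2) * (2 * ?d1 n + 2 * sq_norm2 (ext_op m (?v n)))"
      by (intro mult_left_mono sq_norm_add_le) auto
    also have "\<dots> \<le> ennreal ((cmod c)\<^sup>2) * (2 * ?d1 n + 2 * (ennreal (32 * 4 ^ m) * ?d2 n))"
      by (intro mult_left_mono add_left_mono sq_norm_ext_op_le) auto
    finally show "sq_norm2 (\<lambda>z. \<Phi> n z - f z)
        \<le> ennreal ((cmod c)\<^sup>2) * (2 * ?d1 n + (2 * ennreal (32 * 4 ^ m)) * ?d2 n)"
      by (simp only: mult.assoc)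
  qed
  obtain F where F[measurable]: "F \<in> borel_measurable borel" and F_fin: "sq_norm2 F < \<infinity>"
    and F_lim: "mean_limit lborel (\<lambda>n. ft 1 (\<Phi> n)) F"
    by (rule ft_seq_converges[OF int \<Phi>_fin f_meas \<Phi>_lim, of 1]) auto
  have "AE z in lborel. fourier F z = of_real ((2 * pi)\<^sup>2) * f z"
    by (rule fourier_inversion[OF int \<Phi>_fin f_meas \<Phi>_lim F F_lim fourier_measurable[OF F F_fin]
        fourier_limit[OF F F_fin]])
  then have FF: "AE z in lborel. fourier F z = h z"
    by eventually_elim (simp add: f_def c_def)
  let ?I = "weighted_sq_norm s"
  have "?I (fourier F) = ?I h"
    by (rule nn_integral_cong_AE, use FF in eventually_elim) simp
  also have "\<dots> \<le> (\<integral>\<^sup>+z. 2 * ennreal (weight s z * (cmod (p 1 z))\<^sup>2) + 2 * ennreal (weight s z *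
      (cmod (?e z))\<^sup>2) \<partial>lborel)"
  proof (rule nn_integral_mono)
    fix z
    have "(cmod (h z))\<^sup>2 \<le> 2 * (cmod (p 1 z))\<^sup>2 + 2 * (cmod (?e z))\<^sup>2"
      unfolding h_def by (rule cmod_add_square_le)
    then have "weight s z * (cmod (h z))\<^sup>2
        \<le> weight s z * (2 * (cmod (p 1 z))\<^sup>2 + 2 * (cmod (?e z))\<^sup>2)"
      by (intro mult_left_mono weight_nonneg)
    also have "\<dots> = 2 * (weight s z * (cmod (p 1 z))\<^sup>2) + 2 * (weight s z * (cmod (?e z))\<^sup>2)"
      by (simp add: algebra_simps)
    finally have "ennreal (weight s z * (cmod (h z))\<^sup>2)
        \<le> ennreal (2 * (weight s z * (cmod (p 1 z))\<^sup>2) + 2 * (weight s z * (cmod (?e z))\<^sup>2))"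
      by (rule ennreal_leI)
    then show "ennreal (weight s z * (cmod (h z))\<^sup>2)
        \<le> 2 * ennreal (weight s z * (cmod (p 1 z))\<^sup>2) + 2 * ennreal (weight s z * (cmod (?e z))\<^sup>2)"
      by (simp add: ennreal_plus weight_nonneg ennreal_mult)
  qed
  also have "\<dots> = 2 * ?I (p 1) + 2 * ?I (?e)"
    by (subst nn_integral_add) (auto simp: nn_integral_cmult)
  also have "\<dots> \<le> 2 * ?M + 2 * (ennreal (32 * 4 ^ m) * ?M)"
    by (intro add_mono mult_left_mono pw order_trans[OF ext_op_weight_le[OF _ s m(2)]]) auto
  also have "\<dots> = ennreal ((2 + 2 * (32 * 4 ^ m)) * 2 powr (s + 1) * N)"
  proof -
    have "ennreal ((2 + 2 * (32 * 4 ^ m)) * 2 powr (s + 1) * N)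
        = ennreal (2 * (2 powr (s + 1) * N) + 2 * ((32 * 4 ^ m) * (2 powr (s + 1) * N)))"
      by (simp add: algebra_simps)
    also have "\<dots> = 2 * ?M + 2 * (ennreal (32 * 4 ^ m) * ?M)"
    proof -
      have "ennreal (2 * X + 2 * (Y * X)) = 2 * ennreal X + 2 * (ennreal Y * ennreal X)" if
          "X \<ge> 0" "Y \<ge> 0" for X Y
        using that by (simp add: ennreal_plus ennreal_mult)
      then show ?thesis using N0 by (simp only: mult_nonneg_nonneg powr_ge_zero zero_le_power
          zero_le_numeral)
    qed
    finally show ?thesis ..
  qed
  finally have I_le: "?I (fourier F) \<le> ennreal ((2 + 2 * (32 * 4 ^ m)) * 2 powr (s + 1) * N)" .
  have fF[measurable]: "fourier F \<in> borel_measurable borel" by (rule fourier_measurable[OF F F_fin])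
  have w_eq: "(\<lambda>(k1, k2). (1 + k1\<^sup>2 + k2\<^sup>2) powr s * (cmod (fourier F (k1, k2)))\<^sup>2)
      = (\<lambda>z. weight s z * (cmod (fourier F z))\<^sup>2)"
    by (auto simp: weight_def fun_eq_iff)
  have w_int: "integrable lborel (\<lambda>z. weight s z * (cmod (fourier F z))\<^sup>2)"
    by (rule integrableI_nonneg) (use I_le in \<open>auto simp: weight_nonneg intro: le_less_trans\<close>)
  have trunc: "on_half (solution_trunc g t n) = (on_half (ft 1 (\<Phi> n)))" for n
  proof
    fix z :: "real \<times> real"
    show "on_half (solution_trunc g t n) z = on_half (ft 1 (\<Phi> n)) z"
    proof (cases "z \<in> half_plane")
      case True
      then obtain x y where z: "z = (x, y)" "y > 0" by (auto simp: half_plane_def)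
      have "solution_trunc g t n z = ft 1 (\<Phi> n) z"
        unfolding z(1) \<Phi>_def
        by (rule solution_trunc_eq_ft[OF G G_def m(1) _ _ z(2)]) (use fin1 fin2 in \<open>auto simp:
            p_def\<close>)
      then show ?thesis by simp
    qed simp
  qed
  have "F \<in> sobolev s"
    unfolding sobolev_def mem_Collect_eq w_eq L2_on_UNIV_iff using F F_fin w_int by blast
  moreover have F_half: "F \<in> L2_on half_plane"
    unfolding L2_on_half_plane_iff using sq_norm_half_plane_le F_fin by (auto intro: le_less_trans)
  moreover have "L2_limit half_plane (solution_trunc g t) F"
    unfolding L2_limit_half_plane_iff
  proof
    show "F \<in> L2_on half_plane" by (rule F_half)
    show "mean_limit lborel (\<lambda>n. on_half (solution_trunc g t n)) (on_half F)"
    proof (rule tendsto_0_ennreal_bound[OF F_lim])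
      fix n
      have "(\<lambda>z. on_half (solution_trunc g t n) z - on_half F z)
          = (on_half (\<lambda>z. ft 1 (\<Phi> n) z - F z))"
        using fun_cong[OF trunc, of _ n] by (auto simp: fun_eq_iff scaleR_diff_right)
      then show "sq_norm2 (\<lambda>z. on_half (solution_trunc g t n) z - on_half F z)
          \<le> sq_norm2 (\<lambda>z. ft 1 (\<Phi> n) z - F z)"
        by (simp only: sq_norm_half_plane_le)
    qed
  qed
  moreover have "on_half (solution_trunc g t n) \<in> borel_measurable borel" for n
    unfolding trunc by measurable
  moreover have "sobolev_norm s F \<le> sqrt ((2 + 2 * (32 * 4 ^ m)) * 2 powr (s + 1)) * B_norm s g"
  proof -
    let ?K = "(2 + 2 * (32 * 4 ^ m)) * 2 powr (s + 1) :: real"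
    have K: "?K \<ge> 0" by simp
    have bn: "bourgain_norm a b g \<ge> 0" for a b
      unfolding bourgain_norm_def by (simp add: integral_nonneg_AE bourgain_density_nonneg)
    have "ennreal (\<integral>z. weight s z * (cmod (fourier F z))\<^sup>2 \<partial>lborel) \<le> ennreal (?K * N)"
      using I_le by (subst nn_integral_eq_integral[OF w_int, symmetric]) (auto simp: weight_nonneg)
    then have "(\<integral>z. weight s z * (cmod (fourier F z))\<^sup>2 \<partial>lborel) \<le> ?K * N"
      using N0 K by (subst (asm) ennreal_le_iff) auto
    then have "sobolev_norm s F \<le> sqrt (?K * N)"
      unfolding sobolev_norm_def w_eq by simp
    also have "\<dots> = sqrt ?K * sqrt N" by (rule real_sqrt_mult)
    also have "sqrt N \<le> B_norm s g"
      unfolding N_def B_norm_def using bn by (intro sqrt_sum_squares_le_sum) auto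
    finally show ?thesis by (simp add: mult_left_mono)
  qed
  ultimately show thesis by (rule that)
qed

theorem theorem2p1:
  fixes s :: real
  assumes "s \<ge> 0"
  shows "\<exists>c>0. \<forall>g. g \<in> B_space s \<and> ess_supp g \<subseteq> UNIV \<times> {0<..<2} \<longrightarrow>
     (\<exists>v. solution_formula g v) \<and>
     (\<forall>v. solution_formula g v \<longrightarrow>
        (\<forall>t\<in>{0..2}. v t \<in> sobolev_half s) \<and>
        (SUP t\<in>{0..2}. ennreal (sobolev_half_norm s (v t))) \<le> ennreal (c * B_norm s g))"
proof -
  (* m \<ge> s makes the extension operator bounded with the weight of order s, and
     m \<ge> 1 makes its symbol integrable *)
  define m where "m = Suc (nat \<lceil>s\<rceil>)"
  have m: "m \<ge> 1" "s \<le> real m" using assms unfolding m_def by linarith+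
  define c where "c = sqrt ((2 + 2 * (32 * 4 ^ m)) * 2 powr (s + 1))"
  have "c > 0" unfolding c_def by (auto intro!: mult_pos_pos add_pos_pos)
  moreover have "(\<exists>v. solution_formula g v) \<and>
     (\<forall>v. solution_formula g v \<longrightarrow>
        (\<forall>t\<in>{0..2}. v t \<in> sobolev_half s) \<and>
        (SUP t\<in>{0..2}. ennreal (sobolev_half_norm s (v t))) \<le> ennreal (c * B_norm s g))"
    if g: "g \<in> B_space s" for g
  proof -
    have "\<exists>F. F \<in> sobolev s \<and> L2_limit half_plane (solution_trunc g t) F \<and>
        (\<forall>n. on_half (solution_trunc g t n) \<in> borel_measurable borel) \<and>
        sobolev_norm s F \<le> c * B_norm s g" for t
      unfolding c_def by (rule solution_extension[OF assms m g, of t]) blast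
    then obtain F where F: "\<And>t. F t \<in> sobolev s" "\<And>t. L2_limit half_plane (solution_trunc g t)
        (F t)"
      "\<And>t n. on_half (solution_trunc g t n) \<in> borel_measurable borel"
      "\<And>t. sobolev_norm s (F t) \<le> c * B_norm s g"
      by metis
    have "v t \<in> sobolev_half s \<and> sobolev_half_norm s (v t) \<le> c * B_norm s g"
      if v: "solution_formula g v" and t: "t \<in> {0..2}" for v t
    proof -
      have lim: "L2_limit half_plane (solution_trunc g t) (v t)"
        using v t by (simp add: solution_formula_def)
      have "AE z in lborel. z \<in> half_plane \<longrightarrow> F t z = v t z"
        by (rule L2_limit_half_plane_unique[OF F(2) lim F(3)])
      then have ext: "F t \<in> sobolev_extensions s (v t)"
        using F(1) by (simp add: sobolev_extensions_def)
      have "v t \<in> L2_on half_plane" using lim by (simp add: L2_limit_def)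
      then have "v t \<in> sobolev_half s" using ext by (auto simp: sobolev_half_def)
      moreover have "sobolev_half_norm s (v t) \<le> sobolev_norm s (F t)"
        unfolding sobolev_half_norm_def
      proof (rule cINF_lower[OF _ ext])
        have "0 \<le> sobolev_norm s H" for H
          unfolding sobolev_norm_def by (auto intro!: integral_nonneg_AE)
        then show "bdd_below (sobolev_norm s ` sobolev_extensions s (v t))"
          by (intro bdd_belowI[of _ 0]) auto
      qed
      ultimately show ?thesis using F(4)[of t] by simp
    qed
    moreover have "solution_formula g F" using F(2) by (simp add: solution_formula_def)
    ultimately show ?thesis by (auto intro!: SUP_least ennreal_leI)
  qed
  ultimately show ?thesis by blast
qed

end
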